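(* Let $q$ be a sufficiently large prime and let $k\geq 2$ be a real number. For a Dirichlet character $\chi$ modulo $q$ let $\kappa=\kappa(\chi)=(1-\chi(-1))/2$ and \begin{equation*} \theta(x,\chi)=\sum_{n=1}^{\infty} \chi(n) n^{\kappa} e^{-\pi n^2 x/q}. \end{equation*} Let $X_q^+$ be the set of even characters modulo $q$ and $X_q^-$ the set of odd characters modulo $q$. Then \begin{equation*} \frac{1}{\phi(q)}\sum_{\chi \in X_q^+\setminus \{ \chi_0\} } |\theta(1,\chi)|^{2k} \gg_k q^{k/2}(\log q)^{(k-1)^2} \end{equation*} and \begin{equation*} \frac{1}{\phi(q)}\sum_{\chi \in X_q^- } |\theta(1,\chi)|^{2k} \gg_k q^{3k/2}(\log q)^{(k-1)^2}. \end{equation*}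
   Context: A Dirichlet character $\chi$ is even if $\chi(-1)=1$ and odd if $\chi(-1)=-1$; $\chi_0$ is the principal character modulo $q$, and $\phi$ is Euler's totient function. $A\gg_k B$ means $A\geq c(k)B$ for some constant $c(k)>0$ depending only on $k$. *)

theory Defs
  imports "HOL-Analysis.Analysis" "HOL-Number_Theory.Number_Theory"
begin

text \<open>
  A Dirichlet character modulo \<open>q\<close> is a function on all the integers (extended by zero off the
  residues coprime to \<open>q\<close>), so that \<open>chi (-1)\<close> makes sense.
  Periodicity, multiplicativity and the exact zero set imply \<open>chi 1 = 1\<close>.
\<close>

definition dirichlet_character :: "nat \<Rightarrow> (int \<Rightarrow> complex) \<Rightarrow> bool" where
  "dirichlet_character q chi \<longleftrightarrow>
     (\<forall>n. chi (n + int q) = chi n) \<and>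
     (\<forall>m n. chi (m * n) = chi m * chi n) \<and>
     (\<forall>n. chi n \<noteq> 0 \<longleftrightarrow> coprime n (int q))"

definition principal_character :: "nat \<Rightarrow> int \<Rightarrow> complex" where
  "principal_character q n = (if coprime n (int q) then 1 else 0)"

definition even_characters :: "nat \<Rightarrow> (int \<Rightarrow> complex) set" where
  "even_characters q = {chi. dirichlet_character q chi \<and> chi (-1) = 1}"

definition odd_characters :: "nat \<Rightarrow> (int \<Rightarrow> complex) set" where
  "odd_characters q = {chi. dirichlet_character q chi \<and> chi (-1) = -1}"

text \<open>\<open>kappa chi\<close> is 0 for even and 1 for odd \<open>chi\<close>, but it has type \<^typ>\<open>complex\<close>.\<close>

definition kappa :: "(int \<Rightarrow> complex) \<Rightarrow> complex" where
  "kappa chi = (1 - chi (-1)) / 2"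

text \<open>The modulus is a parameter, because a function \<open>chi\<close> does not determine it.\<close>

definition theta :: "nat \<Rightarrow> real \<Rightarrow> (int \<Rightarrow> complex) \<Rightarrow> complex" where
  "theta q x chi = (\<Sum>\<^sub>\<infinity>n\<in>{1::nat..}.
     chi (int n) * of_nat n powr kappa chi * of_real (exp (- pi * (real n)\<^sup>2 * x / real q)))"

text \<open>Finiteness matters because \<^const>\<open>sum\<close> is 0 on infinite sets.\<close>

lemma dirichlet_character_mod:
  assumes "dirichlet_character q chi"
  shows "chi (n mod int q) = chi n"
proof -
  have per: "chi (m + int q) = chi m" for m
    using assms by (simp add: dirichlet_character_def)
  have nat_per: "chi (m + int j * int q) = chi m" for m j
  proof (induction j)
    case (Suc j)
    have "m + int (Suc j) * int q = (m + int j * int q) + int q"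
      by (simp add: algebra_simps)
    with Suc per show ?case by metis
  qed simp
  show ?thesis
  proof (cases "n div int q \<ge> 0")
    case True
    have "n = n mod int q + int (nat (n div int q)) * int q"
      using True by simp
    with nat_per show ?thesis by metis
  next
    case False
    have "n mod int q = n + int (nat (- (n div int q))) * int q"
      using False by (simp add: minus_div_mult_eq_mod [symmetric])
    with nat_per show ?thesis by metis
  qed
qed

lemma dirichlet_character_power:
  assumes "dirichlet_character q chi"
  shows "chi (n ^ j) = chi n ^ j"
proof (induction j)
  case 0
  have "chi 1 * chi 1 = chi 1" "chi 1 \<noteq> 0"
    using assms unfolding dirichlet_character_def by (metis mult_1, simp)
  then show ?case by simp
qed (use assms in \<open>simp add: dirichlet_character_def\<close>)

lemma finite_dirichlet_characters:
  assumes "q > 0"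
  shows "finite {chi. dirichlet_character q chi}"
proof -
  define R where "R = insert 0 {z::complex. z ^ totient q = 1}"
  have "finite R"
    unfolding R_def using assms by (simp add: finite_roots_unity Suc_leI)
  have val: "chi n \<in> R" if "dirichlet_character q chi" for chi n
  proof (cases "coprime n (int q)")
    case True
    define a where "a = nat (n mod int q)"
    have a: "int a = n mod int q" using assms by (simp add: a_def)
    have "coprime (int a) (int q)"
      using True assms by (simp add: a)
    then have "[a ^ totient q = 1] (mod q)"
      by (intro euler_theorem) simp
    then have "[int a ^ totient q = 1] (mod int q)"
      by (metis cong_int_iff of_nat_1 of_nat_power)
    then have "chi (int a ^ totient q) = chi (1 ^ 0)"
      by (metis cong_def dirichlet_character_mod that power_0)
    then have "chi (int a) ^ totient q = 1"
      using dirichlet_character_power [OF that] by (metis power_0)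
    then show ?thesis
      by (simp add: R_def a dirichlet_character_mod [OF that])
  next
    case False
    with that show ?thesis by (auto simp: R_def dirichlet_character_def)
  qed
  show ?thesis
  proof (rule finite_imageD)
    show "finite ((\<lambda>chi. restrict chi {0..<int q}) ` {chi. dirichlet_character q chi})"
      by (rule finite_subset [where B = "{0..<int q} \<rightarrow>\<^sub>E R"])
         (auto simp: val \<open>finite R\<close> intro!: finite_PiE)
    show "inj_on (\<lambda>chi. restrict chi {0..<int q}) {chi. dirichlet_character q chi}"
    proof (rule inj_onI, rule ext)
      fix chi psi n
      assume *: "chi \<in> {chi. dirichlet_character q chi}" "psi \<in> {chi. dirichlet_character q chi}"
        "restrict chi {0..<int q} = restrict psi {0..<int q}"
      have "n mod int q \<in> {0..<int q}" using assms by simp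
      then have "chi (n mod int q) = psi (n mod int q)"
        using *(3) by (metis restrict_apply')
      then show "chi n = psi n"
        using *(1,2) by (simp add: dirichlet_character_mod)
    qed
  qed
qed

end

(* Let W be the sum, over j with |j| < J, of |A_t|^2 with t = j / J. Here J is a power of 2 of order
   log q and A_t is a Dirichlet polynomial of length a small power of q that imitates
   F_t^(k - 1), where F_t is the product of (1 - chi(p) p^(-1/2 - it))^(-1) over the primes p. By
   Hoelder's inequality a lower bound for the mean of |theta|^2 W and an upper bound for the mean of
   W^(k / (k - 1)) give a lower bound for the 2k-th moment of theta. The average over t is what
   makes the power of log q sharp.

   The primes are cut into blocks (2^(2^i), 2^(2^(i + 1))], over each of which 1 / p has a bounded sum.
   A_t is the product of truncated exponential series of the block sums, the truncation growing
   linearly with the distance from the last block, so that the length of A_t is a small power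
   of q while the truncation errors form a convergent series.

   Upper bound: since 1 / (k - 1) <= 1, W^(k / (k - 1)) is at most the sum of
   |A_t|^2 |A_s|^(2 / (k - 1)) over pairs (t, s). Blockwise this is bounded pointwise by squares of short
   Dirichlet polynomials, whose means are computed by orthogonality. They decay like |j - l|^(-2(k - 1)),
   which is summable, because the sum of cos(u log p) / p is log (1 / |u|) + O(1); this follows from the
   Euler product and the pole of zeta at 1.

   Lower bound: averaging over t with Fejer weights makes all terms of the mean of |theta|^2 W
   nonnegative, and leaves a sum of squares B_N^2 of divisor sums. Cauchy-Schwarz against
   k^(omega(N)) N^(-1/2) reduces it to the sum of (k^2 - 1)^(omega(r)) / r over squarefree r. *)

theory Submission
  imports Defs
begin

section \<open>Orthogonality of the even and of the odd characters\<close>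

text \<open>Why (k - 1)^2: up to the factor q^(1/4 + kappa/2), theta is an average of L(1/2 + it,
  chi) over bounded t. A peak of L has width 1 / log q, |L|^(2k) has mean of order (log q)^(k^2),
  and about log q positions are available for the peak; this gives (log q)^(k^2 - 2k + 1). A
  resonator at a single t sees one position and loses a factor log q. Bookkeeping, up to constants
  and with J of order log q: the mean of W^(k/(k-1)) is at most J^(k^2 + 1), the mean of |theta|^2 W
  is at least q^(1/2 + kappa) J^(k^2 - 1), and k (k^2 - 1) - (k - 1)(k^2 + 1) = (k - 1)^2. No
  L-function of a character is used, only orthogonality, which is exact as long as all lengths stay
  below q/2. Cutting theta at q^(2/3) costs a bounded error, and a resonator of length at most
  q^(1/16) keeps every product below that limit. The same shortness bounds W pointwise by a small
  power of q, which disposes of the truncation error and of the principal character.\<close>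

lemma sum_powers_of_roots_of_unity:
  assumes "N > 0"
  shows "(\<Sum>z | z ^ N = (1::complex). z ^ i) = (if N dvd i then of_nat N else 0)"
proof -
  let ?R = "{z::complex. z ^ N = 1}"
  show ?thesis
  proof (cases "N dvd i")
    case True
    then obtain m where m: "i = N * m" by auto
    have "(\<Sum>z\<in>?R. z ^ i) = (\<Sum>z\<in>?R. 1)" by (rule sum.cong) (auto simp: m power_mult)
    then show ?thesis using True card_roots_unity_eq[OF assms] by simp
  next
    case False
    define w where "w = cis (2 * pi / real N)"
    have wN: "w ^ N = 1" using assms by (simp add: w_def Complex.DeMoivre)
    have wi: "w ^ i \<noteq> 1"
    proof
      assume "w ^ i = 1"
      then have "cis (2 * pi * real i / real N) = 1" by (simp add: w_def Complex.DeMoivre field_simps)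
      then have "cos (2 * pi * real i / real N) = 1" by (simp add: complex_eq_iff)
      then obtain n :: int where "2 * pi * real i / real N = of_int n * 2 * pi"
        by (auto simp: cos_one_2pi_int)
      then have "real i = of_int n * real N" using assms by (simp add: field_simps)
      then have "int i = n * int N" by (metis of_int_eq_iff of_int_mult of_int_of_nat_eq)
      then have "int N dvd int i" by simp
      with False show False by auto
    qed
    have "w \<noteq> 0" using wN assms by (auto simp: power_0_left)
    \<comment> \<open>Multiplication by the primitive root \<open>w\<close> permutes the roots of
      unity, so the sum is fixed by a factor \<open>w ^ i\<close> different from 1.\<close>
    have "(\<Sum>z\<in>?R. z ^ i) = (\<Sum>z\<in>?R. (w * z) ^ i)"
      by (rule sum.reindex_bij_witness[of _ "\<lambda>z. w * z" "\<lambda>z. z / w"])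
         (use \<open>w \<noteq> 0\<close> wN in \<open>auto simp: power_mult_distrib power_divide\<close>)
    also have "\<dots> = w ^ i * (\<Sum>z\<in>?R. z ^ i)" by (simp add: power_mult_distrib sum_distrib_left)
    finally have "(w ^ i - 1) * (\<Sum>z\<in>?R. z ^ i) = 0" by (simp add: algebra_simps)
    then show ?thesis using wi False by simp
  qed
qed

lemma dirichlet_character_1: "dirichlet_character q chi \<Longrightarrow> chi 1 = 1"
  using dirichlet_character_power[of q chi 1 0] by simp

lemma dirichlet_character_cong:
  assumes "dirichlet_character q chi" "[a = b] (mod int q)"
  shows "chi a = chi b"
  using assms by (metis cong_def dirichlet_character_mod)

lemma norm_dirichlet_character:
  assumes "dirichlet_character q chi" "coprime n (int q)" "q > 0"
  shows "cmod (chi n) = 1"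
proof -
  define a where "a = nat (n mod int q)"
  have a: "int a = n mod int q" using assms by (simp add: a_def)
  have "coprime (int a) (int q)"
    using assms by (simp add: a)
  then have "[a ^ totient q = 1] (mod q)"
    by (intro euler_theorem) simp
  then have "[int a ^ totient q = 1] (mod int q)"
    by (metis cong_int_iff of_nat_1 of_nat_power)
  then have "chi (int a) ^ totient q = 1"
    using dirichlet_character_cong[OF assms(1)] dirichlet_character_power[OF assms(1)] dirichlet_character_1[OF assms(1)]
    by metis
  then have "chi n ^ totient q = 1" by (simp add: a dirichlet_character_mod[OF assms(1)])
  moreover have "totient q > 0" using assms by simp
  ultimately show ?thesis by (metis norm_one norm_power power_eq_1_iff norm_ge_zero less_numeral_extra(3))
qed

text \<open>The residues modulo a prime form a cyclic group. A character is determined by its value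
  at a primitive root \<open>g\<close>, and every (q - 1)-th root of unity occurs as this value, so
  the sum over characters becomes a sum of powers of roots of unity.\<close>

lemma sum_dirichlet_characters:
  assumes "prime q" "coprime n (int q)"
  shows "(\<Sum>chi | dirichlet_character q chi. chi n) = (if [n = 1] (mod int q) then of_nat (q - 1) else 0)"
proof -
  have q: "q > 1" using assms prime_gt_1_nat by blast
  have tot: "totient q = q - 1" using assms by (simp add: totient_prime)
  obtain g where g: "residue_primroot q g"
    using prime_primitive_root_exists[of q] assms q prime_gt_1_nat by (auto)
  have bij: "bij_betw (\<lambda>i. g ^ i mod q) {..<q-1} (totatives q)"
    using residue_primroot_is_generator[OF q g] tot by simp
  have cg: "coprime (int g) (int q)"
    using g by (auto simp: residue_primroot_def coprime_commute)
  have gcong: "[int g ^ i = int g ^ j] (mod int q) \<longleftrightarrow> [i = j] (mod (q - 1))" for i j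
  proof -
    have "ord q g = q - 1" "coprime q g" using g tot by (auto simp: residue_primroot_def)
    then have "[g ^ i = g ^ j] (mod q) \<longleftrightarrow> [i = j] (mod (q - 1))"
      using order_divides_expdiff by metis
    then show ?thesis by (metis cong_int_iff of_nat_power)
  qed
  have ex: "\<exists>i. [int g ^ i = m] (mod int q)" if "coprime m (int q)" for m
  proof -
    have "nat (m mod int q) \<in> totatives q"
    proof -
      have c: "coprime (m mod int q) (int q)" using that q by simp
      have "m mod int q \<noteq> 0"
        using c q by (auto)
      then have "m mod int q > 0" using q by (simp add: order_less_le)
      moreover have "nat (m mod int q) \<le> q" using q pos_mod_bound[of "int q" m] by linarith
      moreover have "coprime (nat (m mod int q)) q"
        using c \<open>m mod int q > 0\<close> by (metis coprime_int_iff int_nat_eq less_imp_le)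
      ultimately show ?thesis by (auto simp: totatives_def)
    qed
    then obtain i where "g ^ i mod q = nat (m mod int q)"
      using bij unfolding bij_betw_def by (metis (mono_tags, lifting) imageE)
    then have "int (g ^ i mod q) = m mod int q" using q by simp
    then have "[int g ^ i = m] (mod int q)"
      by (simp add: cong_def zmod_int)
    then show ?thesis by blast
  qed
  \<comment> \<open>The discrete logarithm to base \<open>g\<close>. It is determined only modulo q
    - 1, which is all that matters for powers of a (q - 1)-th root of unity.\<close>
  define ind where "ind m = (SOME i. [int g ^ i = m] (mod int q))" for m
  have ind: "[int g ^ ind m = m] (mod int q)" if "coprime m (int q)" for m
    unfolding ind_def using someI_ex[OF ex[OF that]] .
  let ?R = "{z::complex. z ^ (q - 1) = 1}"
  define ch where "ch z m = (if coprime m (int q) then z ^ ind m else 0)" for z :: complex and m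
  have zcong: "z ^ i = z ^ j" if "z \<in> ?R" "[i = j] (mod (q - 1))" for z i j
  proof -
    have "z ^ i = z ^ (i mod (q - 1))" for i
    proof -
      have "z ^ i = z ^ ((q - 1) * (i div (q - 1)) + i mod (q - 1))" by simp
      then show ?thesis using that(1) unfolding power_add power_mult by simp
    qed
    with that show ?thesis by (metis cong_def)
  qed
  have chdc: "dirichlet_character q (ch z)" if z: "z \<in> ?R" for z
    unfolding dirichlet_character_def
  proof (intro conjI allI)
    fix m n
    have "z \<noteq> 0" using z q by (auto simp: power_0_left)
    show "ch z m \<noteq> 0 \<longleftrightarrow> coprime m (int q)" for m using \<open>z \<noteq> 0\<close> by (simp add: ch_def)
    show "ch z (m * n) = ch z m * ch z n"
    proof (cases "coprime m (int q) \<and> coprime n (int q)")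
      case True
      then have "[int g ^ ind (m * n) = int g ^ (ind m + ind n)] (mod int q)"
        using ind[of "m*n"] ind[of m] ind[of n]
        by (metis coprime_mult_left_iff cong_mult cong_sym cong_trans power_add)
      then have "z ^ ind (m*n) = z ^ (ind m + ind n)" using zcong[OF z] gcong by blast
      then show ?thesis using True by (simp add: ch_def power_add)
    qed (auto simp: ch_def)
    show "ch z (m + int q) = ch z m"
    proof (cases "coprime m (int q)")
      case True
      then have c2: "coprime (m + int q) (int q)"
        by (metis coprime_iff_gcd_eq_1 gcd_add1)
      have "[int g ^ ind (m + int q) = int g ^ ind m] (mod int q)"
        using ind[OF True] ind[OF c2] by (metis cong_def mod_add_self2)
      then show ?thesis using zcong[OF z] gcong True c2 by (simp add: ch_def)
    next
      case False
      then have c2: "\<not>coprime (m + int q) (int q)"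
        by (metis coprime_iff_gcd_eq_1 gcd_add1)
      with False show ?thesis by (simp add: ch_def)
    qed
  qed
  have chg: "ch z (int g) = z" if z: "z \<in> ?R" for z
  proof -
    have "[int g ^ ind (int g) = int g ^ 1] (mod int q)" using ind[OF cg] by simp
    then have "z ^ ind (int g) = z ^ 1" using zcong[OF z] gcong by blast
    then show ?thesis using cg by (simp add: ch_def)
  qed
  have gR: "chi (int g) \<in> ?R" if "dirichlet_character q chi" for chi
  proof -
    have "[int g ^ (q-1) = int g ^ 0] (mod int q)" using gcong[of "q-1" 0] by (simp add: cong_def)
    then have "chi (int g ^ (q - 1)) = chi 1" using dirichlet_character_cong[OF that] by simp
    then show ?thesis by (simp add: dirichlet_character_power[OF that] dirichlet_character_1[OF that])
  qed
  have chi_eq: "chi m = ch (chi (int g)) m" if "dirichlet_character q chi" for chi m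
  proof (cases "coprime m (int q)")
    case True
    have "chi m = chi (int g ^ ind m)" using dirichlet_character_cong[OF that] ind[OF True] by (metis)
    then show ?thesis using True by (simp add: ch_def dirichlet_character_power[OF that])
  next
    case False
    then show ?thesis using that by (auto simp: ch_def dirichlet_character_def)
  qed
  have "(\<Sum>chi | dirichlet_character q chi. chi n) = (\<Sum>z\<in>?R. ch z n)"
    by (rule sum.reindex_bij_witness[of _ ch "\<lambda>chi. chi (int g)"])
       (use chdc chg gR chi_eq in auto)
  also have "\<dots> = (\<Sum>z\<in>?R. z ^ ind n)" using assms by (simp add: ch_def)
  also have "\<dots> = (if (q-1) dvd ind n then of_nat (q-1) else 0)"
    using sum_powers_of_roots_of_unity[of "q-1" "ind n"] q by simp
  also have "(q-1) dvd ind n \<longleftrightarrow> [n = 1] (mod int q)"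
  proof -
    have "(q-1) dvd ind n \<longleftrightarrow> [ind n = 0] (mod (q-1))" by (simp add: cong_0_iff)
    also have "\<dots> \<longleftrightarrow> [int g ^ ind n = 1] (mod int q)" using gcong[of "ind n" 0] by simp
    also have "\<dots> \<longleftrightarrow> [n = 1] (mod int q)" using ind[OF assms(2)] by (metis cong_sym cong_trans)
    finally show ?thesis .
  qed
  finally show ?thesis by simp
qed

lemma finite_even_odd_characters:
  assumes "q > 0"
  shows "finite (even_characters q)" "finite (odd_characters q)"
  using finite_dirichlet_characters[OF assms]
  by (auto simp: even_characters_def odd_characters_def elim: finite_subset[rotated])

text \<open>Below \<open>q / 2\<close> the congruence \<open>a \<equiv> -b\<close> has no solutions, so the even and the odd characters
  satisfy the same orthogonality relation.\<close>

lemma character_orthogonality: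
  assumes q: "prime q" "q > 2" and X: "X = even_characters q \<or> X = odd_characters q"
    and ab: "0 < a" "0 < b" "2 * a < q" "2 * b < q"
  shows "(\<Sum>chi\<in>X. chi (int a) * cnj (chi (int b))) = (if a = b then of_nat (q - 1) / 2 else 0)"
proof -
  have q0: "q > 0" using q by simp
  let ?C = "{chi. dirichlet_character q chi}"
  have fin: "finite ?C" using finite_dirichlet_characters q0 by blast
  have cop: "coprime (int m) (int q)" if "0 < m" "m < q" for m
    using that q by (metis coprime_commute coprime_int_iff nat_dvd_not_less prime_imp_coprime)
  have cb: "coprime (int b) (int q)" and ca: "coprime (int a) (int q)" using ab cop by auto
  obtain b' where b': "[int b * b' = 1] (mod int q)"
    using cong_solve_coprime_int[OF cb] by blast
  have cb': "coprime b' (int q)" using b'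
    by (metis cong_imp_coprime cong_sym coprime_1_left coprime_mult_left_iff)
  have cnj: "cnj (chi (int b)) = chi b'" if "chi \<in> ?C" for chi
  proof -
    have dc: "dirichlet_character q chi" using that by simp
    have "chi (int b) * chi b' = 1"
      using dirichlet_character_cong[OF dc b'] dirichlet_character_1[OF dc] dc
      by (simp add: dirichlet_character_def)
    moreover have "chi (int b) * cnj (chi (int b)) = 1"
      using norm_dirichlet_character[OF dc cb q0] by (metis complex_norm_square of_real_1 power_one)
    ultimately show ?thesis
      by (metis mult.commute mult.left_commute mult_1_right)
  qed
  have val: "chi (-1) = 1 \<or> chi (-1) = -1" if "chi \<in> ?C" for chi
  proof -
    have dc: "dirichlet_character q chi" using that by simp
    have "chi (-1) * chi (-1) = chi ((-1) * (-1))" using dc unfolding dirichlet_character_def by metis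
    then have "chi (-1) * chi (-1) = 1" using dirichlet_character_1[OF dc] by simp
    then show ?thesis by (metis square_eq_1_iff)
  qed
  have c1: "[int a * b' = 1] (mod int q) \<longleftrightarrow> a = b"
  proof
    assume "[int a * b' = 1] (mod int q)"
    then have "[int a * b' * int b = 1 * int b] (mod int q)" by (rule cong_scalar_right)
    moreover have "[int a * (int b * b') = int a * 1] (mod int q)" using b' by (rule cong_scalar_left)
    ultimately have "[int a = int b] (mod int q)"
      by (metis (no_types, opaque_lifting) cong_sym cong_trans mult.assoc mult.commute mult_1)
    then show "a = b" using ab by (simp add: cong_int_iff cong_less_modulus_unique_nat)
  qed (use b' in auto)
  have c2: "\<not> [- (int a * b') = 1] (mod int q)"
  proof
    assume "[- (int a * b') = 1] (mod int q)"
    then have "[- (int a * b') * int b = 1 * int b] (mod int q)" by (rule cong_scalar_right)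
    moreover have "[- int a * (int b * b') = - int a * 1] (mod int q)" using b' by (rule cong_scalar_left)
    ultimately have "[- int a = int b] (mod int q)"
      by (metis (no_types, opaque_lifting) cong_sym cong_trans mult.assoc mult.commute mult_1 mult_minus_left)
    then have "int q dvd int a + int b"
      by (metis add.commute cong_iff_dvd_diff diff_minus_eq_add cong_sym)
    then have "q dvd a + b" by (metis of_nat_add of_nat_dvd_iff)
    then show False using ab by (auto dest: dvd_imp_le)
  qed
  have cc: "coprime (int a * b') (int q)" using ca cb' by simp
  have s1: "(\<Sum>chi\<in>?C. chi (int a * b')) = (if a = b then of_nat (q - 1) else 0)"
    using sum_dirichlet_characters[OF q(1) cc] c1 by simp
  have s2: "(\<Sum>chi\<in>?C. chi (- (int a * b'))) = 0"
    using sum_dirichlet_characters[OF q(1), of "- (int a * b')"] cc c2 by simp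
  define N :: complex where "N = of_nat (q - 1)"
  define e :: complex where "e = (if X = even_characters q then 1 else -1)"
  have neg: "chi (- m) = chi (-1) * chi m" if "chi \<in> ?C" for chi m
  proof -
    have "chi ((-1) * m) = chi (-1) * chi m" using that unfolding dirichlet_character_def by blast
    then show ?thesis by simp
  qed
  have ee: "e = 1 \<and> X = {chi\<in>?C. chi (-1) = 1} \<or> e = -1 \<and> X = {chi\<in>?C. chi (-1) = -1}"
    using X by (auto simp: e_def even_characters_def odd_characters_def)
  have XC: "X \<subseteq> ?C" using ee by auto
  have "(\<Sum>chi\<in>X. chi (int a) * cnj (chi (int b))) = (\<Sum>chi\<in>X. chi (int a * b'))"
    using XC cnj by (intro sum.cong) (auto simp: dirichlet_character_def)
  \<comment> \<open>The factor (1 + e * chi (-1)) / 2 is the indicator of \<open>X\<close> among all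
    characters, because chi (-1) is 1 or -1. The sum over a parity class thus reduces to two sums
    over all characters.\<close>
  also have "\<dots> = (\<Sum>chi\<in>?C. (chi (int a * b') + e * chi (- (int a * b'))) / 2)"
  proof (rule sum.mono_neutral_cong_left)
    show "\<forall>chi\<in>?C - X. (chi (int a * b') + e * chi (- (int a * b'))) / 2 = 0"
    proof
      fix chi assume c: "chi \<in> ?C - X"
      then have "e * chi (-1) = -1" using ee val[of chi] by auto
      then show "(chi (int a * b') + e * chi (- (int a * b'))) / 2 = 0"
        using neg[of chi "int a * b'"] c by (simp add: mult.assoc[symmetric])
    qed
    fix chi assume c: "chi \<in> X"
    then have "e * chi (-1) = 1" using ee by auto
    then show "chi (int a * b') = (chi (int a * b') + e * chi (- (int a * b'))) / 2"
      using neg[of chi "int a * b'"] c XC by (auto simp: mult.assoc[symmetric])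
  qed (use fin XC in auto)
  also have "\<dots> = ((\<Sum>chi\<in>?C. chi (int a * b')) + e * (\<Sum>chi\<in>?C. chi (- (int a * b')))) / 2"
    by (simp add: sum.distrib sum_distrib_left sum_divide_distrib [symmetric])
  finally have *: "(\<Sum>chi\<in>X. chi (int a) * cnj (chi (int b))) = ((if a = b then N else 0) + e * 0) / 2"
    unfolding s1 s2 N_def .
  show ?thesis unfolding * N_def[symmetric] by simp
qed

section \<open>Chebyshev and Mertens type bounds for primes\<close>

text \<open>The bound \<open>E\<close> on the exponents makes the set finite, so that Euler products
  expand into finite sums without any question of convergence.\<close>

definition smooth_numbers :: "nat set \<Rightarrow> nat \<Rightarrow> nat set" where
  "smooth_numbers S E = {n. n > 0 \<and> prime_factors n \<subseteq> S \<and> (\<forall>p\<in>S. multiplicity p n \<le> E)}"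

lemma smooth_numbers_bij_betw:
  assumes S: "finite S" "\<And>p. p \<in> S \<Longrightarrow> prime p"
  shows "bij_betw (\<lambda>g. \<Prod>p\<in>S. p ^ g p) (S \<rightarrow>\<^sub>E {..E}) (smooth_numbers S E)"
proof -
  have mult: "multiplicity p (\<Prod>p\<in>S. p ^ g p) = (if p \<in> S then g p else 0)" if "prime p" for p g
    using S that by (simp add: multiplicity_prod_prime_powers)
  have pos: "(\<Prod>p\<in>S. p ^ g p) > 0" for g :: "nat \<Rightarrow> nat"
    using S by (intro prod_pos) (auto simp: prime_gt_0_nat)
  show "bij_betw (\<lambda>g. \<Prod>p\<in>S. p ^ g p) (S \<rightarrow>\<^sub>E {..E}) (smooth_numbers S E)"
  proof (rule bij_betw_byWitness[where f' = "\<lambda>n. restrict (\<lambda>p. multiplicity p n) S"])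
    show "\<forall>g\<in>S \<rightarrow>\<^sub>E {..E}. restrict (\<lambda>p. multiplicity p (\<Prod>p\<in>S. p ^ g p)) S = g"
    proof
      fix g assume g: "g \<in> S \<rightarrow>\<^sub>E {..E}"
      show "restrict (\<lambda>p. multiplicity p (\<Prod>p\<in>S. p ^ g p)) S = g"
        using g S mult by (intro ext) (auto simp: restrict_def PiE_def extensional_def)
    qed
    show "\<forall>n\<in>smooth_numbers S E. (\<Prod>p\<in>S. p ^ restrict (\<lambda>p. multiplicity p n) S p) = n"
    proof
      fix n assume n: "n \<in> smooth_numbers S E"
      then have n0: "n > 0" and sub: "prime_factors n \<subseteq> S" by (auto simp: smooth_numbers_def)
      have "(\<Prod>p\<in>S. p ^ restrict (\<lambda>p. multiplicity p n) S p) = (\<Prod>p\<in>S. p ^ multiplicity p n)"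
        by (rule prod.cong) auto
      also have "\<dots> = (\<Prod>p\<in>prime_factors n. p ^ multiplicity p n)"
        using S sub n0
        by (intro prod.mono_neutral_right) (auto simp: prime_factors_multiplicity)
      also have "\<dots> = n" using prime_factorization_nat[OF n0] by simp
      finally show "(\<Prod>p\<in>S. p ^ restrict (\<lambda>p. multiplicity p n) S p) = n" .
    qed
    show "(\<lambda>g. \<Prod>p\<in>S. p ^ g p) ` (S \<rightarrow>\<^sub>E {..E}) \<subseteq> smooth_numbers S E"
    proof safe
      fix g assume g: "g \<in> S \<rightarrow>\<^sub>E {..E}"
      let ?n = "\<Prod>p\<in>S. p ^ g p"
      have "multiplicity p ?n \<le> E" if "p \<in> S" for p
        using mult[OF S(2)[OF that], of g] g that by (auto simp: PiE_def)
      moreover have "prime_factors ?n \<subseteq> S"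
        using mult[of _ g] by (auto simp: prime_factors_multiplicity split: if_splits)
      ultimately show "?n \<in> smooth_numbers S E" using pos by (simp add: smooth_numbers_def)
    qed
    show "(\<lambda>n. restrict (\<lambda>p. multiplicity p n) S) ` smooth_numbers S E \<subseteq> S \<rightarrow>\<^sub>E {..E}"
      by (auto simp: smooth_numbers_def)
  qed
qed

lemma finite_smooth_numbers:
  assumes "finite S" "\<And>p. p \<in> S \<Longrightarrow> prime p"
  shows "finite (smooth_numbers S E)"
  using bij_betw_finite[OF smooth_numbers_bij_betw[OF assms, where E = E]] assms
  by (simp add: finite_PiE)

text \<open>Expanding the product picks one exponent for each prime, and by unique factorization
  such choices are the same as numbers \<open>n\<close>.\<close>

lemma finite_euler_product:
  fixes h :: "nat \<Rightarrow> nat \<Rightarrow> 'a :: comm_semiring_1"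
  assumes S: "finite S" "\<And>p. p \<in> S \<Longrightarrow> prime p"
  shows "(\<Prod>p\<in>S. \<Sum>e\<le>E. h p e) = (\<Sum>n\<in>smooth_numbers S E. \<Prod>p\<in>S. h p (multiplicity p n))"
proof -
  have "(\<Prod>p\<in>S. \<Sum>e\<le>E. h p e) = (\<Sum>g\<in>S \<rightarrow>\<^sub>E {..E}. \<Prod>p\<in>S. h p (g p))"
    using S by (intro prod_sum_PiE) auto
  also have "\<dots> = (\<Sum>g\<in>S \<rightarrow>\<^sub>E {..E}. \<Prod>p\<in>S. h p (multiplicity p (\<Prod>p\<in>S. p ^ g p)))"
    using S by (intro sum.cong prod.cong refl) (simp add: multiplicity_prod_prime_powers)
  also have "\<dots> = (\<Sum>n\<in>smooth_numbers S E. \<Prod>p\<in>S. h p (multiplicity p n))"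
    using sum.reindex_bij_betw[OF smooth_numbers_bij_betw[OF S, where E = E]] by simp
  finally show ?thesis .
qed

text \<open>\<open>S\<close> may exceed the set of prime factors of \<open>n\<close>, the additional
  exponents being 0. In this form one set of primes serves all terms of a sum at once.\<close>

lemma completely_multiplicative_prod:
  fixes f :: "nat \<Rightarrow> 'a :: comm_semiring_1"
  assumes "f 1 = 1" "\<And>m n. m > 0 \<Longrightarrow> n > 0 \<Longrightarrow> f (m * n) = f m * f n"
    and S: "finite S" "prime_factors n \<subseteq> S" "n > 0" "\<And>p. p \<in> S \<Longrightarrow> prime p"
  shows "f n = (\<Prod>p\<in>S. f p ^ multiplicity p n)"
proof -
  have pw: "f (p ^ j) = f p ^ j" if "p > 0" for p j
    using that by (induction j) (use assms in auto)
  have pr: "f (\<Prod>p\<in>A. g p) = (\<Prod>p\<in>A. f (g p))" if "finite A" "\<And>p. p \<in> A \<Longrightarrow> g p > 0" for A and g :: "nat \<Rightarrow> nat"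
    using that
  proof (induction rule: finite_induct)
    case (insert x F)
    have "prod g F > 0" using insert by (intro prod_pos) auto
    then show ?case using insert assms(2)[of "g x" "prod g F"] by simp
  qed (use assms in auto)
  have "n = (\<Prod>p\<in>prime_factors n. p ^ multiplicity p n)" using S prime_factorization_nat by blast
  also have "\<dots> = (\<Prod>p\<in>S. p ^ multiplicity p n)"
    using S by (intro prod.mono_neutral_left) (auto simp: prime_factors_multiplicity)
  finally have "f n = f (\<Prod>p\<in>S. p ^ multiplicity p n)" by simp
  also have "\<dots> = (\<Prod>p\<in>S. f (p ^ multiplicity p n))"
    using S prime_gt_0_nat by (intro pr) auto
  also have "\<dots> = (\<Prod>p\<in>S. f p ^ multiplicity p n)"
    using S pw prime_gt_0_nat by (intro prod.cong) auto
  finally show ?thesis .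
qed

lemma multiplicity_le_self:
  assumes "prime p" "n > 0"
  shows "multiplicity p n \<le> (n::nat)"
proof -
  have "p ^ multiplicity p n \<le> n" using assms by (intro dvd_imp_le multiplicity_dvd) auto
  moreover have "multiplicity p n < 2 ^ multiplicity p n" by (rule less_exp)
  moreover have "2 ^ multiplicity p n \<le> p ^ multiplicity p n"
    using assms by (intro power_mono prime_ge_2_nat) auto
  ultimately show ?thesis by linarith
qed

lemma atLeastAtMost_subset_smooth_numbers:
  assumes "N \<le> E"
  shows "{1..N} \<subseteq> smooth_numbers {p. prime p \<and> p \<le> N} E"
proof
  fix n assume n: "n \<in> {1..N}"
  then have "p \<le> N" if "p \<in> prime_factors n" for p
    using that n dvd_imp_le[of p n] by (auto simp: in_prime_factors_iff)
  moreover have "multiplicity p n \<le> E" if "prime p" for p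
    using multiplicity_le_self[OF that, of n] n assms by auto
  ultimately show "n \<in> smooth_numbers {p. prime p \<and> p \<le> N} E"
    using n by (auto simp: smooth_numbers_def)
qed

lemma sum_inverse_prime_times_pred_le:
  "(\<Sum>p | prime p \<and> p \<le> N. 1 / (real p * (real p - 1))) \<le> 1"
proof -
  have "(\<Sum>p | prime p \<and> p \<le> N. 1 / (real p * (real p - 1))) \<le> (\<Sum>n=2..N. 1 / (real n * (real n - 1)))"
    by (rule sum_mono2) (auto dest: prime_ge_2_nat)
  also have "\<dots> \<le> 1 - 1 / real (max 1 N)"
  proof (induction N)
    case (Suc N)
    show ?case
    proof (cases "N \<ge> 1")
      case True
      have "(\<Sum>n=2..Suc N. 1 / (real n * (real n - 1))) = (\<Sum>n=2..N. 1 / (real n * (real n - 1))) + 1 / (real (Suc N) * real N)"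
        using True by simp
      also have "\<dots> \<le> 1 - 1 / real N + 1 / (real (Suc N) * real N)"
        using Suc True by (simp add: max_def)
      also have "\<dots> = 1 - 1 / real (Suc N)" using True by (simp add: divide_simps) (simp add: algebra_simps)
      finally show ?thesis by (simp add: max_def)
    qed auto
  qed auto
  also have "\<dots> \<le> 1" by simp
  finally show ?thesis .
qed

lemma sum_prime_powers_le:
  assumes "prime p"
  shows "(\<Sum>e\<le>N. (1 / real p) ^ e) \<le> 1 + (1 / real p + 1 / (real p * (real p - 1)))"
proof -
  have p2: "real p \<ge> 2" using prime_ge_2_nat[OF assms] by simp
  have "(\<Sum>e\<le>N. (1 / real p) ^ e) \<le> (\<Sum>e. (1 / real p) ^ e)"
    using p2 by (intro sum_le_suminf summable_geometric) auto
  also have "\<dots> = 1 / (1 - 1 / real p)" using p2 by (intro suminf_geometric) auto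
  also have "\<dots> = 1 + (1 / real p + 1 / (real p * (real p - 1)))" using p2 by (simp add: field_simps)
  finally show ?thesis .
qed

text \<open>Euler's argument: the harmonic sum is at most the Euler product, since every n up to N
  has all its prime factors up to N. The part of 1 / (1 - 1/p) beyond 1 + 1/p is 1 / (p (p - 1)),
  whose sum telescopes to at most 1.\<close>

lemma ln_le_exp_sum_inverse_primes:
  "ln (real N + 1) \<le> exp ((\<Sum>p | prime p \<and> p \<le> N. 1 / real p) + 1)"
proof -
  let ?S = "{p. prime p \<and> p \<le> N}"
  have fin: "finite ?S" by simp
  have "ln (real N + 1) \<le> harm N" by (rule ln_le_harm)
  also have "harm N = (\<Sum>n\<in>{1..N}. 1 / real n)" by (simp add: harm_def inverse_eq_divide)
  also have "\<dots> \<le> (\<Sum>n\<in>smooth_numbers ?S N. 1 / real n)"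
    by (rule sum_mono2) (use finite_smooth_numbers[OF fin] atLeastAtMost_subset_smooth_numbers[of N N] in auto)
  also have "\<dots> = (\<Sum>n\<in>smooth_numbers ?S N. \<Prod>p\<in>?S. (1 / real p) ^ multiplicity p n)"
    by (intro sum.cong refl completely_multiplicative_prod) (auto simp: smooth_numbers_def)
  also have "\<dots> = (\<Prod>p\<in>?S. \<Sum>e\<le>N. (1 / real p) ^ e)"
    using finite_euler_product[OF fin, where h = "\<lambda>p e. (1 / real p) ^ e"] by simp
  also have "\<dots> \<le> (\<Prod>p\<in>?S. exp (1 / real p + 1 / (real p * (real p - 1))))"
  proof (rule prod_mono, safe)
    fix p :: nat assume p: "prime p"
    show "(\<Sum>e\<le>N. (1 / real p) ^ e) \<ge> 0" by (intro sum_nonneg) simp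
    have "(\<Sum>e\<le>N. (1 / real p) ^ e) \<le> 1 + (1 / real p + 1 / (real p * (real p - 1)))"
      by (rule sum_prime_powers_le[OF p])
    also have "\<dots> \<le> exp (1 / real p + 1 / (real p * (real p - 1)))" by (rule exp_ge_add_one_self)
    finally show "(\<Sum>e\<le>N. (1 / real p) ^ e) \<le> exp (1 / real p + 1 / (real p * (real p - 1)))" .
  qed
  also have "\<dots> = exp ((\<Sum>p\<in>?S. 1 / real p) + (\<Sum>p\<in>?S. 1 / (real p * (real p - 1))))"
    by (simp add: exp_sum[symmetric] sum.distrib)
  also have "\<dots> \<le> exp ((\<Sum>p | prime p \<and> p \<le> N. 1 / real p) + 1)"
    using sum_inverse_prime_times_pred_le[of N] by simp
  finally show ?thesis .
qed

lemma prod_primes_dvd: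
  fixes n :: nat
  assumes "finite A" "\<And>p. p \<in> A \<Longrightarrow> prime p \<and> p dvd n"
  shows "\<Prod>A dvd n"
  using assms
proof (induction rule: finite_induct)
  case (insert p A)
  have "coprime p (\<Prod>A)"
    by (rule prod_coprime_right) (use insert in \<open>metis insert_iff primes_coprime\<close>)
  then show ?case using insert by (simp add: divides_mult)
qed auto

section \<open>Chebyshev's bound in dyadic ranges and in doubly exponential blocks\<close>

definition dyadic_primes :: "nat \<Rightarrow> nat set" where
  "dyadic_primes j = {p. prime p \<and> 2 ^ j < p \<and> p \<le> 2 ^ Suc j}"

text \<open>Chebyshev's bound: every prime in \<open>(n, 2n]\<close> divides the central binomial coefficient.\<close>

lemma card_dyadic_primes: "card (dyadic_primes j) * j \<le> 2 * 2 ^ j"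
proof -
  let ?n = "2 ^ j :: nat"
  let ?A = "dyadic_primes j"
  have fin: "finite ?A" by (auto simp: dyadic_primes_def intro: finite_subset[of _ "{..2 ^ Suc j}"])
  have dvd: "p dvd (2 * ?n choose ?n)" if "p \<in> ?A" for p
  proof -
    have p: "prime p" "?n < p" "p \<le> 2 * ?n" using that by (auto simp: dyadic_primes_def)
    have "fact ?n * fact (2 * ?n - ?n) * (2 * ?n choose ?n) = fact (2 * ?n)"
      by (rule binomial_fact_lemma) simp
    moreover have "p dvd fact (2 * ?n)" using p prime_dvd_fact_iff by blast
    moreover have "\<not> p dvd fact ?n" "\<not> p dvd fact (2 * ?n - ?n)"
      using p prime_dvd_fact_iff by auto
    ultimately show ?thesis using p by (metis prime_dvd_mult_iff)
  qed
  have "(2::nat) ^ (card ?A * j) = (\<Prod>p\<in>?A. ?n)" by (simp add: power_mult[symmetric] mult.commute)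
  also have "\<dots> \<le> \<Prod>?A" by (rule prod_mono) (auto simp: dyadic_primes_def)
  also have "\<Prod>?A \<le> (2 * ?n choose ?n)"
  proof (rule dvd_imp_le)
    show "\<Prod>?A dvd (2 * ?n choose ?n)"
      using fin dvd by (intro prod_primes_dvd) (auto simp: dyadic_primes_def)
  qed simp
  also have "\<dots> \<le> 2 ^ (2 * ?n)" by (rule binomial_le_pow2)
  finally show ?thesis by simp
qed

lemma sum_inverse_dyadic_primes:
  assumes "j > 0"
  shows "(\<Sum>p\<in>dyadic_primes j. 1 / real p) \<le> 2 / real j"
proof -
  have "(\<Sum>p\<in>dyadic_primes j. 1 / real p) \<le> (\<Sum>p\<in>dyadic_primes j. 1 / 2 ^ j)"
  proof (rule sum_mono)
    fix p assume "p \<in> dyadic_primes j"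
    then have "2 ^ j \<le> p" by (auto simp: dyadic_primes_def)
    then have "(2::real) ^ j \<le> real p" by (metis of_nat_le_iff of_nat_numeral of_nat_power)
    then show "1 / real p \<le> 1 / 2 ^ j" by (intro divide_left_mono) (auto intro!: mult_pos_pos simp: less_le_trans[of 0 "2 ^ j"])
  qed
  also have "\<dots> = real (card (dyadic_primes j) * j) / (2 ^ j * real j)" using assms by simp
  also have "\<dots> \<le> real (2 * 2 ^ j) / (2 ^ j * real j)"
    using card_dyadic_primes[of j] by (intro divide_right_mono) (auto simp del: of_nat_mult of_nat_power simp: of_nat_le_iff)
  also have "\<dots> = 2 / real j" by simp
  finally show ?thesis .
qed

text \<open>The prime 2 belongs to no block.\<close>

definition prime_block :: "nat \<Rightarrow> nat set" where
  "prime_block i = {p. prime p \<and> 2 ^ 2 ^ i < p \<and> p \<le> 2 ^ 2 ^ Suc i}"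

lemma finite_prime_block: "finite (prime_block i)"
  by (rule finite_subset[of _ "{..2 ^ 2 ^ Suc i}"]) (auto simp: prime_block_def)

text \<open>Block \<open>i\<close> is covered by the dyadic ranges with
  \<open>2 ^ i \<le> j < 2 ^ Suc i\<close>. There are \<open>2 ^ i\<close> of them and each
  contributes at most 2 / j, hence at most 2 / 2^i.\<close>

lemma sum_inverse_prime_block: "(\<Sum>p\<in>prime_block i. 1 / real p) \<le> 2"
proof -
  have fin: "finite (dyadic_primes j)" for j
    by (auto simp: dyadic_primes_def intro: finite_subset[of _ "{..2 ^ Suc j}"])
  have sub: "prime_block i \<subseteq> (\<Union>j\<in>{2 ^ i..<2 ^ Suc i}. dyadic_primes j)"
  proof
    fix p assume p: "p \<in> prime_block i"
    define P where "P j \<longleftrightarrow> p \<le> 2 ^ Suc j" for j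
    define j where "j = (LEAST j. P j)"
    have "P (2 ^ Suc i - 1)" using p by (auto simp: P_def prime_block_def)
    then have j: "P j" "j \<le> 2 ^ Suc i - 1" unfolding j_def by (auto intro: LeastI Least_le)
    have ji: "2 ^ i \<le> j"
    proof (rule ccontr)
      assume "\<not> 2 ^ i \<le> j"
      then have "(2::nat) ^ Suc j \<le> 2 ^ 2 ^ i" by (intro power_increasing) auto
      then show False using j p by (auto simp: P_def prime_block_def)
    qed
    then have "j > 0" by (metis less_le_trans zero_less_numeral zero_less_power)
    then have "\<not> P (j - 1)" unfolding j_def using not_less_Least by (metis diff_less j_def zero_less_one)
    then have "2 ^ j < p" using \<open>j > 0\<close> by (simp add: P_def)
    then have "p \<in> dyadic_primes j" using j p by (simp add: dyadic_primes_def P_def prime_block_def)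
    moreover have "j < 2 ^ Suc i" using j(2) by (metis One_nat_def Suc_diff_1 le_imp_less_Suc zero_less_numeral zero_less_power diff_Suc_1)
    ultimately show "p \<in> (\<Union>j\<in>{2 ^ i..<2 ^ Suc i}. dyadic_primes j)" using ji by auto
  qed
  have "(\<Sum>p\<in>prime_block i. 1 / real p) \<le> (\<Sum>p\<in>(\<Union>j\<in>{2 ^ i..<2 ^ Suc i}. dyadic_primes j). 1 / real p)"
    using sub fin by (intro sum_mono2) auto
  also have "\<dots> = (\<Sum>j\<in>{2 ^ i..<2 ^ Suc i}. \<Sum>p\<in>dyadic_primes j. 1 / real p)"
  proof (rule sum.UNION_disjoint)
    have "dyadic_primes j \<inter> dyadic_primes l = {}" if "j < l" for j l
    proof -
      have "(2::nat) ^ Suc j \<le> 2 ^ l" using that by (intro power_increasing) auto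
      then show ?thesis by (auto simp: dyadic_primes_def)
    qed
    then show "\<forall>j\<in>{2 ^ i..<2 ^ Suc i}. \<forall>l\<in>{2 ^ i..<2 ^ Suc i}. j \<noteq> l \<longrightarrow> dyadic_primes j \<inter> dyadic_primes l = {}"
      by (metis inf_commute nat_neq_iff)
  qed (use fin in auto)
  also have "\<dots> \<le> (\<Sum>j\<in>{2 ^ i..<(2::nat) ^ Suc i}. 2 / 2 ^ i)"
  proof (rule sum_mono)
    fix j assume j: "j \<in> {2 ^ i..<(2::nat) ^ Suc i}"
    then have "j > 0" by (metis atLeastLessThan_iff less_le_trans zero_less_numeral zero_less_power)
    then have "(\<Sum>p\<in>dyadic_primes j. 1 / real p) \<le> 2 / real j" by (rule sum_inverse_dyadic_primes)
    also have "\<dots> \<le> 2 / 2 ^ i"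
    proof (rule divide_left_mono)
      show "2 ^ i \<le> real j" using j by (metis atLeastLessThan_iff of_nat_le_iff of_nat_numeral of_nat_power)
    qed (use \<open>j > 0\<close> in auto)
    finally show "(\<Sum>p\<in>dyadic_primes j. 1 / real p) \<le> 2 / 2 ^ i" .
  qed
  also have "\<dots> = 2" by simp
  finally show ?thesis .
qed

section \<open>Size of the zeta function and of its Euler product near s = 1\<close>

text \<open>Each term is compared with the increment of an antiderivative of x^(-s) over [n, n + 1].
  Taylor's theorem bounds the difference by |s| / n^2 and the increments telescope. The factor 1 /
  (1 - s) of the antiderivative is the pole of zeta. The bound is uniform in \<open>N\<close>, so
  partial sums can stand in for zeta itself.\<close>

lemma norm_sum_powr_le:
  fixes s :: complex
  assumes "Re s > 1"
  shows "cmod (\<Sum>n=1..N. of_nat n powr (- s)) \<le> 2 / cmod (s - 1) + 3 * cmod s + 1"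
proof -
  have s1: "1 - s \<noteq> 0" using assms by auto
  define G where "G z = z powr (1 - s) / (1 - s)" for z :: complex
  have step: "cmod (G (of_nat (Suc n)) - G (of_nat n) - of_nat n powr (- s)) \<le> cmod s * (1 / (real n)\<^sup>2)"
    if n: "n \<ge> 1" for n
  proof -
    define S where "S = complex_of_real ` {real n..}"
    \<comment> \<open>The chain of successive derivatives \<open>G\<close>, \<open>G'\<close>,
      \<open>G''\<close> on the real half-line from \<open>n\<close>, in the indexed form in which
      Taylor's theorem takes it.\<close>
    define F where "F i z = (if i = 0 then G z else if i = 1 then z powr (- s) else - s * z powr (- s - 1))" for i :: nat and z
    have nz: "z \<notin> \<real>\<^sub>\<le>\<^sub>0" if "z \<in> S" for z
      using that n by (auto simp: S_def complex_nonpos_Reals_iff)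
    have conv: "convex S"
      unfolding S_def by (rule convex_linear_image) (auto intro: bounded_linear.linear bounded_linear_of_real)
    have "cmod (F 0 (of_nat (Suc n)) - (\<Sum>i\<le>1. F i (of_nat n) * (of_nat (Suc n) - of_nat n) ^ i / (fact i)))
        \<le> (cmod s * (1 / (real n)\<^sup>2)) * cmod (of_nat (Suc n) - of_nat n) ^ Suc 1 / fact 1"
    proof (rule field_Taylor[OF conv])
      fix i z assume z: "z \<in> S" and i: "i \<le> (1::nat)"
      show "(F i has_field_derivative F (Suc i) z) (at z within S)"
      proof (cases "i = 0")
        case True
        have "((\<lambda>z. z powr (1 - s) / (1 - s)) has_field_derivative ((1 - s) * z powr (1 - s - 1)) / (1 - s)) (at z)"
          by (intro DERIV_cdivide has_field_derivative_powr nz z)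
        then have "(G has_field_derivative z powr (- s)) (at z)"
          using s1 by (simp add: G_def[abs_def])
        then show ?thesis using True by (simp add: F_def[abs_def] has_field_derivative_at_within)
      next
        case False
        then have "i = 1" using i by simp
        have "((\<lambda>z. z powr (- s)) has_field_derivative (- s * z powr (- s - 1))) (at z)"
          by (intro has_field_derivative_powr nz z)
        then show ?thesis using \<open>i = 1\<close> by (simp add: F_def[abs_def] has_field_derivative_at_within)
      qed
    next
      fix z assume "z \<in> S"
      then obtain x where x: "z = of_real x" "x \<ge> real n" by (auto simp: S_def)
      have x1: "x \<ge> 1" using x n by linarith
      have "cmod (z powr (- s - 1)) = x powr (- Re s - 1)"
        using x x1 by (simp add: norm_powr_real_powr)
      also have "\<dots> \<le> x powr (-2)" using x1 assms by (intro powr_mono) auto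
      also have "\<dots> = 1 / x\<^sup>2" using x1 by (simp add: powr_minus divide_inverse powr_numeral)
      also have "\<dots> \<le> 1 / (real n)\<^sup>2" using x n by (intro divide_left_mono power_mono) auto
      finally show "cmod (F (Suc 1) z) \<le> cmod s * (1 / (real n)\<^sup>2)"
        using mult_left_mono[of _ _ "cmod s"] by (fastforce simp: F_def norm_mult)
    next
      show "of_nat n \<in> S" unfolding S_def by (metis atLeast_iff imageI of_real_of_nat_eq order_refl)
      show "of_nat (Suc n) \<in> S" unfolding S_def
        by (metis atLeast_iff imageI of_real_of_nat_eq of_nat_le_iff le_SucI order_refl)
    qed
    moreover have "(\<Sum>i\<le>1. F i (of_nat n) * (of_nat (Suc n) - of_nat n) ^ i / (fact i)) = G (of_nat n) + of_nat n powr (- s)"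
      by (simp add: F_def)
    ultimately show ?thesis by (simp add: F_def diff_diff_eq)
  qed
  have sq: "(\<Sum>n=1..N. 1 / (real n)\<^sup>2) \<le> 2 - 1 / real (max 1 N)" for N
  proof (induction N)
    case (Suc N)
    show ?case
    proof (cases "N \<ge> 1")
      case True
      have "1 / (real (Suc N))\<^sup>2 \<le> 1 / (real N * real (Suc N))"
        using True by (intro divide_left_mono) (auto simp: power2_eq_square)
      also have "\<dots> = 1 / real N - 1 / real (Suc N)" using True by (simp add: divide_simps)
      finally have "1 / (real (Suc N))\<^sup>2 \<le> 1 / real N - 1 / real (Suc N)" .
      then show ?thesis using Suc True by (simp add: max_def)
    next
      case False
      then have "N = 0" by simp
      then show ?thesis by simp
    qed
  qed auto
  have bnd: "cmod (G (of_nat n)) \<le> 1 / cmod (s - 1)" if "n \<ge> 1" for n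
  proof -
    have "cmod (of_nat n powr (1 - s)) = real n powr (1 - Re s)"
      using norm_powr_real_powr[of "of_nat n" "1 - s"] by simp
    also have "\<dots> \<le> real n powr 0" using that assms by (intro powr_mono) auto
    also have "\<dots> = 1" using that by simp
    finally show ?thesis by (simp add: G_def norm_divide norm_minus_commute divide_right_mono)
  qed
  have tel: "(\<Sum>n=1..N. G (of_nat (Suc n)) - G (of_nat n)) = G (of_nat (Suc N)) - G (of_nat 1)"
    by (induction N) (auto simp: algebra_simps)
  have "(\<Sum>n=1..N. of_nat n powr (- s)) = (G (of_nat (Suc N)) - G (of_nat 1))
      - (\<Sum>n=1..N. G (of_nat (Suc n)) - G (of_nat n) - of_nat n powr (- s))"
    by (subst tel[symmetric]) (simp add: sum_subtractf)
  also have "cmod \<dots> \<le> (cmod (G (of_nat (Suc N))) + cmod (G (of_nat 1)))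
      + cmod (\<Sum>n=1..N. G (of_nat (Suc n)) - G (of_nat n) - of_nat n powr (- s))"
    by (meson norm_triangle_ineq4 order_trans add_right_mono)
  also have "\<dots> \<le> (1 / cmod (s - 1) + 1 / cmod (s - 1)) + (\<Sum>n=1..N. cmod s * (1 / (real n)\<^sup>2))"
    by (intro add_mono bnd order_trans[OF norm_sum] sum_mono step) auto
  also have "(\<Sum>n=1..N. cmod s * (1 / (real n)\<^sup>2)) \<le> cmod s * 2"
    unfolding sum_distrib_left[symmetric] using sq[of N]
    by (intro mult_left_mono) (auto intro: order_trans)
  finally show ?thesis by (simp add: add_divide_distrib) (smt (verit) norm_ge_zero)
qed

text \<open>A one-sided form of log |1 - z| = - Re z + O(|z|^2) that holds for all \<open>z\<close>
  and needs no logarithm: expand the square of the modulus and use 1 + x <= exp x.\<close>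

lemma norm_one_minus_le: "cmod (1 - z) \<le> exp (- Re z + (cmod z)\<^sup>2 / 2)"
proof -
  have "(cmod (1 - z))\<^sup>2 = 1 + (- 2 * Re z + (cmod z)\<^sup>2)"
    unfolding cmod_power2 by (simp add: power2_eq_square algebra_simps)
  also have "\<dots> \<le> exp (- 2 * Re z + (cmod z)\<^sup>2)" by (rule exp_ge_add_one_self)
  also have "\<dots> = (exp (- Re z + (cmod z)\<^sup>2 / 2))\<^sup>2" by (simp add: exp_double[symmetric] algebra_simps)
  finally show ?thesis by (rule power2_le_imp_le) simp
qed

text \<open>The product over p <= Y is the sum of n^(-s) over n <= Y plus a sum over larger smooth
  n, which absolute convergence makes at most 1. The threshold for \<open>Y\<close> depends on
  \<open>s\<close>; this is harmless because \<open>s\<close> is always fixed before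
  \<open>Y\<close> is chosen.\<close>

lemma euler_product_norm_le:
  fixes s :: complex
  assumes s: "Re s > 1"
  shows "\<exists>Y0. \<forall>Y\<ge>Y0. cmod (\<Prod>p | prime p \<and> p \<le> Y. inverse (1 - of_nat p powr (- s)))
           \<le> 2 / cmod (s - 1) + 3 * cmod s + 2"
proof -
  define f where "f n = complex_of_nat n powr (- s)" for n :: nat
  have nf: "cmod (f n) = real n powr (- Re s)" for n
    unfolding f_def using norm_powr_real_powr[of "of_nat n" "- s"] by simp
  have "summable (\<lambda>n. real n powr (- Re s))" using s by (simp add: summable_real_powr_iff)
  then obtain Y0 where Y0: "\<And>m n. m \<ge> Y0 \<Longrightarrow> norm (\<Sum>k=m..<n. real k powr (- Re s)) < 1"
    unfolding summable_Cauchy by (metis zero_less_one)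
  have tail: "(\<Sum>k\<in>B. real k powr (- Re s)) \<le> 1" if "finite B" "\<And>k. k \<in> B \<Longrightarrow> k \<ge> Y0" for B
  proof -
    have "(\<Sum>k\<in>B. real k powr (- Re s)) \<le> (\<Sum>k=Y0..<Suc (Max B). real k powr (- Re s))"
      using that by (intro sum_mono2) (auto simp: le_imp_less_Suc)
    also have "\<dots> \<le> 1" using Y0[of Y0 "Suc (Max B)"] by (simp del: sum.op_ivl_Suc)
    finally show ?thesis .
  qed
  have "cmod (\<Prod>p | prime p \<and> p \<le> Y. inverse (1 - f p)) \<le> 2 / cmod (s - 1) + 3 * cmod s + 2"
    if Y: "Y \<ge> Y0" for Y
  proof -
    let ?S = "{p. prime p \<and> p \<le> Y}"
    have fin: "finite ?S" by simp
    have small: "cmod (f p) < 1" if "p \<in> ?S" for p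
    proof -
      have "real p > 1" using that prime_gt_1_nat by auto
      then have "real p powr (- Re s) < real p powr 0" using s by (intro powr_less_mono) auto
      then show ?thesis using \<open>real p > 1\<close> by (simp add: nf)
    qed
    \<comment> \<open>With exponents at most \<open>E\<close> the product expands into a finite sum
      that is bounded uniformly in \<open>E\<close>; letting \<open>E\<close> grow restores the
      geometric series.\<close>
    have lim: "(\<lambda>E. \<Prod>p\<in>?S. \<Sum>e\<le>E. f p ^ e) \<longlonglongrightarrow> (\<Prod>p\<in>?S. inverse (1 - f p))"
    proof (rule tendsto_prod)
      fix p assume p: "p \<in> ?S"
      have "(\<lambda>e. f p ^ e) sums (1 / (1 - f p))" using small[OF p] by (rule geometric_sums)
      then show "(\<lambda>E. \<Sum>e\<le>E. f p ^ e) \<longlonglongrightarrow> inverse (1 - f p)"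
        by (simp add: sums_def_le inverse_eq_divide)
    qed
    have "cmod (\<Prod>p\<in>?S. \<Sum>e\<le>E. f p ^ e) \<le> 2 / cmod (s - 1) + 3 * cmod s + 2" if E: "E \<ge> Y" for E
    proof -
      have "(\<Prod>p\<in>?S. \<Sum>e\<le>E. f p ^ e) = (\<Sum>n\<in>smooth_numbers ?S E. \<Prod>p\<in>?S. f p ^ multiplicity p n)"
        by (rule finite_euler_product[OF fin]) auto
      also have "\<dots> = (\<Sum>n\<in>smooth_numbers ?S E. f n)"
        by (intro sum.cong refl completely_multiplicative_prod[symmetric])
           (auto simp: smooth_numbers_def f_def powr_times_real)
      also have "\<dots> = (\<Sum>n=1..Y. f n) + (\<Sum>n\<in>smooth_numbers ?S E - {1..Y}. f n)"
        using finite_smooth_numbers[OF fin] atLeastAtMost_subset_smooth_numbers[OF E]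
        by (subst sum.subset_diff[of "{1..Y}"]) auto
      also have "cmod \<dots> \<le> (2 / cmod (s - 1) + 3 * cmod s + 1) + (\<Sum>n\<in>smooth_numbers ?S E - {1..Y}. cmod (f n))"
        using norm_sum_powr_le[OF s, of Y] unfolding f_def[symmetric]
        by (intro order_trans[OF norm_triangle_ineq] add_mono norm_sum) auto
      also have "(\<Sum>n\<in>smooth_numbers ?S E - {1..Y}. cmod (f n)) \<le> 1"
        unfolding nf using Y finite_smooth_numbers[OF fin, of E]
        by (intro tail) (auto simp: smooth_numbers_def)
      finally show ?thesis by simp
    qed
    then have "eventually (\<lambda>E. cmod (\<Prod>p\<in>?S. \<Sum>e\<le>E. f p ^ e) \<le> 2 / cmod (s - 1) + 3 * cmod s + 2) sequentially"
      unfolding eventually_sequentially by blast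
    with tendsto_norm[OF lim] show ?thesis
      by (rule tendsto_upperbound) simp
  qed
  then show ?thesis unfolding f_def by blast
qed

lemma sum_inverse_prime_squares_le: "(\<Sum>p | prime p \<and> p \<le> Y. 1 / (real p)\<^sup>2) \<le> 1"
proof -
  have "(\<Sum>p | prime p \<and> p \<le> Y. 1 / (real p)\<^sup>2) \<le> (\<Sum>p | prime p \<and> p \<le> Y. 1 / (real p * (real p - 1)))"
  proof (rule sum_mono)
    fix p assume "p \<in> {p. prime p \<and> p \<le> Y}"
    then have "real p \<ge> 2" using prime_ge_2_nat by fastforce
    then show "1 / (real p)\<^sup>2 \<le> 1 / (real p * (real p - 1))"
      by (intro divide_left_mono) (auto simp: power2_eq_square)
  qed
  then show ?thesis using sum_inverse_prime_times_pred_le[of Y] by linarith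
qed

text \<open>The sum is the real part of the sum of p^(-s) at s = 1 + sigma + iu. It is at most log
  |zeta(s)| + O(1), and zeta(s) has size at most of order 1 / |s - 1|, where |s - 1| is comparable
  to sigma + |u|. The restriction on \<open>u\<close> keeps the regular part of zeta
  bounded.\<close>

lemma sum_cos_primes_le_ln:
  assumes \<sigma>: "0 < \<sigma>" "\<sigma> \<le> 1" and u: "\<bar>u\<bar> \<le> 2"
  shows "\<exists>Y0. \<forall>Y\<ge>Y0. (\<Sum>p | prime p \<and> p \<le> Y. cos (u * ln p) * real p powr (- 1 - \<sigma>)) \<le> ln (2 / (\<sigma> + \<bar>u\<bar>)) + 6"
proof -
  define s where "s = Complex (1 + \<sigma>) u"
  have s: "Re s > 1" using \<sigma> by (simp add: s_def)
  obtain Y0 where Y0: "\<And>Y. Y \<ge> Y0 \<Longrightarrow> cmod (\<Prod>p | prime p \<and> p \<le> Y. inverse (1 - of_nat p powr (- s)))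
           \<le> 2 / cmod (s - 1) + 3 * cmod s + 2"
    using euler_product_norm_le[OF s] by blast
  have lo: "cmod (s - 1) \<ge> (\<sigma> + \<bar>u\<bar>) / 2"
    using abs_Re_le_cmod[of "s - 1"] abs_Im_le_cmod[of "s - 1"] \<sigma> by (simp add: s_def)
  have hi: "cmod (s - 1) \<le> 3"
    using cmod_le[of "s - 1"] \<sigma> u by (simp add: s_def)
  have hi2: "cmod s \<le> 4"
    using norm_triangle_ineq[of "s - 1" 1] hi by simp
  have pos: "cmod (s - 1) > 0" using lo \<sigma> by (smt (verit) divide_pos_pos)
  \<comment> \<open>As |s - 1| <= 3, the constant 14 is at most 42 / |s - 1|, whence 44; and 44 <=
    (5/2)^5 <= exp 5. The squares of the terms later cost another 1/2, and 11/2 is rounded up to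
    6.\<close>
  have "2 / cmod (s - 1) + 3 * cmod s + 2 \<le> 2 / cmod (s - 1) + 14" using hi2 by linarith
  also have "\<dots> \<le> 44 / cmod (s - 1)" using pos hi by (simp add: field_simps)
  also have "\<dots> \<le> 44 / ((\<sigma> + \<bar>u\<bar>) / 2)"
    using lo \<sigma> pos by (intro divide_left_mono) auto
  also have "\<dots> = 44 * (2 / (\<sigma> + \<bar>u\<bar>))" by simp
  also have "\<dots> \<le> exp 5 * (2 / (\<sigma> + \<bar>u\<bar>))"
  proof (rule mult_right_mono)
    have "exp (5::real) = exp 1 ^ 5" by (simp add: exp_of_nat_mult[symmetric])
    moreover have "(5 / 2 :: real) ^ 5 \<le> exp 1 ^ 5"
      using exp_lower_Taylor_quadratic[of 1] by (intro power_mono) auto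
    ultimately show "44 \<le> exp (5::real)" by (simp add: power_divide)
  qed (use \<sigma> in auto)
  finally have big: "2 / cmod (s - 1) + 3 * cmod s + 2 \<le> exp 5 * (2 / (\<sigma> + \<bar>u\<bar>))" .
  show ?thesis
  proof (intro exI[of _ Y0] allI impI)
    fix Y assume Y: "Y \<ge> Y0"
    let ?S = "{p. prime p \<and> p \<le> Y}"
    define z where "z p = complex_of_nat p powr (- s)" for p :: nat
    have Rez: "Re (z p) = cos (u * ln p) * real p powr (- 1 - \<sigma>)" if "p \<in> ?S" for p
    proof -
      have p: "p > 0" using that prime_gt_0_nat by auto
      have "z p = exp (- s * of_real (ln (real p)))"
        using p by (simp add: z_def powr_def Ln_of_nat)
      then have "Re (z p) = exp (- (1 + \<sigma>) * ln p) * cos (u * ln p)"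
        by (simp add: Re_exp s_def algebra_simps)
      also have "exp (- (1 + \<sigma>) * ln p) = real p powr (- 1 - \<sigma>)"
        using p by (simp add: powr_def algebra_simps)
      finally show ?thesis by (simp add: mult.commute)
    qed
    have nz: "(cmod (z p))\<^sup>2 \<le> 1 / (real p)\<^sup>2" if "p \<in> ?S" for p
    proof -
      have p: "p \<ge> 1" using that prime_gt_0_nat by (auto simp: Suc_le_eq)
      have "cmod (z p) = real p powr (- 1 - \<sigma>)"
        unfolding z_def using norm_powr_real_powr[of "of_nat p" "- s"] by (simp add: s_def)
      also have "\<dots> \<le> real p powr (- 1)" using p \<sigma> by (intro powr_mono) auto
      also have "\<dots> = 1 / real p" using p by (simp add: powr_minus divide_inverse)
      finally have "(cmod (z p))\<^sup>2 \<le> (1 / real p)\<^sup>2" by (intro power_mono) auto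
      then show ?thesis by (simp add: power_divide)
    qed
    have "exp ((\<Sum>p\<in>?S. Re (z p)) - 1 / 2) \<le> exp (\<Sum>p\<in>?S. Re (z p) - (cmod (z p))\<^sup>2 / 2)"
      using sum_mono[of ?S "\<lambda>p. (cmod (z p))\<^sup>2" "\<lambda>p. 1 / (real p)\<^sup>2"] nz sum_inverse_prime_squares_le[of Y]
      by (simp add: sum_subtractf sum_divide_distrib[symmetric])
    also have "\<dots> = (\<Prod>p\<in>?S. inverse (exp (- Re (z p) + (cmod (z p))\<^sup>2 / 2)))"
      by (simp add: exp_sum exp_minus[symmetric] algebra_simps)
    also have "\<dots> \<le> (\<Prod>p\<in>?S. cmod (inverse (1 - z p)))"
    proof (rule prod_mono, safe)
      fix p :: nat assume p: "prime p" "p \<le> Y"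
      have "cmod (z p) < 1"
      proof -
        have "(cmod (z p))\<^sup>2 \<le> 1 / (real p)\<^sup>2" using nz p by auto
        also have "\<dots> < 1" using prime_gt_1_nat[OF p(1)] by simp
        finally show ?thesis by (simp add: power2_less_1_iff)
      qed
      then have "z p \<noteq> 1" by auto
      then show "inverse (exp (- Re (z p) + (cmod (z p))\<^sup>2 / 2)) \<le> cmod (inverse (1 - z p))"
        unfolding norm_inverse by (intro le_imp_inverse_le norm_one_minus_le) auto
    qed simp
    also have "\<dots> = cmod (\<Prod>p\<in>?S. inverse (1 - z p))" by (simp add: prod_norm)
    also have "\<dots> \<le> exp 5 * (2 / (\<sigma> + \<bar>u\<bar>))"
      using Y0[OF Y] big by (simp add: z_def)
    also have "\<dots> = exp (ln (2 / (\<sigma> + \<bar>u\<bar>)) + 5)" using \<sigma> by (simp add: exp_add)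
    finally have "(\<Sum>p\<in>?S. Re (z p)) \<le> ln (2 / (\<sigma> + \<bar>u\<bar>)) + 6" by simp
    then show "(\<Sum>p\<in>?S. cos (u * ln p) * real p powr (- 1 - \<sigma>)) \<le> ln (2 / (\<sigma> + \<bar>u\<bar>)) + 6"
      using Rez by simp
  qed
qed

section \<open>Cosine sums over primes\<close>

definition odd_primes_below :: "nat \<Rightarrow> nat set" where
  "odd_primes_below I = {p. prime p \<and> 2 < p \<and> p \<le> 2 ^ 2 ^ I}"

lemma finite_odd_primes_below: "finite (odd_primes_below I)"
  by (rule finite_subset[of _ "{..2 ^ 2 ^ I}"]) (auto simp: odd_primes_below_def)

lemma odd_primes_below_Suc:
  "odd_primes_below (Suc I) = odd_primes_below I \<union> prime_block I"
  "odd_primes_below I \<inter> prime_block I = {}"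
proof -
  have "(2::nat) ^ 2 ^ I \<le> 2 ^ 2 ^ Suc I" by (intro power_increasing) auto
  moreover have "(2::nat) ^ 1 \<le> 2 ^ 2 ^ I" by (intro power_increasing) auto
  ultimately show "odd_primes_below (Suc I) = odd_primes_below I \<union> prime_block I"
    by (auto simp: odd_primes_below_def prime_block_def simp del: power_Suc intro: order_trans[of _ "2 ^ 2 ^ I"])
  show "odd_primes_below I \<inter> prime_block I = {}"
    by (auto simp: odd_primes_below_def prime_block_def)
qed

lemma odd_primes_below_0: "odd_primes_below 0 = {}"
  by (auto simp: odd_primes_below_def)

lemma odd_primes_below_mono: "I \<le> M \<Longrightarrow> odd_primes_below I \<subseteq> odd_primes_below M"
  by (rule lift_Suc_mono_le[of odd_primes_below]) (simp add: odd_primes_below_Suc)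

lemma sum_odd_primes_below:
  fixes f :: "nat \<Rightarrow> 'a :: comm_monoid_add"
  shows "(\<Sum>p\<in>odd_primes_below I. f p) = (\<Sum>i<I. \<Sum>p\<in>prime_block i. f p)"
proof (induction I)
  case (Suc I)
  then show ?case
    by (simp add: odd_primes_below_Suc sum.union_disjoint finite_odd_primes_below finite_prime_block)
qed (simp add: odd_primes_below_0)

lemma sum_primes_eq_sum_odd_primes_below:
  fixes f :: "nat \<Rightarrow> 'a :: comm_monoid_add"
  shows "(\<Sum>p | prime p \<and> p \<le> 2 ^ 2 ^ I. f p) = f 2 + (\<Sum>p\<in>odd_primes_below I. f p)"
proof -
  have "(2::nat) ^ 1 \<le> 2 ^ 2 ^ I" by (intro power_increasing) auto
  then have "{p. prime p \<and> p \<le> 2 ^ 2 ^ I} = insert 2 (odd_primes_below I)"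
    by (auto simp: odd_primes_below_def two_is_prime_nat le_less dest: prime_ge_2_nat)
  moreover have "2 \<notin> odd_primes_below I" by (auto simp: odd_primes_below_def)
  ultimately show ?thesis using finite_odd_primes_below by simp
qed

lemma sum_inverse_odd_primes_ge: "(\<Sum>p\<in>odd_primes_below I. 1 / real p) \<ge> real I * ln 2 - 2"
proof -
  define v where "v = (\<Sum>p\<in>odd_primes_below I. 1 / real p)"
  \<comment> \<open>The constant 2 of the statement is 1/2 for replacing ln 2 by 1, 1/2 for the
    missing prime 2, and 1 for the higher prime powers.\<close>
  have l2: "exp (- (1/2)) \<le> ln (2::real)"
  proof -
    have "exp (1/2 :: real) \<ge> 1 + 1/2 + (1/2)\<^sup>2 / 2" by (rule exp_lower_Taylor_quadratic) simp
    then have "exp (1/2 :: real) \<ge> 13 / 8" by (simp add: power2_eq_square)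
    then have "exp (- (1/2)) \<le> (8/13 :: real)" unfolding exp_minus by (simp add: inverse_eq_divide divide_simps)
    also have "8 / 13 \<le> ln (2::real)"  using ln2_ge_two_thirds by simp
    finally show ?thesis .
  qed
  have "exp (real I * ln 2 - 1 / 2) = exp (real I * ln 2) * exp (- (1/2))"
    by (simp only: diff_conv_add_uminus exp_add)
  also have "\<dots> = 2 ^ I * exp (- (1/2))" by (simp only: exp_of_nat_mult) simp
  also have "\<dots> \<le> 2 ^ I * ln 2" using l2 by simp
  also have "\<dots> = ln (2 ^ 2 ^ I)" by (simp add: ln_realpow)
  also have "\<dots> \<le> ln (real (2 ^ 2 ^ I) + 1)" by (subst ln_le_cancel_iff) (auto intro: add_pos_pos)
  also have "\<dots> \<le> exp ((1 / 2 + v) + 1)"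
    using ln_le_exp_sum_inverse_primes[of "2 ^ 2 ^ I"] unfolding sum_primes_eq_sum_odd_primes_below v_def by simp
  finally show ?thesis by (simp add: v_def)
qed

lemma sum_le_geometric_tail: "(\<Sum>i=I..<M. (1/2::real) ^ Suc (i - I)) \<le> 1"
proof (cases "I \<le> M")
  case True
  have "(\<Sum>i=I..<M. (1/2::real) ^ Suc (i - I)) = 1 - (1/2) ^ (M - I)"
    using True by (induction M rule: dec_induct) (auto simp: Suc_diff_le)
  then show ?thesis by simp
qed auto

text \<open>Passing from the weights \<open>p powr (- 1 - \<sigma>)\<close> over all primes to \<open>1 / p\<close> over \<open>p \<le> 2 powr (1 / \<sigma>)\<close>
  costs a bounded error, because \<open>1 / p\<close> has a bounded sum over each block.\<close>

lemma sum_cos_odd_primes_le: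
  assumes u: "\<bar>u\<bar> \<le> 2"
  shows "(\<Sum>p\<in>odd_primes_below I. cos (u * ln p) / real p) \<le> ln (2 ^ I / (1 + \<bar>u\<bar> * 2 ^ I)) + 20"
proof -
  \<comment> \<open>The reciprocal of the binary logarithm of the largest prime: p^(-sigma) is near
    1 well inside the range and decays beyond its end.\<close>
  define \<sigma> :: real where "\<sigma> = 1 / 2 ^ I"
  have \<sigma>: "0 < \<sigma>" "\<sigma> \<le> 1" by (auto simp: \<sigma>_def)
  obtain Y0 where Y0: "\<And>Y. Y \<ge> Y0 \<Longrightarrow> (\<Sum>p | prime p \<and> p \<le> Y. cos (u * ln p) * real p powr (- 1 - \<sigma>)) \<le> ln (2 / (\<sigma> + \<bar>u\<bar>)) + 6"
    using sum_cos_primes_le_ln[OF \<sigma> u] by blast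
  define M where "M = max I Y0"
  have M: "I \<le> M" "Y0 \<le> 2 ^ 2 ^ M"
  proof -
    have "Y0 \<le> M" by (simp add: M_def)
    also have "M < 2 ^ M" by (rule less_exp)
    also have "(2::nat) ^ M < 2 ^ 2 ^ M" by (rule less_exp)
    finally show "Y0 \<le> 2 ^ 2 ^ M" by simp
  qed (simp add: M_def)
  define g where "g p = cos (u * ln p) * real p powr (- 1 - \<sigma>)" for p :: nat
  have blk: "real p \<ge> 1 \<and> ln (real p) \<le> 2 ^ Suc i \<and> 2 ^ 2 ^ i \<le> real p" if "p \<in> prime_block i" for p i
  proof -
    have p: "p > 0" "p \<le> 2 ^ 2 ^ Suc i" "2 ^ 2 ^ i \<le> p" using that by (auto simp: prime_block_def prime_gt_0_nat)
    have "real p \<le> 2 ^ 2 ^ Suc i" using p(2) by (metis of_nat_le_iff of_nat_numeral of_nat_power)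
    then have "ln (real p) \<le> ln (2 ^ 2 ^ Suc i)" using p by simp
    also have "\<dots> = 2 ^ Suc i * ln 2" by (simp add: ln_realpow)
    also have "\<dots> \<le> 2 ^ Suc i" using ln_2_less_1 by simp
    finally show ?thesis using p by (metis of_nat_le_iff of_nat_numeral of_nat_power One_nat_def Suc_leI of_nat_1)
  qed
  have powr_split: "real p powr (- 1 - \<sigma>) = 1 / real p * exp (- (\<sigma> * ln (real p)))" if "real p \<ge> 1" for p
    using that by (simp add: powr_def exp_diff exp_minus algebra_simps inverse_eq_divide)
  \<comment> \<open>In block i < I the factor p^(-sigma) differs from 1 by at most sigma ln p, hence
    by at most 2^(i + 1 - I). These bounds form a geometric series.\<close>
  have first: "(\<Sum>p\<in>odd_primes_below I. cos (u * ln p) / real p) \<le> (\<Sum>p\<in>odd_primes_below I. g p) + 4"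
  proof -
    have "(\<Sum>p\<in>odd_primes_below I. cos (u * ln p) / real p) - (\<Sum>p\<in>odd_primes_below I. g p)
        = (\<Sum>i<I. \<Sum>p\<in>prime_block i. cos (u * ln p) / real p - g p)"
      by (simp add: sum_odd_primes_below sum_subtractf)
    also have "\<dots> \<le> (\<Sum>i<I. \<sigma> * 2 ^ Suc i * 2)"
    proof (rule sum_mono)
      fix i
      have "(\<Sum>p\<in>prime_block i. cos (u * ln p) / real p - g p) \<le> (\<Sum>p\<in>prime_block i. \<sigma> * 2 ^ Suc i * (1 / real p))"
      proof (rule sum_mono)
        fix p assume "p \<in> prime_block i"
        then have b: "real p \<ge> 1" "ln (real p) \<le> 2 ^ Suc i" using blk by auto
        have e1: "0 \<le> 1 - exp (- (\<sigma> * ln (real p)))" using b \<sigma> by simp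
        have e2: "1 - exp (- (\<sigma> * ln (real p))) \<le> \<sigma> * ln (real p)"
          using exp_ge_add_one_self[of "- (\<sigma> * ln (real p))"] by linarith
        have "cos (u * ln p) / real p - g p = cos (u * ln p) * (1 - exp (- (\<sigma> * ln (real p)))) / real p"
          using b by (simp add: g_def powr_split algebra_simps diff_divide_distrib)
        also have "\<dots> \<le> 1 * (\<sigma> * 2 ^ Suc i) / real p"
        proof (rule divide_right_mono)
          have "cos (u * ln p) * (1 - exp (- (\<sigma> * ln (real p)))) \<le> 1 * (1 - exp (- (\<sigma> * ln (real p))))"
            using e1 by (intro mult_right_mono) auto
          also have "\<dots> \<le> 1 * (\<sigma> * 2 ^ Suc i)"
          proof -
            have "\<sigma> * ln (real p) \<le> \<sigma> * 2 ^ Suc i" using b \<sigma> by (intro mult_left_mono) auto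
            then show ?thesis using order_trans[OF e2] by simp
          qed
          finally show "cos (u * ln p) * (1 - exp (- (\<sigma> * ln (real p)))) \<le> 1 * (\<sigma> * 2 ^ Suc i)" .
        qed simp
        finally show "cos (u * ln p) / real p - g p \<le> \<sigma> * 2 ^ Suc i * (1 / real p)" by simp
      qed
      also have "\<dots> \<le> \<sigma> * 2 ^ Suc i * 2"
        unfolding sum_distrib_left[symmetric] using sum_inverse_prime_block[of i] \<sigma>
        by (intro mult_left_mono) auto
      finally show "(\<Sum>p\<in>prime_block i. cos (u * ln p) / real p - g p) \<le> \<sigma> * 2 ^ Suc i * 2" .
    qed
    also have "\<dots> = 4 * \<sigma> * (\<Sum>i<I. 2 ^ i)" by (simp add: sum_distrib_left mult_ac)
    also have "(\<Sum>i<I. 2 ^ i) = (2::real) ^ I - 1" by (subst geometric_sum) auto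
    also have "4 * \<sigma> * (2 ^ I - 1) \<le> 4" by (simp add: \<sigma>_def field_simps)
    finally show ?thesis by simp
  qed
  have "(\<Sum>p\<in>odd_primes_below M. g p) = (\<Sum>p\<in>odd_primes_below I. g p) + (\<Sum>p\<in>odd_primes_below M - odd_primes_below I. g p)"
    using odd_primes_below_mono[OF M(1)] finite_odd_primes_below
    by (subst sum.subset_diff[of "odd_primes_below I"]) auto
  also have "(\<Sum>p\<in>odd_primes_below M - odd_primes_below I. g p) = (\<Sum>i=I..<M. \<Sum>p\<in>prime_block i. g p)"
  proof -
    have "(\<Sum>i<M. \<Sum>p\<in>prime_block i. g p) = (\<Sum>i<I. \<Sum>p\<in>prime_block i. g p) + (\<Sum>i=I..<M. \<Sum>p\<in>prime_block i. g p)"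
      using M(1) by (metis sum.atLeastLessThan_concat lessThan_atLeast0 zero_le)
    then show ?thesis
      using odd_primes_below_mono[OF M(1)] finite_odd_primes_below sum_odd_primes_below[of g]
      by (simp add: sum_diff sum_odd_primes_below)
  qed
  finally have split: "(\<Sum>p\<in>odd_primes_below M. g p) = (\<Sum>p\<in>odd_primes_below I. g p) + (\<Sum>i=I..<M. \<Sum>p\<in>prime_block i. g p)" .
  \<comment> \<open>In block i >= I the factor p^(-sigma) is at most exp (- 2^(i - I) ln 2), and
    already the weaker bound 2^(-(i - I)) is summable. The cosine is only used through its bound by
    1.\<close>
  have second: "(\<Sum>i=I..<M. \<Sum>p\<in>prime_block i. g p) \<ge> - 4"
  proof -
    have "(\<Sum>i=I..<M. \<Sum>p\<in>prime_block i. - g p) \<le> (\<Sum>i=I..<M. 4 * (1/2) ^ Suc (i - I))"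
    proof (rule sum_mono)
      fix i assume i: "i \<in> {I..<M}"
      have dec: "exp (- (\<sigma> * ln (real p))) \<le> 2 * (1/2) ^ Suc (i - I)" if "p \<in> prime_block i" for p
      proof -
        have "real p \<ge> 1" "2 ^ 2 ^ i \<le> real p" using blk[OF that] by auto
        then have "ln (2 ^ 2 ^ i) \<le> ln (real p)" by (subst ln_le_cancel_iff) auto
        then have "2 ^ i * ln 2 \<le> ln (real p)" by (simp add: ln_realpow)
        then have "\<sigma> * (2 ^ i * ln 2) \<le> \<sigma> * ln (real p)" using \<sigma> by (intro mult_left_mono) auto
        moreover have "\<sigma> * 2 ^ i = 2 ^ (i - I)"
          using i by (simp add: \<sigma>_def power_diff)
        moreover have "real (i - I) \<le> 2 ^ (i - I)"
          by (intro less_imp_le of_nat_less_two_power)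
        ultimately have "real (i - I) * ln 2 \<le> \<sigma> * ln (real p)"
          by (smt (verit) ln_gt_zero mult.assoc mult_right_mono)
        then have "exp (- (\<sigma> * ln (real p))) \<le> exp (- (real (i - I) * ln 2))" by simp
        also have "\<dots> = 2 * (1/2) ^ Suc (i - I)"
          unfolding exp_minus exp_of_nat_mult by (simp add: power_one_over inverse_eq_divide)
        finally show ?thesis .
      qed
      have "(\<Sum>p\<in>prime_block i. - g p) \<le> (\<Sum>p\<in>prime_block i. 2 * (1/2) ^ Suc (i - I) * (1 / real p))"
      proof (rule sum_mono)
        fix p assume p: "p \<in> prime_block i"
        have b: "real p \<ge> 1" using blk[OF p] by simp
        have "- g p = - cos (u * ln p) * (1 / real p * exp (- (\<sigma> * ln (real p))))"
          using b by (simp add: g_def powr_split)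
        also have "\<dots> \<le> 1 * (1 / real p * exp (- (\<sigma> * ln (real p))))"
          using cos_ge_minus_one[of "u * ln p"] by (intro mult_right_mono) auto
        also have "\<dots> \<le> 2 * (1/2) ^ Suc (i - I) * (1 / real p)"
          using dec[OF p] b mult_right_mono[OF dec[OF p], of "1 / real p"] by (simp add: mult.commute)
        finally show "- g p \<le> 2 * (1/2) ^ Suc (i - I) * (1 / real p)" .
      qed
      also have "\<dots> \<le> 2 * (1/2) ^ Suc (i - I) * 2"
        unfolding sum_distrib_left[symmetric] using sum_inverse_prime_block[of i]
        by (intro mult_left_mono) auto
      finally show "(\<Sum>p\<in>prime_block i. - g p) \<le> 4 * (1/2) ^ Suc (i - I)" by simp
    qed
    also have "\<dots> \<le> 4 * 1"
      unfolding sum_distrib_left[symmetric] by (intro mult_left_mono sum_le_geometric_tail) auto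
    finally show ?thesis by (simp add: sum_negf)
  qed
  have two: "g 2 \<ge> - 1"
  proof -
    have "2 powr (- 1 - \<sigma>) \<le> 2 powr (0::real)" using \<sigma> by (intro powr_mono) auto
    then have "\<bar>g 2\<bar> \<le> 1 * 1"
      unfolding g_def abs_mult by (intro mult_mono) auto
    then show ?thesis by linarith
  qed
  have "(\<Sum>p\<in>odd_primes_below M. g p) \<le> ln (2 / (\<sigma> + \<bar>u\<bar>)) + 7"
    using Y0[OF M(2)] two unfolding g_def[symmetric] sum_primes_eq_sum_odd_primes_below by linarith
  then have "(\<Sum>p\<in>odd_primes_below I. cos (u * ln p) / real p) \<le> ln (2 / (\<sigma> + \<bar>u\<bar>)) + 15"
    using first split second by linarith
  also have "ln (2 / (\<sigma> + \<bar>u\<bar>)) = ln 2 + ln (2 ^ I / (1 + \<bar>u\<bar> * 2 ^ I))"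
  proof -
    have "2 / (\<sigma> + \<bar>u\<bar>) = 2 * (2 ^ I / (1 + \<bar>u\<bar> * 2 ^ I))"
      using \<sigma> by (simp add: \<sigma>_def field_simps)
    moreover have "2 ^ I / (1 + \<bar>u\<bar> * 2 ^ I) > 0" by (intro divide_pos_pos add_pos_nonneg) auto
    ultimately show ?thesis by (metis ln_mult_pos zero_less_numeral)
  qed
  finally show ?thesis using ln_2_less_1 by linarith
qed

lemma sum_inverse_odd_primes_le: "(\<Sum>p\<in>odd_primes_below I. 1 / real p) \<le> real I * ln 2 + 20"
  using sum_cos_odd_primes_le[of 0 I] by (simp add: ln_realpow)

section \<open>Dirichlet polynomials with independent prime factors\<close>

definition completely_multiplicative :: "(nat \<Rightarrow> complex) \<Rightarrow> bool" where
  "completely_multiplicative f \<longleftrightarrow> f 1 = 1 \<and> (\<forall>m n. f (m * n) = f m * f n)"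

text \<open>When \<open>f\<close> runs over the even or the odd characters modulo \<open>q > 2 * L\<close>, the mean square of
  \<open>P f\<close> is at most \<open>v\<close>. Prime factors are confined to \<open>S\<close> because \<open>v\<close> is multiplicative over
  disjoint \<open>S\<close>.\<close>

definition dirichlet_poly ::
    "nat set \<Rightarrow> nat \<Rightarrow> real \<Rightarrow> ((nat \<Rightarrow> complex) \<Rightarrow> complex) \<Rightarrow> bool" where
  "dirichlet_poly S L v P \<longleftrightarrow>
     (\<exists>A c. finite A \<and> A \<subseteq> {n. 0 < n \<and> n \<le> L \<and> prime_factors n \<subseteq> S} \<and>
        (\<forall>f. completely_multiplicative f \<longrightarrow> P f = (\<Sum>n\<in>A. c n * f n)) \<and>
        (\<Sum>n\<in>A. (cmod (c n))\<^sup>2) \<le> v)"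

lemma dirichlet_polyI:
  assumes "finite A" "A \<subseteq> {n. 0 < n \<and> n \<le> L \<and> prime_factors n \<subseteq> S}"
    "\<And>f. completely_multiplicative f \<Longrightarrow> P f = (\<Sum>n\<in>A. c n * f n)"
    "(\<Sum>n\<in>A. (cmod (c n))\<^sup>2) \<le> v"
  shows "dirichlet_poly S L v P"
  using assms unfolding dirichlet_poly_def by blast

lemma dirichlet_poly_mono:
  "dirichlet_poly S L v P \<Longrightarrow> S \<subseteq> S' \<Longrightarrow> L \<le> L' \<Longrightarrow> v \<le> v' \<Longrightarrow> dirichlet_poly S' L' v' P"
  unfolding dirichlet_poly_def by (elim exE, intro exI conjI) (auto dest: order_trans)

lemma dirichlet_poly_one: "dirichlet_poly {} 1 1 (\<lambda>f. 1)"
  by (rule dirichlet_polyI[where A = "{1}" and c = "\<lambda>_. 1"]) (auto simp: completely_multiplicative_def)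

lemma dirichlet_poly_nonneg: "dirichlet_poly S L v P \<Longrightarrow> 0 \<le> v"
  unfolding dirichlet_poly_def by (meson order_trans sum_nonneg zero_le_power2)

lemma dirichlet_poly_scale:
  assumes "dirichlet_poly S L v P"
  shows "dirichlet_poly S L ((cmod a)\<^sup>2 * v) (\<lambda>f. a * P f)"
proof -
  from assms obtain A c where A: "finite A" "A \<subseteq> {n. 0 < n \<and> n \<le> L \<and> prime_factors n \<subseteq> S}"
    "\<And>f. completely_multiplicative f \<Longrightarrow> P f = (\<Sum>n\<in>A. c n * f n)"
    "(\<Sum>n\<in>A. (cmod (c n))\<^sup>2) \<le> v" unfolding dirichlet_poly_def by blast
  show ?thesis
  proof (rule dirichlet_polyI[OF A(1,2), where c = "\<lambda>n. a * c n"])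
    show "(\<Sum>n\<in>A. (cmod (a * c n))\<^sup>2) \<le> (cmod a)\<^sup>2 * v"
      using mult_left_mono[OF A(4), of "(cmod a)\<^sup>2"]
      by (simp add: norm_mult power_mult_distrib sum_distrib_left)
  qed (simp add: A(3) sum_distrib_left mult.assoc)
qed

lemma coprime_if_disjoint_prime_factors:
  fixes m n :: nat
  assumes "m > 0" "n > 0" "prime_factors m \<inter> prime_factors n = {}"
  shows "coprime m n"
proof (rule ccontr)
  assume "\<not> coprime m n"
  then have "gcd m n \<noteq> 1" using coprime_iff_gcd_eq_1 by blast
  then obtain p where "prime p" "p dvd gcd m n" using prime_factor_nat by blast
  then have "p \<in> prime_factors m \<inter> prime_factors n" using assms by (auto simp: in_prime_factors_iff)
  with assms show False by blast
qed

text \<open>If m n = m' n', then m is coprime to n' and so divides m', and conversely. This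
  injectivity plays the part of independence of the values f(p) at different primes.\<close>

lemma inj_on_mult_disjoint_prime_factors:
  assumes A: "\<And>m. m \<in> A \<Longrightarrow> 0 < m \<and> prime_factors m \<subseteq> S" and B: "\<And>n. n \<in> B \<Longrightarrow> 0 < n \<and> prime_factors n \<subseteq> T"
    and dj: "S \<inter> T = {}"
  shows "inj_on (\<lambda>(m, n). m * n) (A \<times> (B :: nat set))"
proof (rule inj_onI, clarsimp)
  fix m n m' n' assume h: "m \<in> A" "n \<in> B" "m' \<in> A" "n' \<in> B" "m * n = m' * n'"
  have "coprime m n'" "coprime m' n"
    using h A B dj by (intro coprime_if_disjoint_prime_factors; blast)+
  then have "m dvd m'" "m' dvd m" using h(5) by (metis coprime_dvd_mult_left_iff dvd_triv_left)+
  then have "m = m'" by (rule dvd_antisym)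
  moreover have "m > 0" using h A by blast
  ultimately show "m = m' \<and> n = n'" using h(5) by simp
qed

text \<open>Each number arises from at most one pair of factors, so no coefficients are added up:
  they multiply, and so do the sums of their squares.\<close>

lemma dirichlet_poly_mult:
  assumes "dirichlet_poly S L v P" "dirichlet_poly T M w Q" and dj: "S \<inter> T = {}"
  shows "dirichlet_poly (S \<union> T) (L * M) (v * w) (\<lambda>f. P f * Q f)"
proof -
  from assms obtain A c where A: "finite A" "A \<subseteq> {n. 0 < n \<and> n \<le> L \<and> prime_factors n \<subseteq> S}"
    "\<And>f. completely_multiplicative f \<Longrightarrow> P f = (\<Sum>n\<in>A. c n * f n)"
    "(\<Sum>n\<in>A. (cmod (c n))\<^sup>2) \<le> v" unfolding dirichlet_poly_def by blast
  from assms obtain B d where B: "finite B" "B \<subseteq> {n. 0 < n \<and> n \<le> M \<and> prime_factors n \<subseteq> T}"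
    "\<And>f. completely_multiplicative f \<Longrightarrow> Q f = (\<Sum>n\<in>B. d n * f n)"
    "(\<Sum>n\<in>B. (cmod (d n))\<^sup>2) \<le> w" unfolding dirichlet_poly_def by blast
  define h where "h = (\<lambda>(m::nat, n::nat). m * n)"
  have inj: "inj_on h (A \<times> B)"
    unfolding h_def using A(2) B(2) dj by (intro inj_on_mult_disjoint_prime_factors[of A S B T]) auto
  define e where "e x = (case the_inv_into (A \<times> B) h x of (m, n) \<Rightarrow> c m * d n)" for x
  have e: "e (h (m, n)) = c m * d n" if "m \<in> A" "n \<in> B" for m n
    using that by (simp add: e_def the_inv_into_f_f[OF inj])
  have e': "e (h b) = c (fst b) * d (snd b)" if "b \<in> A \<times> B" for b
    using that e by (cases b) auto
  show ?thesis
  proof (rule dirichlet_polyI[where A = "h ` (A \<times> B)" and c = e])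
    show "finite (h ` (A \<times> B))" using A B by simp
    show "h ` (A \<times> B) \<subseteq> {n. 0 < n \<and> n \<le> L * M \<and> prime_factors n \<subseteq> S \<union> T}"
    proof safe
      fix m n assume mn: "m \<in> A" "n \<in> B"
      then have "m > 0" "n > 0" "m \<le> L" "n \<le> M" "prime_factors m \<subseteq> S" "prime_factors n \<subseteq> T"
        using A(2) B(2) by auto
      then show "0 < h (m, n)" "h (m, n) \<le> L * M" by (auto simp: h_def intro: mult_mono)
      fix p assume "p \<in> prime_factors (h (m, n))" "p \<notin> T"
      then show "p \<in> S" using \<open>m > 0\<close> \<open>n > 0\<close> \<open>prime_factors m \<subseteq> S\<close> \<open>prime_factors n \<subseteq> T\<close>
        by (auto simp: h_def prime_factors_product)
    qed
    fix f assume f: "completely_multiplicative f"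
    have "P f * Q f = (\<Sum>b\<in>A \<times> B. (c (fst b) * f (fst b)) * (d (snd b) * f (snd b)))"
      by (simp add: A(3)[OF f] B(3)[OF f] sum_product sum.cartesian_product case_prod_unfold)
    also have "\<dots> = (\<Sum>b\<in>A \<times> B. e (h b) * f (h b))"
      using f by (intro sum.cong refl, subst e') (auto simp: h_def completely_multiplicative_def)
    also have "\<dots> = (\<Sum>n\<in>h ` (A \<times> B). e n * f n)" by (simp add: sum.reindex[OF inj])
    finally show "P f * Q f = (\<Sum>n\<in>h ` (A \<times> B). e n * f n)" .
  next
    have "(\<Sum>n\<in>h ` (A \<times> B). (cmod (e n))\<^sup>2) = (\<Sum>b\<in>A \<times> B. (cmod (e (h b)))\<^sup>2)"
      by (simp add: sum.reindex[OF inj])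
    also have "\<dots> = (\<Sum>b\<in>A \<times> B. (cmod (c (fst b)))\<^sup>2 * (cmod (d (snd b)))\<^sup>2)"
      by (intro sum.cong refl) (simp add: e' norm_mult power_mult_distrib)
    also have "\<dots> = (\<Sum>n\<in>A. (cmod (c n))\<^sup>2) * (\<Sum>n\<in>B. (cmod (d n))\<^sup>2)"
      by (simp add: sum_product sum.cartesian_product case_prod_unfold)
    also have "\<dots> \<le> v * w"
      using A(4) B(4) dirichlet_poly_nonneg[OF assms(1)] by (intro mult_mono) (auto intro: sum_nonneg)
    finally show "(\<Sum>n\<in>h ` (A \<times> B). (cmod (e n))\<^sup>2) \<le> v * w" .
  qed
qed

lemma dirichlet_poly_prod:
  fixes I :: nat
  assumes "\<And>i. i < I \<Longrightarrow> dirichlet_poly (S i) (L i) (v i) (P i)"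
    and "\<And>i j. i < j \<Longrightarrow> j < I \<Longrightarrow> S i \<inter> S j = {}"
  shows "dirichlet_poly (\<Union>i<I. S i) (\<Prod>i<I. L i) (\<Prod>i<I. v i) (\<lambda>f. \<Prod>i<I. P i f)"
  using assms
proof (induction I)
  case 0
  show ?case using dirichlet_poly_one by simp
next
  case (Suc I)
  have "dirichlet_poly ((\<Union>i<I. S i) \<union> S I) ((\<Prod>i<I. L i) * L I) ((\<Prod>i<I. v i) * v I) (\<lambda>f. (\<Prod>i<I. P i f) * P I f)"
    using Suc by (intro dirichlet_poly_mult) auto
  moreover have "(\<Union>i<I. S i) \<union> S I = (\<Union>i<Suc I. S i)" by (auto simp: less_Suc_eq)
  ultimately show ?case by simp
qed

section \<open>Powers and truncated exponentials of linear forms in the values at primes\<close>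

text \<open>In the divided powers x^d / d! the binomial theorem has no coefficients, which makes
  induction over the set of primes smooth.\<close>

lemma power_add_div_fact:
  fixes a b :: "'a :: field_char_0"
  shows "(a + b) ^ d / fact d = (\<Sum>j\<le>d. (a ^ j / fact j) * (b ^ (d - j) / fact (d - j)))"
proof -
  have "(a + b) ^ d / fact d = (\<Sum>j\<le>d. of_nat (d choose j) * a ^ j * b ^ (d - j) / fact d)"
    by (simp add: binomial_ring sum_divide_distrib)
  also have "\<dots> = (\<Sum>j\<le>d. (a ^ j / fact j) * (b ^ (d - j) / fact (d - j)))"
    by (intro sum.cong refl) (simp add: binomial_fact)
  finally show ?thesis .
qed

text \<open>The coefficient of f(n) in the expansion of exp (sum of z(p) f(p)): the multiplicative
  function with value z(p)^j / j! at p^j.\<close>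

definition exp_coeff :: "(nat \<Rightarrow> 'a :: field_char_0) \<Rightarrow> nat \<Rightarrow> 'a" where
  "exp_coeff z n = (\<Prod>p\<in>prime_factors n. z p ^ multiplicity p n / fact (multiplicity p n))"

text \<open>The size of the prime factorization is Omega(n), the number of prime factors counted
  with multiplicity, which is the degree of the monomial that \<open>n\<close> stands for.\<close>

definition homogeneous_numbers :: "nat set \<Rightarrow> nat \<Rightarrow> nat set" where
  "homogeneous_numbers S d = {n. 0 < n \<and> prime_factors n \<subseteq> S \<and> size (prime_factorization n) = d}"

lemma homogeneous_numbers_le:
  assumes "\<And>p. p \<in> S \<Longrightarrow> p \<le> B" "n \<in> homogeneous_numbers S d"
  shows "n \<le> B ^ d"
proof -
  have gen: "prod_mset M \<le> B ^ size M" if "\<forall>p\<in>#M. p \<le> B" for M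
    using that by (induction M) (auto intro: mult_mono)
  have "n = prod_mset (prime_factorization n)"
    using assms(2) prod_mset_prime_factorization_nat[of n] by (simp add: homogeneous_numbers_def)
  also have "\<dots> \<le> B ^ d" using gen[of "prime_factorization n"] assms by (auto simp: homogeneous_numbers_def)
  finally show ?thesis .
qed

lemma finite_homogeneous_numbers: "finite S \<Longrightarrow> finite (homogeneous_numbers S d)"
  by (rule finite_subset[of _ "{..(Max (insert 0 S)) ^ d}"]) (use homogeneous_numbers_le[of S "Max (insert 0 S)"] in auto)

lemma homogeneous_numbers_disjoint:
  "d \<noteq> e \<Longrightarrow> homogeneous_numbers S d \<inter> homogeneous_numbers S e = {}"
  by (auto simp: homogeneous_numbers_def)

lemma exp_coeff_mult_coprime:
  assumes "m > 0" "n > 0" "prime_factors m \<inter> prime_factors n = {}"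
  shows "exp_coeff z (m * n) = exp_coeff z m * exp_coeff z n"
proof -
  have "multiplicity p (m * n) = multiplicity p m" if "p \<in> prime_factors m" for p
    using assms that
    by (subst prime_elem_multiplicity_mult_distrib) (auto simp: prime_factors_multiplicity)
  moreover have "multiplicity p (m * n) = multiplicity p n" if "p \<in> prime_factors n" for p
    using assms that
    by (subst prime_elem_multiplicity_mult_distrib) (auto simp: prime_factors_multiplicity)
  ultimately show ?thesis
    using assms by (simp add: exp_coeff_def prime_factors_product prod.union_disjoint)
qed

lemma exp_coeff_prime_power: "prime p \<Longrightarrow> exp_coeff z (p ^ j) = z p ^ j / fact j"
  by (cases "j = 0") (auto simp: exp_coeff_def prime_factors_power prime_prime_factors)

lemma size_prime_factorization_mult:
  "m > 0 \<Longrightarrow> n > 0 \<Longrightarrow> size (prime_factorization (m * n)) = size (prime_factorization m) + size (prime_factorization (n::nat))"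
  by (simp add: prime_factorization_mult)

text \<open>The step of the induction over \<open>S\<close>: sort the numbers by the exact power of
  the new prime that divides them.\<close>

lemma sum_homogeneous_numbers_insert:
  fixes F :: "nat \<Rightarrow> 'a :: comm_monoid_add"
  assumes S: "finite S" and p: "prime p" "p \<notin> S"
  shows "(\<Sum>n\<in>homogeneous_numbers (insert p S) d. F n)
       = (\<Sum>j\<le>d. \<Sum>n\<in>homogeneous_numbers S (d - j). F (p ^ j * n))"
proof -
  have "(\<Sum>j\<le>d. \<Sum>n\<in>homogeneous_numbers S (d - j). F (p ^ j * n))
      = (\<Sum>(j, n)\<in>(SIGMA j:{..d}. homogeneous_numbers S (d - j)). F (p ^ j * n))"
    using S by (intro sum.Sigma) (auto simp: finite_homogeneous_numbers)
  also have "\<dots> = (\<Sum>n\<in>homogeneous_numbers (insert p S) d. F n)"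
  proof (rule sum.reindex_bij_witness[where i = "\<lambda>n. (multiplicity p n, n div p ^ multiplicity p n)" and j = "\<lambda>(j, n). p ^ j * n"])
    fix b assume "b \<in> (SIGMA j:{..d}. homogeneous_numbers S (d - j))"
    then obtain j n where b: "b = (j, n)" "j \<le> d" "n > 0" "prime_factors n \<subseteq> S" "size (prime_factorization n) = d - j"
      by (auto simp: homogeneous_numbers_def)
    have "multiplicity p n = 0" using b p by (auto simp: prime_factors_multiplicity)
    then have "multiplicity p (p ^ j * n) = j"
      using p b by (subst prime_elem_multiplicity_mult_distrib) (auto simp: multiplicity_same_power)
    then show "(multiplicity p (case b of (j, n) \<Rightarrow> p ^ j * n), (case b of (j, n) \<Rightarrow> p ^ j * n) div
          p ^ multiplicity p (case b of (j, n) \<Rightarrow> p ^ j * n)) = b"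
      using b p prime_gt_0_nat by auto
    show "(case b of (j, n) \<Rightarrow> p ^ j * n) \<in> homogeneous_numbers (insert p S) d"
      using b p prime_gt_0_nat
      by (auto simp: homogeneous_numbers_def prime_factors_product size_prime_factorization_mult
          prime_factorization_prime_power split: if_splits)
    show "F (case b of (j, n) \<Rightarrow> p ^ j * n) = (case b of (j, n) \<Rightarrow> F (p ^ j * n))" by (simp add: b)
  next
    fix n assume n: "n \<in> homogeneous_numbers (insert p S) d"
    let ?j = "multiplicity p n" let ?m = "n div p ^ ?j"
    have n0: "n > 0" "prime_factors n \<subseteq> insert p S" "size (prime_factorization n) = d"
      using n by (auto simp: homogeneous_numbers_def)
    have nm: "p ^ ?j * ?m = n" by (simp add: multiplicity_dvd)
    then show "(case (?j, ?m) of (j, n) \<Rightarrow> p ^ j * n) = n" by simp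
    have m0: "?m > 0" using nm n0 by (metis gr0I mult_0_right)
    have "\<not> p dvd ?m"
      by (rule multiplicity_decompose) (use n0 p not_prime_unit in auto)
    moreover have "prime_factors ?m \<subseteq> prime_factors n"
      using nm n0 by (metis dvd_prime_factors dvd_triv_right less_not_refl2)
    ultimately have "prime_factors ?m \<subseteq> S" using n0 by (auto simp: in_prime_factors_iff)
    moreover have "size (prime_factorization n) = ?j + size (prime_factorization ?m)"
      using size_prime_factorization_mult[of "p ^ ?j" ?m] nm m0 p prime_gt_0_nat[of p]
      by (simp add: prime_factorization_prime_power)
    ultimately show "(?j, ?m) \<in> (SIGMA j:{..d}. homogeneous_numbers S (d - j))"
      using n0 m0 by (auto simp: homogeneous_numbers_def)
  qed
  finally show ?thesis by simp
qed

text \<open>The multinomial theorem, with monomials encoded as numbers. For the squares of the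
  coefficients, 1 / (j!)^2 <= 1 / j! shows that they are dominated by the same expansion with
  |z(p)|^2 in place of z(p).\<close>

lemma power_linear_form:
  fixes z :: "nat \<Rightarrow> complex"
  assumes S: "finite S" "\<And>p. p \<in> S \<Longrightarrow> prime p"
  shows "completely_multiplicative f \<Longrightarrow>
      (\<Sum>p\<in>S. z p * f p) ^ d / fact d = (\<Sum>n\<in>homogeneous_numbers S d. exp_coeff z n * f n)"
    and "(\<Sum>n\<in>homogeneous_numbers S d. (cmod (exp_coeff z n))\<^sup>2) \<le> (\<Sum>p\<in>S. (cmod (z p))\<^sup>2) ^ d / fact d"
proof -
  have ins: "exp_coeff z (p ^ j * n) = z p ^ j / fact j * exp_coeff z n"
    if "prime p" "p \<notin> F" "n \<in> homogeneous_numbers F e" for p F n j e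
  proof -
    have "exp_coeff z (p ^ j * n) = exp_coeff z (p ^ j) * exp_coeff z n"
      using that prime_gt_0_nat
      by (intro exp_coeff_mult_coprime) (auto simp: homogeneous_numbers_def prime_factorization_prime_power)
    then show ?thesis using that by (simp add: exp_coeff_prime_power)
  qed
  have empty: "homogeneous_numbers {} d = (if d = 0 then {1} else {})" for d
    by (auto simp: homogeneous_numbers_def prime_factorization_empty_iff)
  show "(\<Sum>p\<in>S. z p * f p) ^ d / fact d = (\<Sum>n\<in>homogeneous_numbers S d. exp_coeff z n * f n)"
    if f: "completely_multiplicative f"
    using S
  proof (induction S arbitrary: d rule: finite_induct)
    case empty
    then show ?case using f by (simp add: \<open>\<And>d. homogeneous_numbers {} d = _ d\<close> exp_coeff_def completely_multiplicative_def power_0_left)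
  next
    case (insert p F)
    have pw: "f (p ^ j) = f p ^ j" for j
      by (induction j) (use f in \<open>auto simp: completely_multiplicative_def\<close>)
    have "(\<Sum>q\<in>insert p F. z q * f q) ^ d / fact d = (\<Sum>j\<le>d. (z p * f p) ^ j / fact j *
         ((\<Sum>q\<in>F. z q * f q) ^ (d - j) / fact (d - j)))"
      using insert by (simp add: power_add_div_fact)
    also have "\<dots> = (\<Sum>j\<le>d. \<Sum>n\<in>homogeneous_numbers F (d - j). exp_coeff z (p ^ j * n) * f (p ^ j * n))"
    proof (rule sum.cong[OF refl])
      fix j
      have "(z p * f p) ^ j / fact j * ((\<Sum>q\<in>F. z q * f q) ^ (d - j) / fact (d - j))
         = (\<Sum>n\<in>homogeneous_numbers F (d - j). (z p * f p) ^ j / fact j * (exp_coeff z n * f n))"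
        using insert by (simp add: sum_distrib_left)
      also have "\<dots> = (\<Sum>n\<in>homogeneous_numbers F (d - j). exp_coeff z (p ^ j * n) * f (p ^ j * n))"
      proof (rule sum.cong[OF refl])
        fix n assume "n \<in> homogeneous_numbers F (d - j)"
        then have "exp_coeff z (p ^ j * n) = z p ^ j / fact j * exp_coeff z n" using ins insert by auto
        moreover have "f (p ^ j * n) = f p ^ j * f n" using f pw by (simp add: completely_multiplicative_def)
        ultimately show "(z p * f p) ^ j / fact j * (exp_coeff z n * f n) = exp_coeff z (p ^ j * n) * f (p ^ j * n)"
          by (simp add: power_mult_distrib)
      qed
      finally show "(z p * f p) ^ j / fact j * ((\<Sum>q\<in>F. z q * f q) ^ (d - j) / fact (d - j)) =
          (\<Sum>n\<in>homogeneous_numbers F (d - j). exp_coeff z (p ^ j * n) * f (p ^ j * n))" .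
    qed
    also have "\<dots> = (\<Sum>n\<in>homogeneous_numbers (insert p F) d. exp_coeff z n * f n)"
      using insert by (subst sum_homogeneous_numbers_insert) auto
    finally show ?case .
  qed
  show "(\<Sum>n\<in>homogeneous_numbers S d. (cmod (exp_coeff z n))\<^sup>2) \<le> (\<Sum>p\<in>S. (cmod (z p))\<^sup>2) ^ d / fact d"
    using S
  proof (induction S arbitrary: d rule: finite_induct)
    case empty
    then show ?case by (simp add: \<open>\<And>d. homogeneous_numbers {} d = _ d\<close> exp_coeff_def power_0_left)
  next
    case (insert p F)
    have "(\<Sum>n\<in>homogeneous_numbers (insert p F) d. (cmod (exp_coeff z n))\<^sup>2)
      = (\<Sum>j\<le>d. \<Sum>n\<in>homogeneous_numbers F (d - j). (cmod (exp_coeff z (p ^ j * n)))\<^sup>2)"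
      using insert by (subst sum_homogeneous_numbers_insert) auto
    also have "\<dots> = (\<Sum>j\<le>d. ((cmod (z p))\<^sup>2 ^ j / (fact j)\<^sup>2) * (\<Sum>n\<in>homogeneous_numbers F (d - j). (cmod (exp_coeff z n))\<^sup>2))"
      unfolding sum_distrib_left
    proof (intro sum.cong refl)
      fix j n assume "n \<in> homogeneous_numbers F (d - j)"
      then have "exp_coeff z (p ^ j * n) = z p ^ j / fact j * exp_coeff z n" using ins insert by auto
      then show "(cmod (exp_coeff z (p ^ j * n)))\<^sup>2 = ((cmod (z p))\<^sup>2 ^ j / (fact j)\<^sup>2) * (cmod (exp_coeff z n))\<^sup>2"
        by (simp add: norm_mult norm_divide norm_power power_mult_distrib power_divide power_mult[symmetric] mult.commute)
    qed
    also have "\<dots> \<le> (\<Sum>j\<le>d. ((cmod (z p))\<^sup>2 ^ j / fact j) * ((\<Sum>q\<in>F. (cmod (z q))\<^sup>2) ^ (d - j) / fact (d - j)))"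
    proof (intro sum_mono mult_mono)
      fix j
      have "fact j * 1 \<le> fact j * (fact j :: real)" by (intro mult_left_mono) auto
      then show "(cmod (z p))\<^sup>2 ^ j / (fact j)\<^sup>2 \<le> (cmod (z p))\<^sup>2 ^ j / fact j"
        by (intro divide_left_mono) (auto simp: power2_eq_square)
      show "(\<Sum>n\<in>homogeneous_numbers F (d - j). (cmod (exp_coeff z n))\<^sup>2) \<le> (\<Sum>q\<in>F. (cmod (z q))\<^sup>2) ^ (d - j) / fact (d - j)"
        using insert by auto
    qed (auto intro: sum_nonneg)
    also have "\<dots> = (\<Sum>q\<in>insert p F. (cmod (z q))\<^sup>2) ^ d / fact d"
      using insert by (simp add: power_add_div_fact)
    finally show ?case .
  qed
qed

text \<open>The bound d! V^d is the 2d-th absolute moment of a complex Gaussian variable of variance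
  V: the linear form behaves no worse than its random model.\<close>

lemma dirichlet_poly_power:
  assumes S: "finite S" "\<And>p. p \<in> S \<Longrightarrow> prime p" "\<And>p. p \<in> S \<Longrightarrow> p \<le> B"
  shows "dirichlet_poly S (B ^ d) (fact d * (\<Sum>p\<in>S. (cmod (z p))\<^sup>2) ^ d) (\<lambda>f. (\<Sum>p\<in>S. z p * f p) ^ d)"
proof (rule dirichlet_polyI[where A = "homogeneous_numbers S d" and c = "\<lambda>n. fact d * exp_coeff z n"])
  show "finite (homogeneous_numbers S d)" using S by (simp add: finite_homogeneous_numbers)
  show "homogeneous_numbers S d \<subseteq> {n. 0 < n \<and> n \<le> B ^ d \<and> prime_factors n \<subseteq> S}"
    using homogeneous_numbers_le[of S B] S by (auto simp: homogeneous_numbers_def)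
  show "(\<Sum>p\<in>S. z p * f p) ^ d = (\<Sum>n\<in>homogeneous_numbers S d. fact d * exp_coeff z n * f n)"
    if "completely_multiplicative f" for f
    using power_linear_form(1)[OF S(1,2) that, of z d]
    by (simp add: mult.assoc sum_distrib_left[symmetric] field_simps)
  have "(\<Sum>n\<in>homogeneous_numbers S d. (cmod (fact d * exp_coeff z n))\<^sup>2)
     = (fact d)\<^sup>2 * (\<Sum>n\<in>homogeneous_numbers S d. (cmod (exp_coeff z n))\<^sup>2)"
    by (simp add: norm_mult power_mult_distrib sum_distrib_left)
  also have "\<dots> \<le> (fact d)\<^sup>2 * ((\<Sum>p\<in>S. (cmod (z p))\<^sup>2) ^ d / fact d)"
    using power_linear_form(2)[OF S(1,2), of z d] by (intro mult_left_mono) auto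
  also have "\<dots> = fact d * (\<Sum>p\<in>S. (cmod (z p))\<^sup>2) ^ d" by (simp add: power2_eq_square)
  finally show "(\<Sum>n\<in>homogeneous_numbers S d. (cmod (fact d * exp_coeff z n))\<^sup>2) \<le> fact d * (\<Sum>p\<in>S. (cmod (z p))\<^sup>2) ^ d" .
qed

lemma exp_series_le:
  fixes x :: real
  assumes "finite A" "x \<ge> 0"
  shows "(\<Sum>d\<in>A. x ^ d / fact d) \<le> exp x"
proof -
  have s: "(\<lambda>d. x ^ d / fact d) sums exp x"
    using exp_converges[of x] by (simp add: divide_inverse mult.commute)
  have "(\<Sum>d\<in>A. x ^ d / fact d) \<le> (\<Sum>d. x ^ d / fact d)"
    using assms by (intro sum_le_suminf sums_summable[OF s]) auto
  then show ?thesis using sums_unique[OF s] by simp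
qed

definition exp_truncated :: "nat \<Rightarrow> complex \<Rightarrow> complex" where
  "exp_truncated K z = (\<Sum>d\<le>K. z ^ d / fact d)"

lemma exp_truncated_linear_form:
  assumes S: "finite S" "\<And>p. p \<in> S \<Longrightarrow> prime p" and f: "completely_multiplicative f"
  shows "exp_truncated K (\<Sum>p\<in>S. z p * f p) = (\<Sum>n\<in>(\<Union>d\<le>K. homogeneous_numbers S d). exp_coeff z n * f n)"
proof -
  have "exp_truncated K (\<Sum>p\<in>S. z p * f p) = (\<Sum>d\<le>K. \<Sum>n\<in>homogeneous_numbers S d. exp_coeff z n * f n)"
    unfolding exp_truncated_def by (intro sum.cong refl power_linear_form(1)[OF S f])
  also have "\<dots> = (\<Sum>n\<in>(\<Union>d\<le>K. homogeneous_numbers S d). exp_coeff z n * f n)"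
    using S by (intro sum.UNION_disjoint[symmetric]) (auto simp: finite_homogeneous_numbers homogeneous_numbers_disjoint)
  finally show ?thesis .
qed

text \<open>The bound on the mean square is that of the full exponential series, whatever the
  truncation; only the length depends on \<open>K\<close>.\<close>

lemma dirichlet_poly_exp_truncated:
  assumes S: "finite S" "\<And>p. p \<in> S \<Longrightarrow> prime p" "\<And>p. p \<in> S \<Longrightarrow> p \<le> B" and B: "B > 0"
  shows "dirichlet_poly S (B ^ K) (exp (\<Sum>p\<in>S. (cmod (z p))\<^sup>2)) (\<lambda>f. exp_truncated K (\<Sum>p\<in>S. z p * f p))"
proof (rule dirichlet_polyI[where A = "\<Union>d\<le>K. homogeneous_numbers S d" and c = "exp_coeff z"])
  let ?V = "\<Sum>p\<in>S. (cmod (z p))\<^sup>2"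
  show "finite (\<Union>d\<le>K. homogeneous_numbers S d)" using S by (simp add: finite_homogeneous_numbers)
  show "(\<Union>d\<le>K. homogeneous_numbers S d) \<subseteq> {n. 0 < n \<and> n \<le> B ^ K \<and> prime_factors n \<subseteq> S}"
  proof safe
    fix n d assume n: "n \<in> homogeneous_numbers S d" "d \<le> K"
    show "n \<le> B ^ K" using homogeneous_numbers_le[of S B n d] S n B power_increasing[of d K B] by auto
  qed (auto simp: homogeneous_numbers_def)
  show "exp_truncated K (\<Sum>p\<in>S. z p * f p) = (\<Sum>n\<in>(\<Union>d\<le>K. homogeneous_numbers S d). exp_coeff z n * f n)"
    if "completely_multiplicative f" for f
    by (rule exp_truncated_linear_form[OF S(1,2) that])
  have "(\<Sum>n\<in>(\<Union>d\<le>K. homogeneous_numbers S d). (cmod (exp_coeff z n))\<^sup>2)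
      = (\<Sum>d\<le>K. \<Sum>n\<in>homogeneous_numbers S d. (cmod (exp_coeff z n))\<^sup>2)"
    using S by (intro sum.UNION_disjoint) (auto simp: finite_homogeneous_numbers homogeneous_numbers_disjoint)
  also have "\<dots> \<le> (\<Sum>d\<le>K. ?V ^ d / fact d)" by (intro sum_mono power_linear_form(2) S)
  also have "\<dots> \<le> exp ?V"
    by (intro exp_series_le sum_nonneg) auto
  finally show "(\<Sum>n\<in>(\<Union>d\<le>K. homogeneous_numbers S d). (cmod (exp_coeff z n))\<^sup>2) \<le> exp ?V" .
qed

section \<open>Truncated exponentials\<close>

text \<open>The error has to be small relative to exp z, whose modulus may be as small as exp (-
  |z|). For |z| <= K/10 the Taylor remainder is exp |z| times at most exp (- 6K/5), and the spare
  K/5 pays for exp (2 |z|).\<close>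

lemma exp_truncated_approx:
  assumes K: "K > 0" and z: "cmod z \<le> real K / 10"
  shows "cmod (exp z - exp_truncated K z) \<le> exp (- real K) * cmod (exp z)"
proof -
  define r where "r = cmod z"
  have r: "0 \<le> r" "r \<le> real K / 10" using z by (auto simp: r_def)
  have "cmod (exp z - (\<Sum>i\<le>K. z ^ i / fact i)) \<le> exp \<bar>Re z\<bar> * (cmod z) ^ Suc K / fact K"
    by (rule Taylor_exp)
  also have "\<dots> \<le> exp r * r ^ Suc K / fact K"
    unfolding r_def by (intro divide_right_mono mult_right_mono) (auto intro: abs_Re_le_cmod)
  also have "\<dots> \<le> exp r * ((real K / 10) ^ Suc K / fact K)"
    using r by (auto intro!: divide_right_mono mult_left_mono power_mono simp del: power_Suc simp flip: times_divide_eq_right)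
  also have "(real K / 10) ^ Suc K / fact K \<le> exp (- (6/5 * real K))"
  proof -
    have f: "real K ^ K / fact K \<le> exp (real K)"
      using exp_series_le[of "{K}" "real K"] by simp
    have e10: "real K / 10 \<le> exp (real K / 10)" using exp_ge_add_one_self[of "real K / 10"] by linarith
    have "(real K / 10) ^ Suc K / fact K = (real K / 10) * (real K ^ K / fact K) * (1/10) ^ K"
      by (simp add: power_divide)
    \<comment> \<open>The rate is 1/10 + 1 - 23/10 = - 6/5: the summands come from the stray factor
      K/10, from K^K / K! <= e^K, and from 10 >= exp (23/10).\<close>
    also have "\<dots> \<le> exp (real K / 10) * exp (real K) * exp (- (23/10)) ^ K"
    proof (intro mult_mono power_mono e10 f)
      have "exp (23/10 :: real) \<le> 10"
      proof -
        have "exp (23/10 :: real) ^ 10 = exp 1 ^ 23" by (simp add: exp_of_nat_mult[symmetric])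
        also have "\<dots> \<le> (272/100) ^ 23" using e_less_272 by (intro power_mono) auto
        also have "\<dots> \<le> 10 ^ 10" by (simp add: power_divide)
        finally show ?thesis using power_mono_iff[of "exp (23/10)" "10::real" 10] by simp
      qed
      then show "1 / 10 \<le> exp (- (23/10) :: real)" by (simp add: exp_minus inverse_eq_divide divide_simps)
    qed auto
    also have "\<dots> = exp (real K / 10 + real K + real K * (- (23/10)))"
      by (simp only: exp_add exp_of_nat_mult)
    also have "real K / 10 + real K + real K * (- (23/10)) = - (6/5 * real K)" by simp
    finally show ?thesis .
  qed
  also have "exp r * exp (- (6/5 * real K)) \<le> exp (- real K) * exp (- r)"
    using r by (simp add: exp_add[symmetric])
  also have "\<dots> \<le> exp (- real K) * cmod (exp z)"
  proof -
    have "- r \<le> Re z" using abs_Re_le_cmod[of z] by (simp add: r_def)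
    then show ?thesis by simp
  qed
  finally show ?thesis by (simp add: exp_truncated_def mult_left_mono)
qed

text \<open>Where the truncation no longer resembles the exponential it still grows only like a
  polynomial of degree \<open>K\<close>, and such growth can be dominated by a high power of the
  argument.\<close>

lemma exp_truncated_large:
  assumes K: "K > 0" and z: "cmod z \<le> \<rho> * real K / 20" and \<rho>: "\<rho> \<ge> 1"
  shows "cmod (exp_truncated K z) \<le> \<rho> ^ K * exp (real K / 20)"
proof -
  have "cmod (exp_truncated K z) \<le> (\<Sum>d\<le>K. cmod (z ^ d / fact d))" unfolding exp_truncated_def by (rule norm_sum)
  also have "\<dots> \<le> (\<Sum>d\<le>K. \<rho> ^ K * ((real K / 20) ^ d / fact d))"
  proof (rule sum_mono)
    fix d assume d: "d \<in> {..K}"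
    have "cmod (z ^ d / fact d) = cmod z ^ d / fact d" by (simp add: norm_divide norm_power)
    also have "\<dots> \<le> (\<rho> * real K / 20) ^ d / fact d" using z by (intro divide_right_mono power_mono) auto
    also have "\<dots> = \<rho> ^ d * ((real K / 20) ^ d / fact d)" by (simp add: power_mult_distrib power_divide)
    also have "\<dots> \<le> \<rho> ^ K * ((real K / 20) ^ d / fact d)"
      using \<rho> d by (intro mult_right_mono power_increasing) auto
    finally show "cmod (z ^ d / fact d) \<le> \<rho> ^ K * ((real K / 20) ^ d / fact d)" .
  qed
  also have "\<dots> = \<rho> ^ K * (\<Sum>d\<le>K. (real K / 20) ^ d / fact d)" by (simp add: sum_distrib_left)
  also have "\<dots> \<le> \<rho> ^ K * exp (real K / 20)"
    using \<rho> by (intro mult_left_mono exp_series_le) auto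
  finally show ?thesis .
qed

text \<open>The pointwise inequality that replaces the fractional power of a truncated exponential by squares
  of polynomials: off the exceptional set where \<open>x\<close> or \<open>y\<close> is large, all truncations are harmless; on it
  the high powers dominate.\<close>

lemma truncated_resonator_le:
  fixes x y :: complex and \<beta> :: real
  assumes K: "K > 0" and \<beta>: "\<beta> \<ge> 1"
  shows "(cmod (exp_truncated K (of_real \<beta> * x)))\<^sup>2 * ((cmod (exp_truncated K (of_real \<beta> * y)))\<^sup>2) powr (1 / \<beta>)
     \<le> exp (8 * exp (- real K)) * (cmod (exp_truncated K (of_real \<beta> * x + y)))\<^sup>2
       + exp (real K / 5) * (20 * \<beta> / real K) ^ (4 * K) * ((cmod (x ^ (2 * K)))\<^sup>2 + (cmod (y ^ (2 * K)))\<^sup>2)"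
proof -
  define R where "R = max (cmod x) (cmod y)"
  define \<epsilon> where "\<epsilon> = exp (- real K)"
  have \<epsilon>: "0 < \<epsilon>" "\<epsilon> \<le> 1 / 2"
  proof -
    have "exp (real K) \<ge> 1 + real K" by (rule exp_ge_add_one_self)
    then have "exp (real K) \<ge> 2" using K by linarith
    then show "\<epsilon> \<le> 1 / 2" by (simp add: \<epsilon>_def exp_minus inverse_eq_divide divide_simps)
  qed (simp add: \<epsilon>_def)
  \<comment> \<open>Below the threshold K / (20 beta) all three arguments beta x, beta y and beta x
    + y have modulus at most K/10, so relative approximation applies to each of them.\<close>
  show ?thesis
  proof (cases "R \<le> real K / (20 * \<beta>)")
    case True
    let ?X = "of_real \<beta> * x" let ?Y = "of_real \<beta> * y"
    have bR: "\<beta> * R \<le> real K / 20"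
      using True \<beta> mult_left_mono[OF True, of \<beta>] by (simp add: field_simps)
    have R0: "R \<ge> 0" "R \<le> \<beta> * R" using \<beta> by (auto simp: R_def mult_le_cancel_right1 intro: mult_right_mono[of 1 \<beta>] simp: max_def)
    have nx: "cmod ?X \<le> \<beta> * R" and ny: "cmod ?Y \<le> \<beta> * R"
      using \<beta> by (auto simp: norm_mult R_def intro!: mult_left_mono)
    have yR: "cmod y \<le> R" by (simp add: R_def)
    have up: "cmod (exp_truncated K z) \<le> (1 + \<epsilon>) * cmod (exp z)" if "cmod z \<le> real K / 10" for z
    proof -
      have "cmod (exp_truncated K z) \<le> cmod (exp z) + cmod (exp z - exp_truncated K z)"
        by (metis norm_minus_commute norm_triangle_sub)
      then show ?thesis using exp_truncated_approx[OF K that] by (simp add: \<epsilon>_def algebra_simps)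
    qed
    have low: "(1 - \<epsilon>) * cmod (exp z) \<le> cmod (exp_truncated K z)" if "cmod z \<le> real K / 10" for z
    proof -
      have "cmod (exp z) \<le> cmod (exp_truncated K z) + cmod (exp z - exp_truncated K z)"
        by (metis norm_triangle_sub)
      then show ?thesis using exp_truncated_approx[OF K that] by (simp add: \<epsilon>_def algebra_simps)
    qed
    have ux: "(cmod (exp_truncated K ?X))\<^sup>2 \<le> ((1 + \<epsilon>) * cmod (exp ?X))\<^sup>2"
      using nx bR by (intro power_mono up) auto
    have "((cmod (exp_truncated K ?Y))\<^sup>2) powr (1 / \<beta>) \<le> (((1 + \<epsilon>) * cmod (exp ?Y))\<^sup>2) powr (1 / \<beta>)"
      using ny bR \<beta> by (intro powr_mono2 power_mono up) auto
    also have "\<dots> = ((1 + \<epsilon>)\<^sup>2) powr (1 / \<beta>) * ((cmod (exp ?Y))\<^sup>2) powr (1 / \<beta>)"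
      using \<epsilon> by (simp add: power_mult_distrib powr_mult)
    \<comment> \<open>The power 1 / beta turns exp (beta y) into exp y. The product of the two
      factors is then |exp (beta x + y)|^2, in which no fractional power is left.\<close>
    also have "((cmod (exp ?Y))\<^sup>2) powr (1 / \<beta>) = (cmod (exp y))\<^sup>2"
    proof -
      have "((cmod (exp ?Y))\<^sup>2) powr (1 / \<beta>) = (exp (2 * (\<beta> * Re y))) powr (1 / \<beta>)"
        by (simp add: exp_double)
      also have "\<dots> = exp (2 * Re y)" using \<beta> by (simp add: powr_def)
      finally show ?thesis by (simp add: exp_double)
    qed
    also have "((1 + \<epsilon>)\<^sup>2) powr (1 / \<beta>) \<le> ((1 + \<epsilon>)\<^sup>2) powr 1"
      using \<epsilon> \<beta> by (intro powr_mono) auto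
    finally have uy: "((cmod (exp_truncated K ?Y))\<^sup>2) powr (1 / \<beta>) \<le> (1 + \<epsilon>)\<^sup>2 * (cmod (exp y))\<^sup>2"
      using \<epsilon> by (simp add: mult_right_mono)
    have sm: "cmod (?X + y) \<le> real K / 10"
      using norm_triangle_ineq[of ?X y] nx yR R0 bR by linarith
    have "(cmod (exp_truncated K ?X))\<^sup>2 * ((cmod (exp_truncated K ?Y))\<^sup>2) powr (1 / \<beta>)
        \<le> ((1 + \<epsilon>) * cmod (exp ?X))\<^sup>2 * ((1 + \<epsilon>)\<^sup>2 * (cmod (exp y))\<^sup>2)"
      using ux uy by (intro mult_mono) auto
    also have "\<dots> = ((1 + \<epsilon>)\<^sup>2 * cmod (exp (?X + y)))\<^sup>2"
      by (simp add: exp_add norm_mult power2_eq_square algebra_simps)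
    also have "\<dots> \<le> (exp (4 * \<epsilon>) * cmod (exp_truncated K (?X + y)))\<^sup>2"
    proof (rule power_mono)
      have "(1 + \<epsilon>)\<^sup>2 \<le> (exp \<epsilon>)\<^sup>2" using \<epsilon> exp_ge_add_one_self[of \<epsilon>] by (intro power_mono) auto
      moreover have "1 \<le> exp (2 * \<epsilon>) * (1 - \<epsilon>)"
      proof -
        have "1 \<le> (1 + 2 * \<epsilon>) * (1 - \<epsilon>)" using \<epsilon> mult_left_mono[of \<epsilon> "1/2" \<epsilon>] by (simp add: algebra_simps)
        also have "\<dots> \<le> exp (2 * \<epsilon>) * (1 - \<epsilon>)"
          using \<epsilon> exp_ge_add_one_self[of "2 * \<epsilon>"] by (intro mult_right_mono) auto
        finally show ?thesis .
      qed
      ultimately have "(1 + \<epsilon>)\<^sup>2 * 1 \<le> (exp \<epsilon>)\<^sup>2 * (exp (2 * \<epsilon>) * (1 - \<epsilon>))"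
        by (intro mult_mono) auto
      also have "\<dots> = exp (4 * \<epsilon>) * (1 - \<epsilon>)"
        by (simp add: exp_double[symmetric] mult.assoc[symmetric] exp_add[symmetric])
      finally have "(1 + \<epsilon>)\<^sup>2 * cmod (exp (?X + y)) \<le> exp (4 * \<epsilon>) * (1 - \<epsilon>) * cmod (exp (?X + y))"
        by (intro mult_right_mono) auto
      also have "\<dots> \<le> exp (4 * \<epsilon>) * cmod (exp_truncated K (?X + y))"
        using low[OF sm] by (simp add: mult.assoc)
      finally show "(1 + \<epsilon>)\<^sup>2 * cmod (exp (?X + y)) \<le> exp (4 * \<epsilon>) * cmod (exp_truncated K (?X + y))" .
    qed (use \<epsilon> in auto)
    also have "\<dots> = exp (8 * \<epsilon>) * (cmod (exp_truncated K (?X + y)))\<^sup>2"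
      by (simp add: power_mult_distrib exp_double[symmetric])
    also have "\<dots> \<le> exp (8 * \<epsilon>) * (cmod (exp_truncated K (?X + y)))\<^sup>2
       + exp (real K / 5) * (20 * \<beta> / real K) ^ (4 * K) * ((cmod (x ^ (2 * K)))\<^sup>2 + (cmod (y ^ (2 * K)))\<^sup>2)"
      using \<beta> by (simp add: zero_le_divide_iff)
    finally show ?thesis by (simp add: \<epsilon>_def)
  next
    case False
    \<comment> \<open>The ratio of \<open>R\<close> to the threshold. Both factors are at most the
      square of a bound containing rho^K, which yields rho^(4K), a multiple of the square of
      R^(2K).\<close>
    define \<rho> where "\<rho> = 20 * \<beta> * R / real K"
    have \<rho>: "\<rho> \<ge> 1" using False \<beta> K by (simp add: \<rho>_def field_simps)
    let ?b = "\<rho> ^ K * exp (real K / 20)"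
    have b1: "?b \<ge> 1" using \<rho> one_le_power[OF \<rho>, of K] by (intro mult_ge1_I) auto
    have nb: "cmod (exp_truncated K (of_real \<beta> * z)) \<le> ?b" if "cmod z \<le> R" for z
    proof (rule exp_truncated_large[OF K _ \<rho>])
      have "cmod (of_real \<beta> * z) \<le> \<beta> * R" using that \<beta> by (simp add: norm_mult mult_left_mono)
      also have "\<dots> = \<rho> * real K / 20" using K by (simp add: \<rho>_def)
      finally show "cmod (of_real \<beta> * z) \<le> \<rho> * real K / 20" .
    qed
    have "((cmod (exp_truncated K (of_real \<beta> * y)))\<^sup>2) powr (1 / \<beta>) \<le> (?b\<^sup>2) powr (1 / \<beta>)"
      using \<beta> by (intro powr_mono2 power_mono nb) (auto simp: R_def)
    \<comment> \<open>Here 1 / beta <= 1 is used: the bound \<open>?b\<close> is at least 1, so the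
      fractional power may be dropped.\<close>
    also have "\<dots> \<le> (?b\<^sup>2) powr 1" using \<beta> b1 by (intro powr_mono one_le_power) auto
    also have "\<dots> = ?b\<^sup>2" using b1 by simp
    finally have "(cmod (exp_truncated K (of_real \<beta> * x)))\<^sup>2 * ((cmod (exp_truncated K (of_real \<beta> * y)))\<^sup>2) powr (1 / \<beta>) \<le> ?b\<^sup>2 * ?b\<^sup>2"
      using nb[of x] by (intro mult_mono power_mono) (auto simp: R_def)
    also have "\<dots> = exp (real K / 5) * \<rho> ^ (4 * K)"
    proof -
      have e: "exp (real K / 5) = exp (real K / 20) ^ 4" by (simp add: exp_of_nat_mult[symmetric])
      have r: "\<rho> ^ (4 * K) = (\<rho> ^ K) ^ 4" by (metis power_mult mult.commute)
      have "a\<^sup>2 * a\<^sup>2 = a ^ 4" for a :: real by (simp add: power2_eq_square power4_eq_xxxx)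
      then show ?thesis unfolding e r power_mult_distrib[symmetric] by (simp only: mult.commute)
    qed
    also have "\<rho> ^ (4 * K) = (20 * \<beta> / real K) ^ (4 * K) * R ^ (4 * K)"
      by (simp add: \<rho>_def power_mult_distrib[symmetric])
    also have "exp (real K / 5) * ((20 * \<beta> / real K) ^ (4 * K) * R ^ (4 * K))
       \<le> exp (real K / 5) * ((20 * \<beta> / real K) ^ (4 * K) * ((cmod (x ^ (2 * K)))\<^sup>2 + (cmod (y ^ (2 * K)))\<^sup>2))"
    proof (intro mult_left_mono)
      have "R ^ (4 * K) \<le> cmod x ^ (4 * K) + cmod y ^ (4 * K)" by (auto simp: R_def max_def)
      then show "R ^ (4 * K) \<le> (cmod (x ^ (2 * K)))\<^sup>2 + (cmod (y ^ (2 * K)))\<^sup>2"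
        by (simp add: norm_power power_mult[symmetric] mult.commute)
    qed (use \<beta> in auto)
    also have "\<dots> \<le> exp (8 * exp (- real K)) * (cmod (exp_truncated K (of_real \<beta> * x + y)))\<^sup>2
       + exp (real K / 5) * (20 * \<beta> / real K) ^ (4 * K) * ((cmod (x ^ (2 * K)))\<^sup>2 + (cmod (y ^ (2 * K)))\<^sup>2)"
      by (simp add: mult.assoc)
    finally show ?thesis .
  qed
qed

section \<open>The resonators and the upper bound\<close>

lemma completely_multiplicative_character:
  "dirichlet_character q chi \<Longrightarrow> completely_multiplicative (\<lambda>n. chi (int n))"
  using dirichlet_character_1[of q chi] by (simp add: completely_multiplicative_def dirichlet_character_def)

definition parity_class :: "nat \<Rightarrow> (int \<Rightarrow> complex) set \<Rightarrow> bool" where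
  "parity_class q X \<longleftrightarrow> prime q \<and> q > 2 \<and> (X = even_characters q \<or> X = odd_characters q)"

lemma parity_class_character:
  "parity_class q X \<Longrightarrow> chi \<in> X \<Longrightarrow> dirichlet_character q chi"
  by (auto simp: parity_class_def even_characters_def odd_characters_def)

lemma finite_parity_class: "parity_class q X \<Longrightarrow> finite X"
  using finite_even_odd_characters[of q] by (auto simp: parity_class_def prime_gt_0_nat)

lemma mean_square_dirichlet_poly:
  assumes X: "parity_class q X" and A: "finite A" "\<And>n. n \<in> A \<Longrightarrow> 0 < n \<and> 2 * n < q"
  shows "(\<Sum>chi\<in>X. (cmod (\<Sum>n\<in>A. c n * chi (int n)))\<^sup>2) = real (q - 1) / 2 * (\<Sum>n\<in>A. (cmod (c n))\<^sup>2)"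
proof -
  have orth: "(\<Sum>chi\<in>X. chi (int a) * cnj (chi (int b))) = (if a = b then of_nat (q - 1) / 2 else 0)"
    if "a \<in> A" "b \<in> A" for a b
    using character_orthogonality[of q X a b] X A that by (simp add: parity_class_def)
  have "complex_of_real (\<Sum>chi\<in>X. (cmod (\<Sum>n\<in>A. c n * chi (int n)))\<^sup>2)
      = (\<Sum>chi\<in>X. \<Sum>a\<in>A. \<Sum>b\<in>A. (c a * cnj (c b)) * (chi (int a) * cnj (chi (int b))))"
    by (simp add: complex_norm_square sum_product mult_ac del: of_real_power)
  also have "\<dots> = (\<Sum>a\<in>A. \<Sum>b\<in>A. (c a * cnj (c b)) * (\<Sum>chi\<in>X. chi (int a) * cnj (chi (int b))))"
    by (subst sum.swap, rule sum.cong[OF refl], subst sum.swap) (simp add: sum_distrib_left)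
  also have "\<dots> = (\<Sum>a\<in>A. \<Sum>b\<in>A. if a = b then c a * cnj (c b) * (of_nat (q - 1) / 2) else 0)"
    by (intro sum.cong refl) (simp add: orth)
  also have "\<dots> = (\<Sum>a\<in>A. c a * cnj (c a) * (of_nat (q - 1) / 2))"
    using A by (simp add: sum.delta')
  also have "\<dots> = complex_of_real (real (q - 1) / 2 * (\<Sum>n\<in>A. (cmod (c n))\<^sup>2))"
    by (simp add: complex_norm_square sum_distrib_left mult_ac del: of_real_power)
  finally show ?thesis by (simp only: of_real_eq_iff)
qed

lemma mean_square_le:
  assumes X: "parity_class q X" and P: "dirichlet_poly S L v P" and L: "2 * L < q"
  shows "(\<Sum>chi\<in>X. (cmod (P (\<lambda>n. chi (int n))))\<^sup>2) \<le> real q * v"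
proof -
  from P obtain A c where A: "finite A" "A \<subseteq> {n. 0 < n \<and> n \<le> L \<and> prime_factors n \<subseteq> S}"
    "\<And>f. completely_multiplicative f \<Longrightarrow> P f = (\<Sum>n\<in>A. c n * f n)"
    "(\<Sum>n\<in>A. (cmod (c n))\<^sup>2) \<le> v" unfolding dirichlet_poly_def by blast
  have "(\<Sum>chi\<in>X. (cmod (P (\<lambda>n. chi (int n))))\<^sup>2) = (\<Sum>chi\<in>X. (cmod (\<Sum>n\<in>A. c n * chi (int n)))\<^sup>2)"
    by (intro sum.cong refl arg_cong[where f = "\<lambda>x. (cmod x)\<^sup>2"] A(3)
          completely_multiplicative_character[of q] parity_class_character[OF X])
  also have "\<dots> = real (q - 1) / 2 * (\<Sum>n\<in>A. (cmod (c n))\<^sup>2)"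
    using A L by (intro mean_square_dirichlet_poly[OF X]) auto
  also have "\<dots> \<le> real q * v"
    using A(4) by (intro mult_mono sum_nonneg) auto
  finally show ?thesis .
qed

text \<open>The trivial pointwise bound by Cauchy-Schwarz. It is affordable for short polynomials
  and is needed where no averaging is available, as at the principal character.\<close>

lemma norm_square_dirichlet_poly_le:
  assumes P: "dirichlet_poly S L v P" and f: "completely_multiplicative f" "\<And>n. cmod (f n) \<le> 1"
  shows "(cmod (P f))\<^sup>2 \<le> real L * v"
proof -
  from P obtain A c where A: "finite A" "A \<subseteq> {n. 0 < n \<and> n \<le> L \<and> prime_factors n \<subseteq> S}"
    "\<And>f. completely_multiplicative f \<Longrightarrow> P f = (\<Sum>n\<in>A. c n * f n)"
    "(\<Sum>n\<in>A. (cmod (c n))\<^sup>2) \<le> v" unfolding dirichlet_poly_def by blast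
  have "cmod (P f) \<le> (\<Sum>n\<in>A. cmod (c n) * 1)"
    unfolding A(3)[OF f(1)] using f(2) by (intro order_trans[OF norm_sum] sum_mono) (simp add: norm_mult mult_left_le)
  then have "(cmod (P f))\<^sup>2 \<le> (\<Sum>n\<in>A. cmod (c n) * 1)\<^sup>2" by (intro power_mono) auto
  also have "\<dots> \<le> (\<Sum>n\<in>A. (cmod (c n))\<^sup>2) * (\<Sum>n\<in>A. 1\<^sup>2)" by (rule Cauchy_Schwarz_ineq_sum)
  also have "\<dots> \<le> v * real L"
  proof (intro mult_mono A(4))
    have "card A \<le> card {1..L}" using A(2) by (intro card_mono) auto
    then show "(\<Sum>n\<in>A. 1\<^sup>2) \<le> real L" by simp
  qed (use dirichlet_poly_nonneg[OF P] in auto)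
  finally show ?thesis by (simp add: mult.commute)
qed

text \<open>Multiplying out gives one product polynomial for every choice of a \<open>j\<close> in
  each block. Its factors live on disjoint sets of primes, so its mean square is bounded by the
  product of the bounds, and the sum over choices factors again.\<close>

lemma mean_prod_sum_squares_le:
  fixes I :: nat and J :: "'j set"
  assumes X: "parity_class q X"
    and P: "\<And>i j. i < I \<Longrightarrow> j \<in> J \<Longrightarrow> dirichlet_poly (S i) (L i) (v i j) (P i j)"
    and dj: "\<And>i j. i < j \<Longrightarrow> j < I \<Longrightarrow> S i \<inter> S j = {}"
    and J: "finite J" and L: "2 * (\<Prod>i<I. L i) < q"
  shows "(\<Sum>chi\<in>X. \<Prod>i<I. \<Sum>j\<in>J. (cmod (P i j (\<lambda>n. chi (int n))))\<^sup>2) \<le> real q * (\<Prod>i<I. \<Sum>j\<in>J. v i j)"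
proof -
  have "(\<Sum>chi\<in>X. \<Prod>i<I. \<Sum>j\<in>J. (cmod (P i j (\<lambda>n. chi (int n))))\<^sup>2)
     = (\<Sum>chi\<in>X. \<Sum>g\<in>{..<I} \<rightarrow>\<^sub>E J. (cmod (\<Prod>i<I. P i (g i) (\<lambda>n. chi (int n))))\<^sup>2)"
    using J by (simp add: prod_sum_PiE prod_norm[symmetric] prod_power_distrib)
  also have "\<dots> = (\<Sum>g\<in>{..<I} \<rightarrow>\<^sub>E J. \<Sum>chi\<in>X. (cmod (\<Prod>i<I. P i (g i) (\<lambda>n. chi (int n))))\<^sup>2)"
    by (rule sum.swap)
  also have "\<dots> \<le> (\<Sum>g\<in>{..<I} \<rightarrow>\<^sub>E J. real q * (\<Prod>i<I. v i (g i)))"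
  proof (rule sum_mono)
    fix g assume g: "g \<in> {..<I} \<rightarrow>\<^sub>E J"
    have "dirichlet_poly (\<Union>i<I. S i) (\<Prod>i<I. L i) (\<Prod>i<I. v i (g i)) (\<lambda>f. \<Prod>i<I. P i (g i) f)"
      by (intro dirichlet_poly_prod P dj) (use g in \<open>auto simp: PiE_mem\<close>)
    from mean_square_le[OF X this L]
    show "(\<Sum>chi\<in>X. (cmod (\<Prod>i<I. P i (g i) (\<lambda>n. chi (int n))))\<^sup>2) \<le> real q * (\<Prod>i<I. v i (g i))" .
  qed
  also have "\<dots> = real q * (\<Prod>i<I. \<Sum>j\<in>J. v i j)"
    using J by (simp add: prod_sum_PiE sum_distrib_left)
  finally show ?thesis .
qed

section \<open>Shifted resonators and the correlation of two shifts\<close>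

text \<open>This is n^(-1/2 - it), written so that modulus and argument can be read off.\<close>

definition twist :: "real \<Rightarrow> nat \<Rightarrow> complex" where
  "twist t n = of_real (real n powr (- 1 / 2)) * cis (- t * ln (real n))"

definition block_sum :: "nat \<Rightarrow> real \<Rightarrow> (nat \<Rightarrow> complex) \<Rightarrow> complex" where
  "block_sum i t f = (\<Sum>p\<in>prime_block i. twist t p * f p)"

text \<open>Only the first-order term of the logarithm of the Euler product is exponentiated, with
  beta = k - 1.\<close>

definition resonator :: "real \<Rightarrow> (nat \<Rightarrow> nat) \<Rightarrow> nat \<Rightarrow> real \<Rightarrow> (nat \<Rightarrow> complex) \<Rightarrow> complex" where
  "resonator \<beta> K I t f = (\<Prod>i<I. exp_truncated (K i) (of_real \<beta> * block_sum i t f))"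

lemma powr_minus_half_sq: "n > 0 \<Longrightarrow> (real n powr (- 1 / 2))\<^sup>2 = 1 / real n"
  unfolding power2_eq_square powr_add[symmetric] by (simp add: powr_minus_divide)

lemma norm_twist_sq: "n > 0 \<Longrightarrow> (cmod (twist t n))\<^sup>2 = 1 / real n"
  by (simp only: twist_def norm_mult norm_of_real norm_cis power_mult_distrib power2_abs powr_minus_half_sq
      one_power2 mult_1_right)

text \<open>The cross term, a cosine of (t - s) ln n, carries the correlation of the two shifts and
  is the source of the decay in |t - s|.\<close>

lemma norm_twist_combination_sq:
  assumes "n > 0"
  shows "(cmod (of_real \<beta> * twist t n + twist s n))\<^sup>2 = (\<beta>\<^sup>2 + 1) * (1 / real n) + 2 * \<beta> * (cos ((t - s) * ln n) / real n)"
proof -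
  let ?r = "real n powr (- 1 / 2)"
  have r: "?r\<^sup>2 = 1 / real n"
    using assms by (rule powr_minus_half_sq)
  have "of_real \<beta> * twist t n + twist s n = of_real ?r * (of_real \<beta> * cis (- t * ln n) + cis (- s * ln n))"
    by (simp add: twist_def algebra_simps)
  then have "(cmod (of_real \<beta> * twist t n + twist s n))\<^sup>2 = 1 / real n * (cmod (of_real \<beta> * cis (- t * ln n) + cis (- s * ln n)))\<^sup>2"
    by (simp only: norm_mult norm_of_real power_mult_distrib power2_abs r)
  also have "(cmod (of_real \<beta> * cis (- t * ln n) + cis (- s * ln n)))\<^sup>2
      = \<beta>\<^sup>2 * ((sin (t * ln n))\<^sup>2 + (cos (t * ln n))\<^sup>2) + ((sin (s * ln n))\<^sup>2 + (cos (s * ln n))\<^sup>2)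
        + 2 * \<beta> * (cos (t * ln n) * cos (s * ln n) + sin (t * ln n) * sin (s * ln n))"
    unfolding cmod_power2
    by (simp add: power2_eq_square algebra_simps
             del: sin_cos_squared_add sin_cos_squared_add2 sin_cos_squared_add3)
  also have "\<dots> = \<beta>\<^sup>2 + 1 + 2 * \<beta> * cos ((t - s) * ln n)"
    by (simp only: sin_cos_squared_add cos_diff left_diff_distrib mult_1_right)
  finally show ?thesis by (simp add: add_divide_distrib)
qed

lemma prime_block_disjoint:
  assumes "i < j"
  shows "prime_block i \<inter> prime_block j = {}"
proof -
  have "(2::nat) ^ Suc i \<le> 2 ^ j" using assms by (intro power_increasing) auto
  then have "(2::nat) ^ 2 ^ Suc i \<le> 2 ^ 2 ^ j" by (rule power_increasing) simp
  then have "x \<notin> prime_block j" if "x \<in> prime_block i" for x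
    using that unfolding prime_block_def by (metis (no_types, lifting) leD le_trans mem_Collect_eq)
  then show ?thesis by blast
qed

lemma prime_block_prime: "p \<in> prime_block i \<Longrightarrow> prime p"
  and prime_block_le: "p \<in> prime_block i \<Longrightarrow> p \<le> 2 ^ 2 ^ Suc i"
  by (auto simp: prime_block_def)

lemma sum_norm_twist_sq_block: "(\<Sum>p\<in>prime_block i. (cmod (twist t p))\<^sup>2) = (\<Sum>p\<in>prime_block i. 1 / real p)"
  by (intro sum.cong refl norm_twist_sq) (auto dest: prime_block_prime prime_gt_0_nat)

lemma dirichlet_poly_resonator:
  assumes "\<beta> \<ge> 0"
  shows "dirichlet_poly (\<Union>i<I. prime_block i) (\<Prod>i<I. (2 ^ 2 ^ Suc i) ^ K i)
     (exp (\<beta>\<^sup>2 * (\<Sum>p\<in>odd_primes_below I. 1 / real p))) (resonator \<beta> K I t)"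
proof -
  have "dirichlet_poly (\<Union>i<I. prime_block i) (\<Prod>i<I. (2 ^ 2 ^ Suc i) ^ K i)
     (\<Prod>i<I. exp (\<Sum>p\<in>prime_block i. (cmod (of_real \<beta> * twist t p))\<^sup>2))
     (\<lambda>f. \<Prod>i<I. exp_truncated (K i) (\<Sum>p\<in>prime_block i. (of_real \<beta> * twist t p) * f p))"
    by (intro dirichlet_poly_prod dirichlet_poly_exp_truncated prime_block_disjoint)
       (auto intro: finite_prime_block prime_block_prime simp del: power_Suc dest: prime_block_le)
  also have "(\<Prod>i<I. exp (\<Sum>p\<in>prime_block i. (cmod (of_real \<beta> * twist t p))\<^sup>2))
     = exp (\<Sum>i<I. \<Sum>p\<in>prime_block i. (cmod (of_real \<beta> * twist t p))\<^sup>2)"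
    by (simp add: exp_sum)
  also have "(\<Sum>i<I. \<Sum>p\<in>prime_block i. (cmod (of_real \<beta> * twist t p))\<^sup>2)
     = \<beta>\<^sup>2 * (\<Sum>p\<in>odd_primes_below I. 1 / real p)"
    by (simp add: norm_mult power_mult_distrib sum_distrib_left[symmetric] sum_norm_twist_sq_block sum_odd_primes_below)
  also have "(\<lambda>f. \<Prod>i<I. exp_truncated (K i) (\<Sum>p\<in>prime_block i. (of_real \<beta> * twist t p) * f p)) = resonator \<beta> K I t"
    by (simp add: fun_eq_iff resonator_def block_sum_def sum_distrib_left mult.assoc)
  finally show ?thesis .
qed

text \<open>The cost of the exceptional set in one block. With v <= 2 the factorial and the power of
  v are at most (4K)^(2K), and (20 beta / K)^2 * 4K = 1600 beta^2 / K. The constant 4800 makes this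
  at most 1/3, below 1/e, so that the total is at most exp (K/5 - 2K).\<close>

lemma large_power_negligible:
  assumes \<beta>: "\<beta> \<ge> 1" and K: "real K \<ge> 4800 * \<beta>\<^sup>2" and v: "0 \<le> v" "v \<le> 2"
  shows "exp (real K / 5) * (20 * \<beta> / real K) ^ (4 * K) * (fact (2 * K) * v ^ (2 * K)) \<le> exp (- real K)"
proof -
  have K0: "real K > 0" using K \<beta> by (smt (verit) one_le_power)
  have "fact (2 * K) * v ^ (2 * K) \<le> real (2 * K) ^ (2 * K) * 2 ^ (2 * K)"
  proof (intro mult_mono power_mono v)
    show "fact (2 * K) \<le> real (2 * K) ^ (2 * K)"
      by (metis of_nat_power fact_le_power)
  qed (use v in auto)
  also have "\<dots> = (real (2 * K) * 2) ^ (2 * K)" by (simp only: power_mult_distrib)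
  also have "real (2 * K) * 2 = 4 * real K" by simp
  finally have "exp (real K / 5) * (20 * \<beta> / real K) ^ (4 * K) * (fact (2 * K) * v ^ (2 * K))
     \<le> exp (real K / 5) * (20 * \<beta> / real K) ^ (4 * K) * (4 * real K) ^ (2 * K)"
    using \<beta> by (intro mult_left_mono) auto
  also have "\<dots> = exp (real K / 5) * (((20 * \<beta> / real K)\<^sup>2) ^ (2 * K) * (4 * real K) ^ (2 * K))"
  proof -
    have "2 * (2 * K) = 4 * K" by simp
    then show ?thesis by (simp only: power_mult[symmetric] mult.assoc)
  qed
  also have "\<dots> = exp (real K / 5) * ((20 * \<beta> / real K)\<^sup>2 * (4 * real K)) ^ (2 * K)"
    by (simp only: power_mult_distrib)
  also have "(20 * \<beta> / real K)\<^sup>2 * (4 * real K) = 1600 * \<beta>\<^sup>2 / real K"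
    using K0 by (simp add: power2_eq_square field_simps)
  also have "exp (real K / 5) * (1600 * \<beta>\<^sup>2 / real K) ^ (2 * K) \<le> exp (real K / 5) * exp (- 1) ^ (2 * K)"
  proof (intro mult_left_mono power_mono)
    have "1600 * \<beta>\<^sup>2 / real K \<le> 1 / 3" using K K0 by (simp add: field_simps)
    also have "\<dots> \<le> exp (- 1)" using e_less_272 by (simp add: exp_minus inverse_eq_divide divide_simps)
    finally show "1600 * \<beta>\<^sup>2 / real K \<le> exp (- 1)" .
  qed (use K0 in auto)
  also have "\<dots> = exp (real K / 5 + real (2 * K) * (- 1))" by (simp only: exp_add exp_of_nat_mult)
  also have "\<dots> \<le> exp (- real K)" by simp
  finally show ?thesis .
qed

text \<open>The pointwise inequality replaces each block by a sum of three squares of polynomials,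
  to which multiplicativity over blocks applies. Lengths involve \<open>2 * K i\<close> because of
  the powers x^(2K) that control the exceptional set.\<close>

lemma twisted_resonator_mean_le:
  assumes X: "parity_class q X" and \<beta>: "\<beta> \<ge> 1"
    and K: "\<And>i. i < I \<Longrightarrow> real (K i) \<ge> 4800 * \<beta>\<^sup>2"
    and L: "2 * (\<Prod>i<I. (2 ^ 2 ^ Suc i) ^ (2 * K i)) < q"
  shows "(\<Sum>chi\<in>X. (cmod (resonator \<beta> K I t (\<lambda>n. chi (int n))))\<^sup>2 *
            ((cmod (resonator \<beta> K I s (\<lambda>n. chi (int n))))\<^sup>2) powr (1 / \<beta>))
     \<le> real q * exp ((\<Sum>p\<in>odd_primes_below I. (cmod (of_real \<beta> * twist t p + twist s p))\<^sup>2) + 10 * (\<Sum>i<I. exp (- real (K i))))"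
proof -
  have K0: "K i > 0" if "i < I" for i
  proof -
    have "real (K i) > 0" using K[OF that] \<beta> by (smt (verit) one_le_power)
    then show ?thesis by simp
  qed
  define D where "D i = exp (real (K i) / 5) * (20 * \<beta> / real (K i)) ^ (4 * K i)" for i
  have D: "D i \<ge> 0" for i using \<beta> by (simp add: D_def)
  \<comment> \<open>Index 0 is the main polynomial, indices 1 and 2 are the high powers of the block
    sums at \<open>t\<close> and \<open>s\<close>; the constants are moved inside the
    squares.\<close>
  define P where "P i j f = (if j = 0 then of_real (exp (4 * exp (- real (K i)))) *
          exp_truncated (K i) (\<Sum>p\<in>prime_block i. (of_real \<beta> * twist t p + twist s p) * f p)
        else of_real (sqrt (D i)) * (\<Sum>p\<in>prime_block i. twist (if j = 1 then t else s) p * f p) ^ (2 * K i))"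
    for i and j :: nat and f
  define V where "V i = (\<Sum>p\<in>prime_block i. (cmod (of_real \<beta> * twist t p + twist s p))\<^sup>2)" for i
  define b where "b i = (\<Sum>p\<in>prime_block i. 1 / real p)" for i
  define v where "v i j = (if j = 0 then exp (8 * exp (- real (K i))) * exp (V i)
        else D i * (fact (2 * K i) * b i ^ (2 * K i)))" for i and j :: nat
  have V0: "V i \<ge> 0" for i unfolding V_def by (intro sum_nonneg) auto
  have dp: "dirichlet_poly (prime_block i) ((2 ^ 2 ^ Suc i) ^ (2 * K i)) (v i j) (P i j)" for i j
  proof (cases "j = 0")
    case True
    have "dirichlet_poly (prime_block i) ((2 ^ 2 ^ Suc i) ^ K i)
      ((cmod (of_real (exp (4 * exp (- real (K i))))))\<^sup>2 * exp (V i)) (P i 0)"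
      unfolding P_def V_def using prime_block_le[of _ i] prime_block_prime[of _ i]
      by (simp only: if_True refl, intro dirichlet_poly_scale dirichlet_poly_exp_truncated) (auto simp: finite_prime_block simp del: power_Suc)
    then show ?thesis
      unfolding True
    proof (rule dirichlet_poly_mono)
      show "(2 ^ 2 ^ Suc i) ^ K i \<le> ((2::nat) ^ 2 ^ Suc i) ^ (2 * K i)" by (intro power_increasing) auto
      show "(cmod (of_real (exp (4 * exp (- real (K i))))))\<^sup>2 * exp (V i) \<le> v i 0"
        by (simp add: v_def exp_double[symmetric])
    qed auto
  next
    case False
    have "dirichlet_poly (prime_block i) ((2 ^ 2 ^ Suc i) ^ (2 * K i))
      ((cmod (of_real (sqrt (D i))))\<^sup>2 * (fact (2 * K i) * (\<Sum>p\<in>prime_block i. (cmod (twist (if j = 1 then t else s) p))\<^sup>2) ^ (2 * K i)))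
      (P i j)"
      unfolding P_def using False prime_block_le[of _ i] prime_block_prime[of _ i]
      by (simp only: if_False refl, intro dirichlet_poly_scale dirichlet_poly_power) (auto simp: finite_prime_block simp del: power_Suc)
    then show ?thesis
      using False D by (simp add: v_def b_def sum_norm_twist_sq_block)
  qed
  have "(\<Sum>chi\<in>X. (cmod (resonator \<beta> K I t (\<lambda>n. chi (int n))))\<^sup>2 *
            ((cmod (resonator \<beta> K I s (\<lambda>n. chi (int n))))\<^sup>2) powr (1 / \<beta>))
     \<le> (\<Sum>chi\<in>X. \<Prod>i<I. \<Sum>j<3. (cmod (P i j (\<lambda>n. chi (int n))))\<^sup>2)"
  proof (rule sum_mono)
    fix chi assume "chi \<in> X"
    define f where "f = (\<lambda>n. chi (int n))"
    let ?x = "\<lambda>i. block_sum i t f" let ?y = "\<lambda>i. block_sum i s f"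
    have pp: "(\<Prod>i<I. g i) powr a = (\<Prod>i<I. g i powr a)" if "\<And>i. g i \<ge> 0" for g :: "nat \<Rightarrow> real" and a
      using that by (induction I) (auto simp: powr_mult prod_nonneg)
    have "(cmod (resonator \<beta> K I t f))\<^sup>2 * ((cmod (resonator \<beta> K I s f))\<^sup>2) powr (1 / \<beta>)
       = (\<Prod>i<I. (cmod (exp_truncated (K i) (of_real \<beta> * ?x i)))\<^sup>2 * ((cmod (exp_truncated (K i) (of_real \<beta> * ?y i)))\<^sup>2) powr (1 / \<beta>))"
      by (simp add: resonator_def prod_norm[symmetric] prod_power_distrib pp prod.distrib)
    also have "\<dots> \<le> (\<Prod>i<I. \<Sum>j<3. (cmod (P i j f))\<^sup>2)"
    proof (rule prod_mono, safe)
      fix i assume i: "i < I"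
      have s3: "(\<Sum>j<3. g j) = g 0 + g 1 + g (2::nat)" for g :: "nat \<Rightarrow> real"
        by (simp add: eval_nat_numeral)
      have lin: "(\<Sum>p\<in>prime_block i. (of_real \<beta> * twist t p + twist s p) * f p) = of_real \<beta> * ?x i + ?y i"
        by (simp add: block_sum_def sum.distrib sum_distrib_left algebra_simps)
      have "(cmod (exp_truncated (K i) (of_real \<beta> * ?x i)))\<^sup>2 * ((cmod (exp_truncated (K i) (of_real \<beta> * ?y i)))\<^sup>2) powr (1 / \<beta>)
        \<le> exp (8 * exp (- real (K i))) * (cmod (exp_truncated (K i) (of_real \<beta> * ?x i + ?y i)))\<^sup>2
       + D i * ((cmod (?x i ^ (2 * K i)))\<^sup>2 + (cmod (?y i ^ (2 * K i)))\<^sup>2)"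
        unfolding D_def by (rule truncated_resonator_le[OF K0[OF i] \<beta>])
      also have "\<dots> = (\<Sum>j<3. (cmod (P i j f))\<^sup>2)"
      proof -
        have "P i 0 f = of_real (exp (4 * exp (- real (K i)))) * exp_truncated (K i) (of_real \<beta> * ?x i + ?y i)"
          by (simp only: P_def if_True refl lin)
        moreover have "P i (Suc 0) f = of_real (sqrt (D i)) * ?x i ^ (2 * K i)"
          and "P i 2 f = of_real (sqrt (D i)) * ?y i ^ (2 * K i)"
          by (simp_all add: P_def block_sum_def)
        ultimately show ?thesis
          unfolding s3 using D[of i]
          by (simp add: norm_mult power_mult_distrib exp_double[symmetric] distrib_left)
      qed
      finally show "(cmod (exp_truncated (K i) (of_real \<beta> * ?x i)))\<^sup>2 * ((cmod (exp_truncated (K i) (of_real \<beta> * ?y i)))\<^sup>2) powr (1 / \<beta>)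
          \<le> (\<Sum>j<3. (cmod (P i j f))\<^sup>2)" .
    qed simp
    finally show "(cmod (resonator \<beta> K I t (\<lambda>n. chi (int n))))\<^sup>2 *
            ((cmod (resonator \<beta> K I s (\<lambda>n. chi (int n))))\<^sup>2) powr (1 / \<beta>) \<le> (\<Prod>i<I. \<Sum>j<3. (cmod (P i j (\<lambda>n. chi (int n))))\<^sup>2)"
      by (simp add: f_def)
  qed
  also have "\<dots> \<le> real q * (\<Prod>i<I. \<Sum>j<3. v i j)"
    by (rule mean_prod_sum_squares_le[OF X, where S = prime_block and L = "\<lambda>i. (2 ^ 2 ^ Suc i) ^ (2 * K i)"])
       (use dp prime_block_disjoint L in auto)
  also have "\<dots> \<le> real q * (\<Prod>i<I. exp (V i + 10 * exp (- real (K i))))"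
  proof (intro mult_left_mono prod_mono conjI)
    fix i assume "i \<in> {..<I}"
    then have i: "i < I" by simp
    have bb: "0 \<le> b i" "b i \<le> 2" unfolding b_def by (auto intro: sum_nonneg sum_inverse_prime_block)
    show "0 \<le> (\<Sum>j<3. v i j)" using D bb by (intro sum_nonneg) (auto simp: v_def)
    let ?\<epsilon> = "exp (- real (K i))"
    have "(\<Sum>j<3. v i j) = exp (8 * ?\<epsilon>) * exp (V i) + 2 * (D i * (fact (2 * K i) * b i ^ (2 * K i)))"
      by (simp add: v_def eval_nat_numeral)
    also have "\<dots> \<le> exp (8 * ?\<epsilon>) * exp (V i) + 2 * ?\<epsilon>"
      using large_power_negligible[OF \<beta> K[OF i] bb] by (simp add: D_def)
    \<comment> \<open>The main term is at least 1, so an additive error is also a multiplicative one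
      and can enter the exponent.\<close>
    also have "\<dots> \<le> exp (8 * ?\<epsilon>) * exp (V i) + (exp (8 * ?\<epsilon>) * exp (V i)) * (2 * ?\<epsilon>)"
    proof -
      have "1 * 1 \<le> exp (8 * ?\<epsilon>) * exp (V i)" using V0[of i] by (intro mult_mono) auto
      then have "1 * (2 * ?\<epsilon>) \<le> (exp (8 * ?\<epsilon>) * exp (V i)) * (2 * ?\<epsilon>)" by (intro mult_right_mono) auto
      then show ?thesis by simp
    qed
    also have "\<dots> = (exp (8 * ?\<epsilon>) * exp (V i)) * (1 + 2 * ?\<epsilon>)" by (simp add: algebra_simps)
    also have "\<dots> \<le> (exp (8 * ?\<epsilon>) * exp (V i)) * exp (2 * ?\<epsilon>)"
      using exp_ge_add_one_self[of "2 * ?\<epsilon>"] by (intro mult_left_mono) auto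
    also have "\<dots> = exp (V i + 10 * ?\<epsilon>)" by (simp add: exp_add[symmetric] algebra_simps)
    finally show "(\<Sum>j<3. v i j) \<le> exp (V i + 10 * ?\<epsilon>)" .
  qed simp
  also have "(\<Prod>i<I. exp (V i + 10 * exp (- real (K i)))) = exp ((\<Sum>p\<in>odd_primes_below I. (cmod (of_real \<beta> * twist t p + twist s p))\<^sup>2) + 10 * (\<Sum>i<I. exp (- real (K i))))"
    by (simp add: exp_sum[symmetric] sum.distrib sum_distrib_left sum_odd_primes_below V_def)
  finally show ?thesis .
qed

section \<open>The energy of the resonators and its moment\<close>

definition truncation :: "nat \<Rightarrow> nat \<Rightarrow> nat \<Rightarrow> nat" where
  "truncation K0 I i = K0 * (I - i)"

definition shifts :: "nat \<Rightarrow> int set" where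
  "shifts I = {- (2 ^ I) <..< 2 ^ I}"

definition resonator_energy :: "real \<Rightarrow> nat \<Rightarrow> nat \<Rightarrow> (nat \<Rightarrow> complex) \<Rightarrow> real" where
  "resonator_energy \<beta> K0 I f =
     (\<Sum>j\<in>shifts I. (cmod (resonator \<beta> (truncation K0 I) I (of_int j / 2 ^ I) f))\<^sup>2)"

lemma finite_shifts: "finite (shifts I)" by (simp add: shifts_def)

lemma card_shifts: "real (card (shifts I)) \<le> 2 * 2 ^ I"
  by (simp add: shifts_def)

lemma sum_truncated_exp_le:
  assumes "K0 \<ge> 1"
  shows "(\<Sum>i<I. exp (- real (truncation K0 I i))) \<le> 1"
proof -
  have "(\<Sum>i<I. exp (- real (truncation K0 I i))) \<le> (\<Sum>i<I. (1/2) ^ Suc (I - Suc i))"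
  proof (rule sum_mono)
    fix i assume "i \<in> {..<I}"
    then have S: "Suc (I - Suc i) = I - i" by auto
    have "I - i \<le> truncation K0 I i" using assms by (simp add: truncation_def)
    then have "exp (- real (truncation K0 I i)) \<le> exp (real (I - i) * (- 1))" by simp
    also have "\<dots> = exp (- 1) ^ (I - i)" by (simp only: exp_of_nat_mult)
    also have "\<dots> \<le> (1/2) ^ (I - i)"
    proof (rule power_mono)
      have "exp (1::real) \<ge> 2" using exp_ge_add_one_self[of 1] by simp
      then show "exp (- 1 :: real) \<le> 1 / 2" by (simp add: exp_minus inverse_eq_divide divide_simps)
    qed simp
    finally show "exp (- real (truncation K0 I i)) \<le> (1/2) ^ Suc (I - Suc i)" by (simp only: S)
  qed
  also have "\<dots> = (\<Sum>m<I. (1/2::real) ^ Suc m)"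
    by (rule sum.nat_diff_reindex)
  also have "\<dots> = 1 - (1/2) ^ I" by (induction I) auto
  also have "\<dots> \<le> 1" by simp
  finally show ?thesis .
qed

text \<open>The sum of 2^i (I - i) is dominated by i near I and remains of order 2^I in spite of the
  growing truncation. The whole length is thus a fixed power of 2^(2^I), the limit of the
  primes.\<close>

lemma prod_length_le:
  "(\<Prod>i<I. (2 ^ 2 ^ Suc i) ^ (2 * truncation K0 I i)) \<le> (2::nat) ^ (8 * K0 * 2 ^ I)"
proof -
  have geo: "(\<Sum>i<n. 2 ^ i) + 1 = (2::nat) ^ n" for n by (induction n) auto
  \<comment> \<open>The exact value of the sum is 2 * 2^I - (I + 2); the subtrahend is moved to the
    left because the numbers are natural.\<close>
  have a: "(\<Sum>i<I. 2 ^ i * (I - i)) + (I + 2) = 2 * (2::nat) ^ I"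
  proof (induction I)
    case (Suc I)
    have "(\<Sum>i<Suc I. 2 ^ i * (Suc I - i)) = (\<Sum>i<I. 2 ^ i * (Suc I - i)) + 2 ^ I" by simp
    also have "(\<Sum>i<I. 2 ^ i * (Suc I - i)) = (\<Sum>i<I. 2 ^ i * (I - i) + 2 ^ i)"
      by (intro sum.cong refl) (auto simp: Suc_diff_le)
    also have "\<dots> = (\<Sum>i<I. 2 ^ i * (I - i)) + (\<Sum>i<I. 2 ^ i)" by (rule sum.distrib)
    finally show ?case using Suc geo[of I] by simp
  qed auto
  have "(\<Prod>i<I. (2 ^ 2 ^ Suc i) ^ (2 * truncation K0 I i)) = (\<Prod>i<I. (2::nat) ^ (4 * K0 * (2 ^ i * (I - i))))"
  proof (rule prod.cong[OF refl])
    fix i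
    have "2 ^ Suc i * (2 * truncation K0 I i) = 4 * K0 * (2 ^ i * (I - i))" by (simp add: truncation_def)
    then show "(2 ^ 2 ^ Suc i) ^ (2 * truncation K0 I i) = (2::nat) ^ (4 * K0 * (2 ^ i * (I - i)))"
      by (simp only: power_mult[symmetric])
  qed
  also have "\<dots> = 2 ^ (4 * K0 * (\<Sum>i<I. 2 ^ i * (I - i)))"
    by (simp only: power_sum[symmetric] sum_distrib_left[symmetric])
  also have "\<dots> \<le> 2 ^ (8 * K0 * 2 ^ I)"
  proof (rule power_increasing)
    have "(\<Sum>i<I. 2 ^ i * (I - i)) \<le> 2 * 2 ^ I" using a by linarith
    then have "4 * K0 * (\<Sum>i<I. 2 ^ i * (I - i)) \<le> 4 * K0 * (2 * 2 ^ I)" by (rule mult_le_mono2)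
    then show "4 * K0 * (\<Sum>i<I. 2 ^ i * (I - i)) \<le> 8 * K0 * 2 ^ I" by simp
  qed simp
  finally show ?thesis .
qed

text \<open>After dividing by the total, every term lies between 0 and 1 and is at most its own r-th
  power.\<close>

lemma powr_sum_le:
  fixes a :: "'b \<Rightarrow> real"
  assumes T: "finite T" "\<And>j. j \<in> T \<Longrightarrow> a j \<ge> 0" and r: "0 < r" "r \<le> 1"
  shows "(\<Sum>j\<in>T. a j) powr r \<le> (\<Sum>j\<in>T. a j powr r)"
proof (cases "(\<Sum>j\<in>T. a j) = 0")
  case True
  then show ?thesis by (simp add: sum_nonneg)
next
  case False
  define S where "S = (\<Sum>j\<in>T. a j)"
  have S: "S > 0" using False T sum_nonneg[of T a] by (simp add: S_def order_less_le)
  have "a j \<le> S" if "j \<in> T" for j unfolding S_def using T that by (intro member_le_sum) auto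
  then have "a j / S \<le> (a j / S) powr r" if "j \<in> T" for j
    using that T S r powr_mono'[of r 1 "a j / S"] by simp
  then have "(\<Sum>j\<in>T. a j / S) \<le> (\<Sum>j\<in>T. (a j / S) powr r)" by (rule sum_mono)
  also have "\<dots> = (\<Sum>j\<in>T. a j powr r) / S powr r"
    using T S by (simp add: powr_divide sum_divide_distrib)
  also have "(\<Sum>j\<in>T. a j / S) = 1" using S by (simp add: sum_divide_distrib[symmetric] S_def)
  finally show ?thesis using S by (simp add: S_def field_simps)
qed

lemma sum_inverse_squares_le:
  fixes A :: "nat set"
  assumes "finite A"
  shows "(\<Sum>n\<in>A. 1 / (1 + real n)\<^sup>2) \<le> 2"
proof -
  have "(\<Sum>n\<in>A. 1 / (1 + real n)\<^sup>2) \<le> (\<Sum>n\<le>Max (insert 0 A). 1 / (1 + real n)\<^sup>2)"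
    using assms by (intro sum_mono2) auto
  also have "(\<Sum>n\<le>N. 1 / (1 + real n)\<^sup>2) \<le> 2 - 1 / (1 + real N)" for N
  proof (induction N)
    case (Suc N)
    have "1 / (1 + real (Suc N))\<^sup>2 \<le> 1 / ((1 + real N) * (1 + real (Suc N)))"
      unfolding power2_eq_square by (intro divide_left_mono mult_right_mono mult_pos_pos) auto
    also have "\<dots> = 1 / (1 + real N) - 1 / (1 + real (Suc N))"
      by (simp add: divide_simps)
    finally show ?case using Suc by simp
  qed simp
  finally show ?thesis by (smt (verit) divide_nonneg_nonneg of_nat_0_le_iff)
qed

lemma sum_inverse_square_int_le:
  fixes D :: "int set"
  assumes "finite D"
  shows "(\<Sum>d\<in>D. (1 + real_of_int \<bar>d\<bar>) powr (- 2)) \<le> 4"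
proof -
  have p: "(1 + real_of_int \<bar>d\<bar>) powr (- 2) = 1 / (1 + real (nat \<bar>d\<bar>))\<^sup>2" for d
    by (simp add: powr_minus_divide)
  have half: "(\<Sum>d\<in>E. 1 / (1 + real (nat \<bar>d\<bar>))\<^sup>2) \<le> 2" if "finite E" "inj_on (\<lambda>d. nat \<bar>d\<bar>) E" for E :: "int set"
    using sum_inverse_squares_le[of "(\<lambda>d. nat \<bar>d\<bar>) ` E"] that by (simp add: sum.reindex)
  have "(\<Sum>d\<in>D. 1 / (1 + real (nat \<bar>d\<bar>))\<^sup>2)
      = (\<Sum>d\<in>{d\<in>D. d \<ge> 0}. 1 / (1 + real (nat \<bar>d\<bar>))\<^sup>2) + (\<Sum>d\<in>{d\<in>D. d < 0}. 1 / (1 + real (nat \<bar>d\<bar>))\<^sup>2)"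
    using assms by (subst sum.union_disjoint[symmetric]) (auto intro: sum.cong)
  also have "\<dots> \<le> 2 + 2"
    using assms by (intro add_mono half) (auto simp: inj_on_def)
  finally show ?thesis unfolding p by simp
qed

text \<open>With x = 1 + |t - s| 2^I the cosine sum is log (2^I / x) + O(1). The exponent becomes
  (beta^2 + 1 + 2 beta) log (2^I) - 2 beta log x, and the first coefficient is the square of beta +
  1 = k.\<close>

lemma twisted_exponent_le:
  assumes \<beta>: "\<beta> \<ge> 1" and u: "\<bar>t - s\<bar> \<le> 2"
  shows "exp (\<Sum>p\<in>odd_primes_below I. (cmod (of_real \<beta> * twist t p + twist s p))\<^sup>2)
     \<le> exp (20 * (\<beta> + 1)\<^sup>2) * (2 ^ I) powr ((\<beta> + 1)\<^sup>2) * (1 + \<bar>t - s\<bar> * 2 ^ I) powr (- 2)"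
proof -
  define x where "x = 1 + \<bar>t - s\<bar> * 2 ^ I"
  have x: "x \<ge> 1" by (simp add: x_def)
  have "(\<Sum>p\<in>odd_primes_below I. (cmod (of_real \<beta> * twist t p + twist s p))\<^sup>2)
     = (\<Sum>p\<in>odd_primes_below I. (\<beta>\<^sup>2 + 1) * (1 / real p) + 2 * \<beta> * (cos ((t - s) * ln p) / real p))"
    by (intro sum.cong refl norm_twist_combination_sq) (auto simp: odd_primes_below_def)
  also have "\<dots> = (\<beta>\<^sup>2 + 1) * (\<Sum>p\<in>odd_primes_below I. 1 / real p) + 2 * \<beta> * (\<Sum>p\<in>odd_primes_below I. cos ((t - s) * ln p) / real p)"
    by (simp only: sum.distrib sum_distrib_left)
  also have "\<dots> \<le> (\<beta>\<^sup>2 + 1) * (real I * ln 2 + 20) + 2 * \<beta> * (ln (2 ^ I / x) + 20)"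
    unfolding x_def using \<beta> by (intro add_mono mult_left_mono sum_inverse_odd_primes_le sum_cos_odd_primes_le u) auto
  also have "ln (2 ^ I / x) = real I * ln 2 - ln x"
    using x by (subst ln_div) (auto simp: ln_realpow)
  also have "(\<beta>\<^sup>2 + 1) * (real I * ln 2 + 20) + 2 * \<beta> * (real I * ln 2 - ln x + 20)
     = 20 * (\<beta> + 1)\<^sup>2 + (\<beta> + 1)\<^sup>2 * (real I * ln 2) - 2 * (\<beta> * ln x)"
    by (simp add: power2_eq_square algebra_simps)
  \<comment> \<open>As beta >= 1, the decay x^(-2 beta) may be weakened to x^(-2), which is summable
    with a bound free of beta.\<close>
  also have "\<dots> \<le> 20 * (\<beta> + 1)\<^sup>2 + (\<beta> + 1)\<^sup>2 * (real I * ln 2) + (- 2) * ln x"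
    using mult_right_mono[OF \<beta>, of "ln x"] ln_ge_zero[OF x] by linarith
  finally have "exp (\<Sum>p\<in>odd_primes_below I. (cmod (of_real \<beta> * twist t p + twist s p))\<^sup>2)
     \<le> exp (20 * (\<beta> + 1)\<^sup>2 + (\<beta> + 1)\<^sup>2 * (real I * ln 2) + (- 2) * ln x)" by simp
  also have "\<dots> = exp (20 * (\<beta> + 1)\<^sup>2) * exp ((\<beta> + 1)\<^sup>2 * (real I * ln 2)) * exp ((- 2) * ln x)"
    by (simp only: exp_add)
  also have "exp ((\<beta> + 1)\<^sup>2 * (real I * ln 2)) = (2 ^ I) powr ((\<beta> + 1)\<^sup>2)"
    by (simp add: powr_def ln_realpow)
  also have "exp ((- 2) * ln x) = x powr (- 2)"
    using x by (simp add: powr_def)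
  finally show ?thesis unfolding x_def .
qed

text \<open>Write W^(1 + 1/beta) as W * W^(1/beta) and use subadditivity of the power 1/beta. For
  fixed \<open>j\<close> the sum over \<open>l\<close> converges, so that only the number of shifts
  is left: it accounts for the + 1 in the exponent.\<close>

lemma resonator_energy_moment_le:
  assumes X: "parity_class q X" and \<beta>: "\<beta> \<ge> 1"
    and K0: "real K0 \<ge> 4800 * \<beta>\<^sup>2" and L: "2 * 2 ^ (8 * K0 * 2 ^ I) < q"
  shows "(\<Sum>chi\<in>X. resonator_energy \<beta> K0 I (\<lambda>n. chi (int n)) powr (1 + 1 / \<beta>))
     \<le> 8 * exp (20 * (\<beta> + 1)\<^sup>2 + 10) * (real q * (2 ^ I) powr ((\<beta> + 1)\<^sup>2 + 1))"
proof -
  define A where "A j f = (cmod (resonator \<beta> (truncation K0 I) I (of_int j / 2 ^ I) f))\<^sup>2" for j :: int and f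
  define C where "C = exp (20 * (\<beta> + 1)\<^sup>2 + 10)"
  have K01: "K0 \<ge> 1"
  proof -
    have "real K0 > 0" using K0 \<beta> by (smt (verit) one_le_power)
    then show ?thesis by simp
  qed
  have pair: "(\<Sum>chi\<in>X. A j (\<lambda>n. chi (int n)) * A l (\<lambda>n. chi (int n)) powr (1 / \<beta>))
      \<le> real q * (C * (2 ^ I) powr ((\<beta> + 1)\<^sup>2)) * (1 + real_of_int \<bar>j - l\<bar>) powr (- 2)"
    if "j \<in> shifts I" "l \<in> shifts I" for j l
  proof -
    \<comment> \<open>Both shifts lie in (-1, 1); their distance is at most 2, as the cosine bound
      requires.\<close>
    let ?t = "of_int j / 2 ^ I :: real" and ?s = "of_int l / 2 ^ I :: real"
    have ts: "\<bar>?t - ?s\<bar> * 2 ^ I = real_of_int \<bar>j - l\<bar>"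
      by (simp add: diff_divide_distrib[symmetric] abs_divide)
    have "\<bar>j - l\<bar> \<le> 2 * 2 ^ I" using that by (auto simp: shifts_def)
    then have "real_of_int \<bar>j - l\<bar> \<le> real_of_int (2 * 2 ^ I)" by (simp only: of_int_le_iff)
    then have "\<bar>?t - ?s\<bar> * 2 ^ I \<le> 2 * 2 ^ I" unfolding ts by simp
    then have u: "\<bar>?t - ?s\<bar> \<le> 2" by (rule mult_right_le_imp_le) simp
    have "(\<Sum>chi\<in>X. A j (\<lambda>n. chi (int n)) * A l (\<lambda>n. chi (int n)) powr (1 / \<beta>))
       \<le> real q * exp ((\<Sum>p\<in>odd_primes_below I. (cmod (of_real \<beta> * twist ?t p + twist ?s p))\<^sup>2) + 10 * (\<Sum>i<I. exp (- real (truncation K0 I i))))"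
      unfolding A_def
    proof (rule twisted_resonator_mean_le[OF X \<beta>])
      fix i assume "i < I"
      then have "K0 * 1 \<le> K0 * (I - i)" by (intro mult_le_mono2) simp
      then have "K0 \<le> truncation K0 I i" by (simp add: truncation_def)
      then show "real (truncation K0 I i) \<ge> 4800 * \<beta>\<^sup>2" using K0 by linarith
    qed (rule le_less_trans[OF mult_le_mono2[OF prod_length_le] L])
    also have "\<dots> \<le> real q * (exp (20 * (\<beta> + 1)\<^sup>2) * (2 ^ I) powr ((\<beta> + 1)\<^sup>2) * (1 + \<bar>?t - ?s\<bar> * 2 ^ I) powr (- 2) * exp 10)"
      unfolding exp_add using sum_truncated_exp_le[OF K01, of I]
      by (intro mult_left_mono mult_mono twisted_exponent_le[OF \<beta> u]) auto
    also have "\<dots> = real q * (C * (2 ^ I) powr ((\<beta> + 1)\<^sup>2)) * (1 + real_of_int \<bar>j - l\<bar>) powr (- 2)"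
      unfolding ts by (simp add: C_def exp_add)
    finally show ?thesis .
  qed
  have "(\<Sum>chi\<in>X. resonator_energy \<beta> K0 I (\<lambda>n. chi (int n)) powr (1 + 1 / \<beta>))
     \<le> (\<Sum>chi\<in>X. \<Sum>j\<in>shifts I. \<Sum>l\<in>shifts I. A j (\<lambda>n. chi (int n)) * A l (\<lambda>n. chi (int n)) powr (1 / \<beta>))"
  proof (rule sum_mono)
    fix chi :: "int \<Rightarrow> complex"
    let ?f = "\<lambda>n. chi (int n)" let ?W = "\<Sum>j\<in>shifts I. A j ?f"
    have A0: "A j ?f \<ge> 0" for j by (simp add: A_def)
    have "resonator_energy \<beta> K0 I ?f powr (1 + 1 / \<beta>) = ?W * ?W powr (1 / \<beta>)"
      by (simp add: resonator_energy_def A_def powr_add sum_nonneg)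
    also have "\<dots> \<le> ?W * (\<Sum>l\<in>shifts I. A l ?f powr (1 / \<beta>))"
      using \<beta> A0 by (intro mult_left_mono powr_sum_le sum_nonneg) (auto simp: finite_shifts)
    finally show "resonator_energy \<beta> K0 I ?f powr (1 + 1 / \<beta>) \<le> (\<Sum>j\<in>shifts I. \<Sum>l\<in>shifts I. A j ?f * A l ?f powr (1 / \<beta>))"
      by (simp add: sum_product)
  qed
  also have "\<dots> = (\<Sum>j\<in>shifts I. \<Sum>l\<in>shifts I. \<Sum>chi\<in>X. A j (\<lambda>n. chi (int n)) * A l (\<lambda>n. chi (int n)) powr (1 / \<beta>))"
    by (subst sum.swap, rule sum.cong[OF refl], subst sum.swap) simp
  also have "\<dots> \<le> (\<Sum>j\<in>shifts I. \<Sum>l\<in>shifts I. real q * (C * (2 ^ I) powr ((\<beta> + 1)\<^sup>2)) * (1 + real_of_int \<bar>j - l\<bar>) powr (- 2))"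
    by (intro sum_mono pair)
  also have "\<dots> = real q * (C * (2 ^ I) powr ((\<beta> + 1)\<^sup>2)) * (\<Sum>j\<in>shifts I. \<Sum>l\<in>shifts I. (1 + real_of_int \<bar>j - l\<bar>) powr (- 2))"
    by (simp only: sum_distrib_left)
  also have "\<dots> \<le> real q * (C * (2 ^ I) powr ((\<beta> + 1)\<^sup>2)) * (\<Sum>j\<in>shifts I. 4)"
  proof (intro mult_left_mono sum_mono)
    fix j
    have "(\<Sum>l\<in>shifts I. (1 + real_of_int \<bar>j - l\<bar>) powr (- 2)) = (\<Sum>d\<in>(\<lambda>l. j - l) ` shifts I. (1 + real_of_int \<bar>d\<bar>) powr (- 2))"
      by (subst sum.reindex) (auto simp: inj_on_def)
    also have "\<dots> \<le> 4" by (intro sum_inverse_square_int_le finite_imageI finite_shifts)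
    finally show "(\<Sum>l\<in>shifts I. (1 + real_of_int \<bar>j - l\<bar>) powr (- 2)) \<le> 4" .
  qed (simp add: C_def)
  also have "\<dots> \<le> real q * (C * (2 ^ I) powr ((\<beta> + 1)\<^sup>2)) * (8 * 2 ^ I)"
    using card_shifts[of I] by (intro mult_left_mono) (auto simp: C_def)
  also have "\<dots> = 8 * C * (real q * (2 ^ I) powr ((\<beta> + 1)\<^sup>2 + 1))"
    by (simp add: powr_add)
  finally show ?thesis unfolding C_def .
qed

text \<open>Far from the truth on average, but only a small power of q because the resonator is
  short.\<close>

lemma resonator_energy_le:
  assumes \<beta>: "\<beta> \<ge> 0" and f: "completely_multiplicative f" "\<And>n. cmod (f n) \<le> 1"
  shows "resonator_energy \<beta> K0 I f \<le> 2 * 2 ^ I * (2 ^ (8 * K0 * 2 ^ I) * (exp (20 * \<beta>\<^sup>2) * (2 ^ I) powr \<beta>\<^sup>2))"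
proof -
  have "resonator_energy \<beta> K0 I f \<le> (\<Sum>j\<in>shifts I. 2 ^ (8 * K0 * 2 ^ I) * (exp (20 * \<beta>\<^sup>2) * (2 ^ I) powr \<beta>\<^sup>2))"
    unfolding resonator_energy_def
  proof (rule sum_mono)
    fix j
    have "(cmod (resonator \<beta> (truncation K0 I) I (of_int j / 2 ^ I) f))\<^sup>2
       \<le> real (\<Prod>i<I. (2 ^ 2 ^ Suc i) ^ truncation K0 I i) * exp (\<beta>\<^sup>2 * (\<Sum>p\<in>odd_primes_below I. 1 / real p))"
      by (rule norm_square_dirichlet_poly_le[OF dirichlet_poly_resonator[OF \<beta>] f])
    also have "\<dots> \<le> real (2 ^ (8 * K0 * 2 ^ I)) * exp (\<beta>\<^sup>2 * (real I * ln 2 + 20))"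
    proof (intro mult_mono)
      have "(\<Prod>i<I. (2 ^ 2 ^ Suc i) ^ truncation K0 I i) \<le> (\<Prod>i<I. ((2::nat) ^ 2 ^ Suc i) ^ (2 * truncation K0 I i))"
        by (intro prod_mono conjI power_increasing) auto
      also have "\<dots> \<le> 2 ^ (8 * K0 * 2 ^ I)" by (rule prod_length_le)
      finally show "real (\<Prod>i<I. (2 ^ 2 ^ Suc i) ^ truncation K0 I i) \<le> real (2 ^ (8 * K0 * 2 ^ I))"
        by (simp only: of_nat_le_iff)
      show "exp (\<beta>\<^sup>2 * (\<Sum>p\<in>odd_primes_below I. 1 / real p)) \<le> exp (\<beta>\<^sup>2 * (real I * ln 2 + 20))"
        using sum_inverse_odd_primes_le[of I] by (simp add: mult_left_mono)
    qed auto
    also have "exp (\<beta>\<^sup>2 * (real I * ln 2 + 20)) = exp (20 * \<beta>\<^sup>2) * (2 ^ I) powr \<beta>\<^sup>2"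
      by (simp add: powr_def ln_realpow exp_add[symmetric] algebra_simps)
    finally show "(cmod (resonator \<beta> (truncation K0 I) I (of_int j / 2 ^ I) f))\<^sup>2
       \<le> 2 ^ (8 * K0 * 2 ^ I) * (exp (20 * \<beta>\<^sup>2) * (2 ^ I) powr \<beta>\<^sup>2)" by simp
  qed
  also have "\<dots> \<le> 2 * 2 ^ I * (2 ^ (8 * K0 * 2 ^ I) * (exp (20 * \<beta>\<^sup>2) * (2 ^ I) powr \<beta>\<^sup>2))"
    using card_shifts[of I] by (simp add: mult_right_mono)
  finally show ?thesis .
qed

section \<open>The lower bound\<close>

lemma twist_1: "twist t 1 = 1"
  by (simp add: twist_def)

lemma twist_mult: "m > 0 \<Longrightarrow> n > 0 \<Longrightarrow> twist t (m * n) = twist t m * twist t n"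
  by (simp add: twist_def powr_mult ln_mult algebra_simps cis_mult)

text \<open>The shift enters only through the factor n^(-1/2 - it). What remains is real,
  nonnegative when beta is, and independent of \<open>t\<close>, as the positivity argument with
  Fejer weights demands.\<close>

lemma exp_coeff_twist:
  assumes "n > 0"
  shows "exp_coeff (\<lambda>p. of_real \<beta> * twist t p) n = of_real (exp_coeff (\<lambda>_. \<beta>) n) * twist t n"
proof -
  have "twist t n = (\<Prod>p\<in>prime_factors n. twist t p ^ multiplicity p n)"
    by (rule completely_multiplicative_prod) (use assms twist_1 twist_mult in auto)
  then show ?thesis
    by (simp add: exp_coeff_def power_mult_distrib prod.distrib prod_dividef)
qed

lemma exp_coeff_nonneg: "\<beta> \<ge> 0 \<Longrightarrow> exp_coeff (\<lambda>_. \<beta> :: real) n \<ge> 0"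
  by (auto simp: exp_coeff_def intro!: prod_nonneg)

lemma prod_set_of_primes:
  fixes R :: "nat set"
  assumes "finite R" "\<And>p. p \<in> R \<Longrightarrow> prime p"
  shows "\<Prod>R > 0" "prime_factors (\<Prod>R) = R" "size (prime_factorization (\<Prod>R)) = card R"
    and "exp_coeff (\<lambda>_. \<beta> :: real) (\<Prod>R) = \<beta> ^ card R"
proof -
  show pos: "\<Prod>R > 0" using assms by (intro prod_pos) (auto simp: prime_gt_0_nat)
  have mult: "multiplicity p (\<Prod>R) = (if p \<in> R then 1 else 0)" if "prime p" for p
    using multiplicity_prod_prime_powers[of R p "\<lambda>_. 1"] assms that by simp
  show pf: "prime_factors (\<Prod>R) = R"
    using mult assms by (auto simp: prime_factors_multiplicity split: if_splits)
  show "exp_coeff (\<lambda>_. \<beta> :: real) (\<Prod>R) = \<beta> ^ card R"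
    unfolding exp_coeff_def pf using mult assms by simp
  show "size (prime_factorization (\<Prod>R)) = card R"
    using assms
  proof (induction R rule: finite_induct)
    case (insert p R)
    have "\<Prod>R > 0" using insert by (intro prod_pos) (auto simp: prime_gt_0_nat)
    then show ?case
      using insert by (simp add: size_prime_factorization_mult prime_gt_0_nat prime_factorization_prime)
  qed simp
qed

section \<open>The coefficients of the resonator\<close>

text \<open>A set of primes stands for the squarefree number that is its product. The admissible
  ones are those that survive the truncation in every block.\<close>

definition admissible_sets :: "(nat \<Rightarrow> nat) \<Rightarrow> nat \<Rightarrow> nat set set" where
  "admissible_sets K I = {R. R \<subseteq> odd_primes_below I \<and> (\<forall>i<I. card (R \<inter> prime_block i) \<le> K i)}"

text \<open>Induction over the blocks. Exact coefficients are recorded only at admissible squarefree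
  numbers, where all factorials are 1; for the other numbers nonnegativity is enough, since they are
  discarded in the lower bound.\<close>

lemma resonator_expansion:
  assumes \<beta>: "\<beta> \<ge> 0"
  shows "\<exists>M a. finite M \<and> M \<subseteq> {m. 0 < m \<and> m \<le> (\<Prod>i<I. (2 ^ 2 ^ Suc i) ^ K i) \<and> prime_factors m \<subseteq> odd_primes_below I}
     \<and> (\<forall>m\<in>M. a m \<ge> 0)
     \<and> (\<forall>t f. completely_multiplicative f \<longrightarrow> resonator \<beta> K I t f = (\<Sum>m\<in>M. of_real (a m) * twist t m * f m))
     \<and> (\<forall>R\<in>admissible_sets K I. \<Prod>R \<in> M \<and> a (\<Prod>R) = \<beta> ^ card R)"
proof (induction I)
  case 0
  show ?case
    by (rule exI[of _ "{1}"], rule exI[of _ "\<lambda>_. 1"])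
       (auto simp: resonator_def completely_multiplicative_def twist_1[simplified] admissible_sets_def odd_primes_below_0)
next
  case (Suc I)
  from Suc.IH obtain M a where *: "finite M \<and> M \<subseteq> {m. 0 < m \<and> m \<le> (\<Prod>i<I. (2 ^ 2 ^ Suc i) ^ K i) \<and> prime_factors m \<subseteq> odd_primes_below I}
     \<and> (\<forall>m\<in>M. a m \<ge> 0)
     \<and> (\<forall>t f. completely_multiplicative f \<longrightarrow> resonator \<beta> K I t f = (\<Sum>m\<in>M. of_real (a m) * twist t m * f m))
     \<and> (\<forall>R\<in>admissible_sets K I. \<Prod>R \<in> M \<and> a (\<Prod>R) = \<beta> ^ card R)"
    by (elim exE) (rule that)
  note M = *[THEN conjunct1] *[THEN conjunct2, THEN conjunct1]
  note a = *[THEN conjunct2, THEN conjunct2, THEN conjunct1, rule_format]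
  note exp = *[THEN conjunct2, THEN conjunct2, THEN conjunct2, THEN conjunct1, rule_format]
  note adm = *[THEN conjunct2, THEN conjunct2, THEN conjunct2, THEN conjunct2, rule_format]
  let ?B = "prime_block I"
  define N where "N = (\<Union>d\<le>K I. homogeneous_numbers ?B d)"
  define e where "e n = exp_coeff (\<lambda>_. \<beta>) n" for n
  define h where "h = (\<lambda>(m::nat, n::nat). m * n)"
  have finN: "finite N" by (simp add: N_def finite_homogeneous_numbers finite_prime_block)
  have N: "0 < n \<and> n \<le> (2 ^ 2 ^ Suc I) ^ K I \<and> prime_factors n \<subseteq> ?B" if "n \<in> N" for n
  proof -
    from that obtain d where d: "d \<le> K I" "n \<in> homogeneous_numbers ?B d" by (auto simp: N_def)
    have "n \<le> (2 ^ 2 ^ Suc I) ^ d" using d(2) by (rule homogeneous_numbers_le[rotated]) (rule prime_block_le)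
    also have "\<dots> \<le> (2 ^ 2 ^ Suc I) ^ K I" using d(1) by (intro power_increasing) auto
    finally show ?thesis using d(2) by (auto simp: homogeneous_numbers_def)
  qed
  have inj: "inj_on h (M \<times> N)"
    unfolding h_def using M(2) N odd_primes_below_Suc(2)
    by (intro inj_on_mult_disjoint_prime_factors[of M "odd_primes_below I" N ?B]) auto
  define a' where "a' x = (case the_inv_into (M \<times> N) h x of (m, n) \<Rightarrow> a m * e n)" for x
  have a': "a' (h (m, n)) = a m * e n" if "m \<in> M" "n \<in> N" for m n
    using that by (simp add: a'_def the_inv_into_f_f[OF inj])
  show ?case
  proof (rule exI[of _ "h ` (M \<times> N)"], rule exI[of _ a'], intro conjI)
    show "finite (h ` (M \<times> N))" using M finN by simp
    show "h ` (M \<times> N) \<subseteq> {m. 0 < m \<and> m \<le> (\<Prod>i<Suc I. (2 ^ 2 ^ Suc i) ^ K i) \<and> prime_factors m \<subseteq> odd_primes_below (Suc I)}"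
    proof safe
      fix m n assume mn: "m \<in> M" "n \<in> N"
      have m: "0 < m" "m \<le> (\<Prod>i<I. (2 ^ 2 ^ Suc i) ^ K i)" "prime_factors m \<subseteq> odd_primes_below I" using mn M(2) by auto
      have n: "0 < n" "n \<le> (2 ^ 2 ^ Suc I) ^ K I" "prime_factors n \<subseteq> ?B" using mn N by auto
      show "0 < h (m, n)" using m n by (simp add: h_def)
      show "h (m, n) \<le> (\<Prod>i<Suc I. (2 ^ 2 ^ Suc i) ^ K i)"
        using mult_mono[OF m(2) n(2)] by (simp add: h_def)
      fix p assume "p \<in> prime_factors (h (m, n))"
      then show "p \<in> odd_primes_below (Suc I)"
        using m n by (auto simp: h_def prime_factors_product odd_primes_below_Suc)
    qed
    show "\<forall>m\<in>h ` (M \<times> N). a' m \<ge> 0"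
      using a a' exp_coeff_nonneg[OF \<beta>] by (auto simp: e_def intro!: mult_nonneg_nonneg)
    show "\<forall>t f. completely_multiplicative f \<longrightarrow> resonator \<beta> K (Suc I) t f = (\<Sum>m\<in>h ` (M \<times> N). of_real (a' m) * twist t m * f m)"
    proof (intro allI impI)
      fix t f assume f: "completely_multiplicative f"
      have "exp_truncated (K I) (of_real \<beta> * block_sum I t f) = exp_truncated (K I) (\<Sum>p\<in>?B. (of_real \<beta> * twist t p) * f p)"
        by (simp add: block_sum_def sum_distrib_left mult.assoc)
      also have "\<dots> = (\<Sum>n\<in>N. exp_coeff (\<lambda>p. of_real \<beta> * twist t p) n * f n)"
        unfolding N_def by (rule exp_truncated_linear_form[OF finite_prime_block prime_block_prime f])
      also have "\<dots> = (\<Sum>n\<in>N. of_real (e n) * twist t n * f n)"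
        using N by (intro sum.cong refl) (simp add: exp_coeff_twist e_def)
      finally have E: "exp_truncated (K I) (of_real \<beta> * block_sum I t f) = (\<Sum>n\<in>N. of_real (e n) * twist t n * f n)" .
      have "resonator \<beta> K (Suc I) t f = resonator \<beta> K I t f * exp_truncated (K I) (of_real \<beta> * block_sum I t f)"
        by (simp add: resonator_def)
      also have "\<dots> = (\<Sum>b\<in>M \<times> N. (of_real (a (fst b)) * twist t (fst b) * f (fst b)) * (of_real (e (snd b)) * twist t (snd b) * f (snd b)))"
        by (simp add: E exp[OF f] sum_product sum.cartesian_product case_prod_unfold)
      also have "\<dots> = (\<Sum>b\<in>M \<times> N. of_real (a' (h b)) * twist t (h b) * f (h b))"
      proof (rule sum.cong[OF refl])
        fix b assume "b \<in> M \<times> N"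
        then obtain m n where b: "b = (m, n)" "m \<in> M" "n \<in> N" by auto
        then have "m > 0" "n > 0" using M(2) N by auto
        then show "(of_real (a (fst b)) * twist t (fst b) * f (fst b)) * (of_real (e (snd b)) * twist t (snd b) * f (snd b))
          = of_real (a' (h b)) * twist t (h b) * f (h b)"
          using b a'[OF b(2,3)] f by (simp add: h_def twist_mult completely_multiplicative_def)
      qed
      also have "\<dots> = (\<Sum>m\<in>h ` (M \<times> N). of_real (a' m) * twist t m * f m)"
        by (simp add: sum.reindex[OF inj])
      finally show "resonator \<beta> K (Suc I) t f = (\<Sum>m\<in>h ` (M \<times> N). of_real (a' m) * twist t m * f m)" .
    qed
    show "\<forall>R\<in>admissible_sets K (Suc I). \<Prod>R \<in> h ` (M \<times> N) \<and> a' (\<Prod>R) = \<beta> ^ card R"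
    proof
      fix R assume R: "R \<in> admissible_sets K (Suc I)"
      define R1 where "R1 = R \<inter> odd_primes_below I"
      define R2 where "R2 = R \<inter> ?B"
      have fin: "finite R1" "finite R2" by (auto simp: R1_def R2_def finite_odd_primes_below finite_prime_block)
      have R12: "R = R1 \<union> R2" "R1 \<inter> R2 = {}"
        using R odd_primes_below_Suc[of I] by (auto simp: R1_def R2_def admissible_sets_def)
      have "prime_block i \<subseteq> odd_primes_below I" if "i < I" for i
        using odd_primes_below_Suc(1)[of i] odd_primes_below_mono[of "Suc i" I] that by auto
      then have "R1 \<inter> prime_block i = R \<inter> prime_block i" if "i < I" for i
        using that by (auto simp: R1_def)
      then have "R1 \<in> admissible_sets K I" using R by (auto simp: admissible_sets_def R1_def)
      then have 1: "\<Prod>R1 \<in> M" "a (\<Prod>R1) = \<beta> ^ card R1" using adm by auto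
      have p2: "\<And>p. p \<in> R2 \<Longrightarrow> prime p" by (auto simp: R2_def prime_block_def)
      note P = prod_set_of_primes[OF fin(2) p2]
      have "card R2 \<le> K I" using R by (auto simp: admissible_sets_def R2_def)
      then have 2: "\<Prod>R2 \<in> N" using P by (auto simp: N_def homogeneous_numbers_def R2_def)
      have "\<Prod>R = h (\<Prod>R1, \<Prod>R2)" using R12 fin by (simp add: h_def prod.union_disjoint)
      moreover have "card R = card R1 + card R2" using R12 fin by (simp add: card_Un_disjoint)
      ultimately show "\<Prod>R \<in> h ` (M \<times> N) \<and> a' (\<Prod>R) = \<beta> ^ card R"
        using 1 2 P(4)[of \<beta>] a'[OF 1(1) 2] by (auto simp: e_def power_add)
    qed
  qed
qed

text \<open>The sum over \<open>j\<close> dominates the sum with Fejer weights, in which all pairs \<open>(m, m')\<close> contribute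
  a nonnegative amount.\<close>

lemma fejer_lower_bound:
  fixes c v :: "'b \<Rightarrow> real" and J :: nat
  assumes M: "finite M" "M' \<subseteq> M" and c: "\<And>m. m \<in> M \<Longrightarrow> c m \<ge> 0" and J: "J > 0"
    and v: "\<And>m m'. m \<in> M' \<Longrightarrow> m' \<in> M' \<Longrightarrow> \<bar>v m - v m'\<bar> * real J \<le> 1"
  shows "real J / 4 * (\<Sum>m\<in>M'. c m)\<^sup>2
       \<le> (\<Sum>j\<in>{- int J<..<int J}. (cmod (\<Sum>m\<in>M. of_real (c m) * cis (of_int j * v m)))\<^sup>2)"
proof -
  define g where "g j = (cmod (\<Sum>m\<in>M. of_real (c m) * cis (of_int j * v m)))\<^sup>2" for j :: int
  define D where "D x = (\<Sum>a<J. cis (real a * x))" for x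
  have D: "D x * cnj (D x) = (\<Sum>a<J. \<Sum>b<J. cis (real_of_int (int a - int b) * x))" for x
    by (simp add: D_def sum_product cis_cnj cis_mult left_diff_distrib)
  have g: "complex_of_real (g j) = (\<Sum>m\<in>M. \<Sum>m'\<in>M. of_real (c m * c m') * cis (real_of_int j * (v m - v m')))" for j
  proof -
    have "complex_of_real (g j) = (\<Sum>m\<in>M. \<Sum>m'\<in>M. (of_real (c m) * cis (of_int j * v m)) * (of_real (c m') * cis (- (of_int j * v m'))))"
      unfolding g_def complex_norm_square by (simp only: cnj_sum complex_cnj_mult complex_cnj_complex_of_real cis_cnj sum_product)
    also have "\<dots> = (\<Sum>m\<in>M. \<Sum>m'\<in>M. of_real (c m * c m') * cis (real_of_int j * (v m - v m')))"
    proof (intro sum.cong refl)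
      fix m m'
      have "cis (real_of_int j * (v m - v m')) = cis (of_int j * v m) * cis (- (of_int j * v m'))"
        by (simp add: cis_mult right_diff_distrib)
      then show "(of_real (c m) * cis (of_int j * v m)) * (of_real (c m') * cis (- (of_int j * v m')))
          = of_real (c m * c m') * cis (real_of_int j * (v m - v m'))"
        by simp
    qed
    finally show ?thesis .
  qed
  \<comment> \<open>The Fejer weight of an integer is the number of ways to write it as a - b; for
    each \<open>a\<close> there is at most one, so weights are at most J.\<close>
  have "(\<Sum>a<J. \<Sum>b<J. g (int a - int b)) \<le> (\<Sum>a<J. \<Sum>j\<in>{- int J<..<int J}. g j)"
  proof (rule sum_mono)
    fix a assume a: "a \<in> {..<J}"
    have "(\<Sum>b<J. g (int a - int b)) = (\<Sum>j\<in>(\<lambda>b. int a - int b) ` {..<J}. g j)"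
      by (subst sum.reindex) (auto simp: inj_on_def)
    also have "\<dots> \<le> (\<Sum>j\<in>{- int J<..<int J}. g j)"
      using a by (intro sum_mono2) (auto simp: g_def)
    finally show "(\<Sum>b<J. g (int a - int b)) \<le> (\<Sum>j\<in>{- int J<..<int J}. g j)" .
  qed
  then have up: "(\<Sum>a<J. \<Sum>b<J. g (int a - int b)) \<le> real J * (\<Sum>j\<in>{- int J<..<int J}. g j)" by simp
  have "complex_of_real (\<Sum>a<J. \<Sum>b<J. g (int a - int b))
     = (\<Sum>a<J. \<Sum>b<J. \<Sum>m\<in>M. \<Sum>m'\<in>M. of_real (c m * c m') * cis (real_of_int (int a - int b) * (v m - v m')))"
    by (simp only: of_real_sum g)
  also have "\<dots> = (\<Sum>m\<in>M. \<Sum>m'\<in>M. \<Sum>a<J. \<Sum>b<J. of_real (c m * c m') * cis (real_of_int (int a - int b) * (v m - v m')))"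
  proof -
    have sw: "(\<Sum>a<J. \<Sum>m\<in>M. \<Sum>m'\<in>M. F a m m') = (\<Sum>m\<in>M. \<Sum>m'\<in>M. \<Sum>a<J. F a m m')"
      for F :: "nat \<Rightarrow> 'b \<Rightarrow> 'b \<Rightarrow> complex"
      by (subst sum.swap, rule sum.cong[OF refl], rule sum.swap)
    show ?thesis by (simp only: sw)
  qed
  also have "\<dots> = (\<Sum>m\<in>M. \<Sum>m'\<in>M. of_real (c m * c m') * (D (v m - v m') * cnj (D (v m - v m'))))"
    by (simp only: D sum_distrib_left)
  also have "\<dots> = complex_of_real (\<Sum>m\<in>M. \<Sum>m'\<in>M. c m * c m' * (cmod (D (v m - v m')))\<^sup>2)"
    by (simp add: complex_norm_square del: of_real_power)
  finally have eq: "(\<Sum>a<J. \<Sum>b<J. g (int a - int b)) = (\<Sum>m\<in>M. \<Sum>m'\<in>M. c m * c m' * (cmod (D (v m - v m')))\<^sup>2)"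
    by (simp only: of_real_eq_iff)
  \<comment> \<open>All angles a x are at most 1 in absolute value, hence below pi/3, and every
    cosine in the Dirichlet kernel is at least 1/2.\<close>
  have half: "real J / 2 \<le> cmod (D x)" if x: "\<bar>x\<bar> * real J \<le> 1" for x
  proof -
    have "real J / 2 = (\<Sum>a<J. 1 / 2)" by simp
    also have "\<dots> \<le> (\<Sum>a<J. cos (real a * x))"
    proof (rule sum_mono)
      fix a assume "a \<in> {..<J}"
      then have "real a * \<bar>x\<bar> \<le> real J * \<bar>x\<bar>" by (intro mult_right_mono) auto
      then have "real a * \<bar>x\<bar> \<le> pi / 3" using x pi_gt3 by (simp add: mult.commute)
      then have "cos (pi / 3) \<le> cos (real a * \<bar>x\<bar>)" by (intro cos_monotone_0_pi_le) auto
      also have "cos (real a * \<bar>x\<bar>) = cos (real a * x)" by (metis abs_mult abs_of_nat cos_abs_real)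
      finally show "1 / 2 \<le> cos (real a * x)" by (simp add: cos_60)
    qed
    also have "\<dots> = Re (D x)" by (simp add: D_def)
    also have "\<dots> \<le> cmod (D x)" by (rule complex_Re_le_cmod)
    finally show ?thesis .
  qed
  \<comment> \<open>Pairs outside \<open>M'\<close> contribute nonnegative terms, so restricting to
    \<open>M'\<close>, where the kernel is large, only lowers the sum.\<close>
  have "(real J / 2)\<^sup>2 * (\<Sum>m\<in>M'. c m)\<^sup>2 = (\<Sum>m\<in>M'. \<Sum>m'\<in>M'. c m * c m' * (real J / 2)\<^sup>2)"
  proof -
    have s: "(\<Sum>m\<in>M'. c m)\<^sup>2 = (\<Sum>m\<in>M'. \<Sum>m'\<in>M'. c m * c m')"
      by (simp add: power2_eq_square sum_product)
    show ?thesis unfolding s sum_distrib_left by (intro sum.cong refl) (rule mult.commute)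
  qed
  also have "\<dots> \<le> (\<Sum>m\<in>M'. \<Sum>m'\<in>M'. c m * c m' * (cmod (D (v m - v m')))\<^sup>2)"
    using M c by (intro sum_mono mult_left_mono power_mono half v mult_nonneg_nonneg) auto
  also have "\<dots> \<le> (\<Sum>m\<in>M'. \<Sum>m'\<in>M. c m * c m' * (cmod (D (v m - v m')))\<^sup>2)"
    using M c by (intro sum_mono sum_mono2) auto
  also have "\<dots> \<le> (\<Sum>m\<in>M. \<Sum>m'\<in>M. c m * c m' * (cmod (D (v m - v m')))\<^sup>2)"
    using M c by (intro sum_mono2 sum_nonneg) auto
  also have "\<dots> \<le> real J * (\<Sum>j\<in>{- int J<..<int J}. g j)" using up eq by simp
  finally have "real J * (real J / 4 * (\<Sum>m\<in>M'. c m)\<^sup>2) \<le> real J * (\<Sum>j\<in>{- int J<..<int J}. g j)"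
    by (simp add: power2_eq_square)
  then show ?thesis using J unfolding g_def by simp
qed

text \<open>Collect the product by N = n m. For each N the coefficient is a trigonometric sum in the
  shift \<open>j\<close> with frequencies - ln m / 2^I. Restricting N / m to a set in which ratios
  are at most 2 brings these frequencies within 1 / 2^I of each other, and the Fejer bound
  applies.\<close>

lemma twisted_second_moment_ge:
  assumes X: "parity_class q X"
    and M: "finite M" "M \<subseteq> {m. 0 < m \<and> m \<le> Z}" and a: "\<And>m. m \<in> M \<Longrightarrow> a m \<ge> (0::real)"
    and exp: "\<And>t f. completely_multiplicative f \<Longrightarrow>
          resonator \<beta> (truncation K0 I) I t f = (\<Sum>m\<in>M. of_real (a m) * twist t m * f m)"
    and w: "\<And>n. w n \<ge> (0::real)" and L: "2 * (Z * N0) < q"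
    and Y: "Y \<subseteq> {1..N0}" "\<And>n n'. n \<in> Y \<Longrightarrow> n' \<in> Y \<Longrightarrow> n \<le> 2 * n'"
  shows "real (q - 1) / 2 * (2 ^ I / 4) *
      (\<Sum>N=1..Z * N0. (\<Sum>m | m \<in> M \<and> m dvd N \<and> N div m \<in> Y. w (N div m) * a m * real m powr (- 1 / 2))\<^sup>2)
    \<le> (\<Sum>chi\<in>X. (cmod (\<Sum>n=1..N0. of_real (w n) * chi (int n)))\<^sup>2 * resonator_energy \<beta> K0 I (\<lambda>n. chi (int n)))"
proof -
  define MN where "MN N = {m \<in> M. m dvd N \<and> N div m \<in> {1..N0}}" for N
  define c where "c N m = w (N div m) * a m * real m powr (- 1 / 2)" for N m
  define t where "t j = real_of_int j / 2 ^ I" for j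
  define v where "v m = - ln (real m) / 2 ^ I" for m :: nat
  define g where "g j N = (\<Sum>m\<in>MN N. of_real (c N m) * cis (of_int j * v m))" for j N
  have prod: "(\<Sum>n=1..N0. of_real (w n) * chi (int n)) * resonator \<beta> (truncation K0 I) I (t j) (\<lambda>n. chi (int n))
      = (\<Sum>N=1..Z * N0. g j N * chi (int N))" if "chi \<in> X" for chi j
  proof -
    define f where "f = (\<lambda>n. chi (int n))"
    have f: "completely_multiplicative f"
      unfolding f_def using that by (intro completely_multiplicative_character[of q] parity_class_character[OF X])
    have "(\<Sum>n=1..N0. of_real (w n) * f n) * resonator \<beta> (truncation K0 I) I (t j) f
       = (\<Sum>(n, m)\<in>{1..N0} \<times> M. of_real (w n) * f n * (of_real (a m) * twist (t j) m * f m))"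
      by (simp add: exp[OF f] sum_product sum.cartesian_product)
    also have "\<dots> = (\<Sum>(N, m)\<in>(SIGMA N:{1..Z * N0}. MN N). of_real (w (N div m)) * f (N div m) * (of_real (a m) * twist (t j) m * f m))"
    proof (rule sum.reindex_bij_witness[where i = "\<lambda>(N, m). (N div m, m)" and j = "\<lambda>(n, m). (n * m, m)"])
      fix b assume "b \<in> {1..N0} \<times> M"
      then obtain n m where b: "b = (n, m)" "1 \<le> n" "n \<le> N0" "m \<in> M" "0 < m" "m \<le> Z" using M by auto
      have "n * m \<le> Z * N0" using mult_mono[OF b(6,3)] by (simp add: mult.commute)
      then show "(case b of (n, m) \<Rightarrow> (n * m, m)) \<in> (SIGMA N:{1..Z * N0}. MN N)"
        using b by (auto simp: MN_def Suc_le_eq)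
    qed (use M in \<open>auto simp: MN_def\<close>)
    also have "\<dots> = (\<Sum>N=1..Z * N0. \<Sum>m\<in>MN N. of_real (w (N div m)) * f (N div m) * (of_real (a m) * twist (t j) m * f m))"
      using M by (intro sum.Sigma[symmetric]) (auto simp: MN_def)
    also have "\<dots> = (\<Sum>N=1..Z * N0. g j N * f N)"
      unfolding g_def sum_distrib_right
    proof (intro sum.cong refl)
      fix N m assume "m \<in> MN N"
      then have "m dvd N" by (auto simp: MN_def)
      then have "f N = f (N div m) * f m" using f by (metis completely_multiplicative_def dvd_div_mult_self)
      then show "of_real (w (N div m)) * f (N div m) * (of_real (a m) * twist (t j) m * f m)
        = of_real (c N m) * cis (of_int j * v m) * f N"
        by (simp add: c_def twist_def t_def v_def)
    qed
    finally show ?thesis by (simp add: f_def)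
  qed
  have qpos: "N \<in> {1..Z * N0} \<Longrightarrow> 0 < N \<and> 2 * N < q" for N using L by auto
  have "(\<Sum>chi\<in>X. (cmod (\<Sum>n=1..N0. of_real (w n) * chi (int n)))\<^sup>2 * resonator_energy \<beta> K0 I (\<lambda>n. chi (int n)))
     = (\<Sum>chi\<in>X. \<Sum>j\<in>shifts I. (cmod ((\<Sum>n=1..N0. of_real (w n) * chi (int n)) * resonator \<beta> (truncation K0 I) I (t j) (\<lambda>n. chi (int n))))\<^sup>2)"
    by (simp add: resonator_energy_def sum_distrib_left norm_mult power_mult_distrib t_def)
  also have "\<dots> = (\<Sum>chi\<in>X. \<Sum>j\<in>shifts I. (cmod (\<Sum>N=1..Z * N0. g j N * chi (int N)))\<^sup>2)"
    by (intro sum.cong refl) (simp only: prod)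
  also have "\<dots> = (\<Sum>j\<in>shifts I. \<Sum>chi\<in>X. (cmod (\<Sum>N=1..Z * N0. g j N * chi (int N)))\<^sup>2)"
    by (rule sum.swap)
  also have "\<dots> = (\<Sum>j\<in>shifts I. real (q - 1) / 2 * (\<Sum>N=1..Z * N0. (cmod (g j N))\<^sup>2))"
    by (intro sum.cong refl mean_square_dirichlet_poly[OF X] qpos) auto
  also have "\<dots> = real (q - 1) / 2 * (\<Sum>N=1..Z * N0. \<Sum>j\<in>shifts I. (cmod (g j N))\<^sup>2)"
    by (subst sum.swap) (simp add: sum_distrib_left)
  finally have total: "(\<Sum>chi\<in>X. (cmod (\<Sum>n=1..N0. of_real (w n) * chi (int n)))\<^sup>2 * resonator_energy \<beta> K0 I (\<lambda>n. chi (int n)))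
     = real (q - 1) / 2 * (\<Sum>N=1..Z * N0. \<Sum>j\<in>shifts I. (cmod (g j N))\<^sup>2)" .
  have "(\<Sum>N=1..Z * N0. 2 ^ I / 4 * (\<Sum>m | m \<in> M \<and> m dvd N \<and> N div m \<in> Y. c N m)\<^sup>2)
     \<le> (\<Sum>N=1..Z * N0. \<Sum>j\<in>shifts I. (cmod (g j N))\<^sup>2)"
  proof (rule sum_mono)
    fix N assume N: "N \<in> {1..Z * N0}"
    let ?M' = "{m. m \<in> M \<and> m dvd N \<and> N div m \<in> Y}"
    have "real (2 ^ I) / 4 * (\<Sum>m\<in>?M'. c N m)\<^sup>2
      \<le> (\<Sum>j\<in>{- int (2 ^ I)<..<int (2 ^ I)}. (cmod (\<Sum>m\<in>MN N. of_real (c N m) * cis (of_int j * v m)))\<^sup>2)"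
    proof (rule fejer_lower_bound)
      show "finite (MN N)" using M by (simp add: MN_def)
      show "?M' \<subseteq> MN N" using Y(1) by (auto simp: MN_def)
      show "c N m \<ge> 0" if "m \<in> MN N" for m using that w a by (auto simp: c_def MN_def)
      fix m m' assume m: "m \<in> ?M'" "m' \<in> ?M'"
      have pos: "m > 0" "m' > 0" using m M by auto
      \<comment> \<open>Since m (N div m) = m' (N div m') and the cofactors differ by at most a
        factor 2, so do m and m'; and ln 2 < 1.\<close>
      have le: "ln (real m) - ln (real m') \<le> 1" if "m \<in> ?M'" "m' \<in> ?M'" "m > 0" "m' > 0" for m m'
      proof -
        have "m * (N div m) = N" "m' * (N div m') = N" using that by auto
        moreover have "N div m' \<le> 2 * (N div m)" using that Y(2) by auto
        ultimately have "m * (N div m) \<le> (2 * m') * (N div m)"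
          by (metis mult.assoc mult.left_commute mult_le_mono2)
        moreover have "N div m > 0" using that Y(1) by auto
        ultimately have "m \<le> 2 * m'" by simp
        then have "real m \<le> 2 * real m'" by simp
        then have "ln (real m) \<le> ln (2 * real m')" using that by simp
        also have "\<dots> = ln 2 + ln (real m')" using that by (simp add: ln_mult)
        finally show ?thesis using ln_2_less_1 by linarith
      qed
      have "\<bar>v m - v m'\<bar> * real (2 ^ I) = \<bar>ln (real m) - ln (real m')\<bar>"
        by (simp add: v_def diff_divide_distrib[symmetric] abs_divide abs_minus_commute)
      also have "\<dots> \<le> 1" using le[OF m pos] le[OF m(2,1) pos(2,1)] by linarith
      finally show "\<bar>v m - v m'\<bar> * real (2 ^ I) \<le> 1" .
    qed simp
    then show "2 ^ I / 4 * (\<Sum>m\<in>?M'. c N m)\<^sup>2 \<le> (\<Sum>j\<in>shifts I. (cmod (g j N))\<^sup>2)"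
      by (simp add: g_def shifts_def)
  qed
  then have "real (q - 1) / 2 * (\<Sum>N=1..Z * N0. 2 ^ I / 4 * (\<Sum>m | m \<in> M \<and> m dvd N \<and> N div m \<in> Y. c N m)\<^sup>2)
     \<le> real (q - 1) / 2 * (\<Sum>N=1..Z * N0. \<Sum>j\<in>shifts I. (cmod (g j N))\<^sup>2)"
    by (intro mult_left_mono) auto
  then show ?thesis unfolding total c_def by (simp add: sum_distrib_left mult.assoc)
qed

section \<open>Sums over admissible squarefree numbers and over all integers\<close>

lemma admissible_sets_subset:
  assumes "R \<in> admissible_sets K I" "U \<subseteq> R"
  shows "U \<in> admissible_sets K I"
proof -
  have "card (U \<inter> prime_block i) \<le> card (R \<inter> prime_block i)" for i
    using assms by (intro card_mono) (auto simp: finite_prime_block)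
  then show ?thesis using assms unfolding admissible_sets_def by (blast intro: order_trans)
qed

lemma admissible_sets_finite_primes:
  assumes "R \<in> admissible_sets K I"
  shows "finite R" "p \<in> R \<Longrightarrow> prime p"
proof -
  have R: "R \<subseteq> odd_primes_below I" using assms by (simp add: admissible_sets_def)
  then show "finite R" using finite_odd_primes_below by (rule finite_subset)
  show "p \<in> R \<Longrightarrow> prime p" using R by (auto simp: odd_primes_below_def)
qed

lemma finite_admissible_sets: "finite (admissible_sets K I)"
  by (rule finite_subset[of _ "Pow (odd_primes_below I)"])
     (auto simp: admissible_sets_def finite_odd_primes_below)

text \<open>Admissibility is a separate condition on each block, so the sum factors over blocks just
  as an Euler product factors over primes.\<close>

lemma admissible_sum_eq_prod:
  fixes u :: "nat \<Rightarrow> real"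
  shows "(\<Sum>R\<in>admissible_sets K I. \<Prod>p\<in>R. u p)
    = (\<Prod>i<I. \<Sum>R | R \<subseteq> prime_block i \<and> card R \<le> K i. \<Prod>p\<in>R. u p)"
proof (induction I)
  case 0
  have "admissible_sets K 0 = {{}}" by (auto simp: admissible_sets_def odd_primes_below_0)
  then show ?case by simp
next
  case (Suc I)
  let ?S = "odd_primes_below I" and ?B = "prime_block I"
  let ?C = "{R. R \<subseteq> ?B \<and> card R \<le> K I}"
  have sub: "prime_block i \<subseteq> ?S" if "i < I" for i
    using odd_primes_below_Suc(1)[of i] odd_primes_below_mono[of "Suc i" I] that by auto
  have "(\<Sum>R\<in>admissible_sets K (Suc I). \<Prod>p\<in>R. u p)
     = (\<Sum>(P, Q)\<in>admissible_sets K I \<times> ?C. (\<Prod>p\<in>P. u p) * (\<Prod>p\<in>Q. u p))"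
  proof (rule sum.reindex_bij_witness[where j = "\<lambda>R. (R \<inter> ?S, R \<inter> ?B)" and i = "\<lambda>(P, Q). P \<union> Q"])
    fix R assume R: "R \<in> admissible_sets K (Suc I)"
    then have RU: "R = (R \<inter> ?S) \<union> (R \<inter> ?B)" by (auto simp: admissible_sets_def odd_primes_below_Suc)
    then show "(case (R \<inter> ?S, R \<inter> ?B) of (P, Q) \<Rightarrow> P \<union> Q) = R" by auto
    have "(R \<inter> ?S) \<inter> prime_block i = R \<inter> prime_block i" if "i < I" for i using sub[OF that] by auto
    then show "(R \<inter> ?S, R \<inter> ?B) \<in> admissible_sets K I \<times> ?C" using R by (auto simp: admissible_sets_def)
    have "(\<Prod>p\<in>R. u p) = (\<Prod>p\<in>R \<inter> ?S. u p) * (\<Prod>p\<in>R \<inter> ?B. u p)"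
      by (subst RU, rule prod.union_disjoint)
         (use odd_primes_below_Suc(2)[of I] in \<open>auto simp: finite_odd_primes_below finite_prime_block\<close>)
    then show "(case (R \<inter> ?S, R \<inter> ?B) of (P, Q) \<Rightarrow> (\<Prod>p\<in>P. u p) * (\<Prod>p\<in>Q. u p)) = (\<Prod>p\<in>R. u p)" by simp
  next
    fix b assume "b \<in> admissible_sets K I \<times> ?C"
    then obtain P Q where b: "b = (P, Q)" "P \<in> admissible_sets K I" "Q \<subseteq> ?B" "card Q \<le> K I" by auto
    have P: "P \<subseteq> ?S" using b by (simp add: admissible_sets_def)
    have PS: "(P \<union> Q) \<inter> ?S = P" "(P \<union> Q) \<inter> ?B = Q"
      using P b(3) odd_primes_below_Suc(2)[of I] by auto
    then show "((case b of (P, Q) \<Rightarrow> P \<union> Q) \<inter> ?S, (case b of (P, Q) \<Rightarrow> P \<union> Q) \<inter> ?B) = b" by (simp add: b)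
    have "(P \<union> Q) \<inter> prime_block i = P \<inter> prime_block i" if "i < I" for i
      using sub[OF that] b(3) odd_primes_below_Suc(2)[of I] by auto
    then show "(case b of (P, Q) \<Rightarrow> P \<union> Q) \<in> admissible_sets K (Suc I)"
      using b PS P by (auto simp: admissible_sets_def odd_primes_below_Suc less_Suc_eq)
  qed
  also have "\<dots> = (\<Sum>R\<in>admissible_sets K I. \<Prod>p\<in>R. u p) * (\<Sum>R\<in>?C. \<Prod>p\<in>R. u p)"
    by (simp add: sum_product sum.cartesian_product)
  finally show ?case using Suc by simp
qed

lemma one_minus_ge_exp:
  fixes x :: real
  assumes "0 \<le> x" "x \<le> 1 / 2"
  shows "exp (- 2 * x) \<le> 1 - x"
proof -
  have "1 \<le> (1 - x) * (1 + 2 * x)" using assms mult_left_mono[of x "1/2" x] by (simp add: algebra_simps)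
  also have "\<dots> \<le> (1 - x) * exp (2 * x)"
    using assms exp_ge_add_one_self[of "2 * x"] by (intro mult_left_mono) auto
  finally show ?thesis by (simp add: exp_minus inverse_eq_divide divide_simps)
qed

text \<open>Rankin's trick: sets with more than \<open>K\<close> elements are weighted by \<open>exp (card R - K)\<close>.\<close>

lemma truncated_subset_sum_ge:
  fixes \<nu> :: real and B :: "nat set"
  assumes B: "finite B" "(\<Sum>p\<in>B. 1 / real p) \<le> 2" and \<nu>: "\<nu> \<ge> 0"
    and K: "real K \<ge> 12 * \<nu>" "K \<ge> 2"
  shows "(\<Prod>p\<in>B. 1 + \<nu> / real p) * exp (- 2 * exp (- real K / 2))
     \<le> (\<Sum>R | R \<subseteq> B \<and> card R \<le> K. \<Prod>p\<in>R. \<nu> / real p)"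
proof -
  define E where "E = (\<Prod>p\<in>B. 1 + \<nu> / real p)"
  have full: "(\<Sum>R\<in>Pow B. \<Prod>p\<in>R. c / real p) = (\<Prod>p\<in>B. 1 + c / real p)" for c :: real
    using prod_add[OF B(1), of "\<lambda>p. c / real p" "\<lambda>_. 1"] by (simp add: add.commute)
  have E1: "E \<ge> 1" unfolding E_def using \<nu> by (intro prod_ge_1) auto
  have "(\<Sum>R | R \<subseteq> B \<and> \<not> card R \<le> K. \<Prod>p\<in>R. \<nu> / real p)
      \<le> (\<Sum>R | R \<subseteq> B \<and> \<not> card R \<le> K. exp (- real K) * (\<Prod>p\<in>R. (exp 1 * \<nu>) / real p))"
  proof (rule sum_mono)
    fix R assume R: "R \<in> {R. R \<subseteq> B \<and> \<not> card R \<le> K}"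
    have "1 * (\<Prod>p\<in>R. \<nu> / real p) \<le> exp (real (card R) - real K) * (\<Prod>p\<in>R. \<nu> / real p)"
      using R \<nu> by (intro mult_right_mono prod_nonneg) auto
    also have "exp (real (card R) - real K) = exp (- real K) * exp 1 ^ card R"
    proof -
      have "exp (real (card R) - real K) = exp (- real K) * exp (real (card R) * 1)"
        by (simp only: exp_add[symmetric]) simp
      then show ?thesis by (simp only: exp_of_nat_mult)
    qed
    also have "exp (- real K) * exp 1 ^ card R * (\<Prod>p\<in>R. \<nu> / real p) = exp (- real K) * (\<Prod>p\<in>R. (exp 1 * \<nu>) / real p)"
      by (simp add: prod.distrib prod_constant[symmetric] prod_dividef del: prod_constant)
    finally show "(\<Prod>p\<in>R. \<nu> / real p) \<le> exp (- real K) * (\<Prod>p\<in>R. (exp 1 * \<nu>) / real p)" by simp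
  qed
  also have "\<dots> \<le> (\<Sum>R\<in>Pow B. exp (- real K) * (\<Prod>p\<in>R. (exp 1 * \<nu>) / real p))"
    using B \<nu> by (intro sum_mono2 mult_nonneg_nonneg prod_nonneg) auto
  also have "\<dots> = exp (- real K) * (\<Prod>p\<in>B. 1 + (exp 1 * \<nu>) / real p)"
    by (simp only: sum_distrib_left[symmetric] full)
  \<comment> \<open>The constant 6 bounds e, taken as 3, times the mass 2 of the block; K >= 12 nu
    then leaves exp (- K/2).\<close>
  also have "\<dots> \<le> exp (- real K) * exp (6 * \<nu>)"
  proof (rule mult_left_mono)
    have "(\<Prod>p\<in>B. 1 + (exp 1 * \<nu>) / real p) \<le> (\<Prod>p\<in>B. exp ((exp 1 * \<nu>) / real p))"
      using \<nu> by (intro prod_mono conjI exp_ge_add_one_self add_nonneg_nonneg) auto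
    also have "\<dots> = exp ((exp 1 * \<nu>) * (\<Sum>p\<in>B. 1 / real p))"
      by (simp add: exp_sum[OF B(1), symmetric] sum_distrib_left)
    also have "\<dots> \<le> exp ((3 * \<nu>) * 2)"
      using B(2) \<nu> e_less_272 unfolding exp_le_cancel_iff by (intro mult_mono mult_right_mono sum_nonneg) auto
    finally show "(\<Prod>p\<in>B. 1 + (exp 1 * \<nu>) / real p) \<le> exp (6 * \<nu>)" by simp
  qed simp
  also have "\<dots> \<le> exp (- real K / 2)" using K(1) by (simp add: exp_add[symmetric])
  finally have tail: "(\<Sum>R | R \<subseteq> B \<and> \<not> card R \<le> K. \<Prod>p\<in>R. \<nu> / real p) \<le> exp (- real K / 2)" .
  have split: "E = (\<Sum>R | R \<subseteq> B \<and> card R \<le> K. \<Prod>p\<in>R. \<nu> / real p) + (\<Sum>R | R \<subseteq> B \<and> \<not> card R \<le> K. \<Prod>p\<in>R. \<nu> / real p)"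
  proof -
    have "finite {R. R \<subseteq> B \<and> card R \<le> K}" "finite {R. R \<subseteq> B \<and> \<not> card R \<le> K}"
      using B by (auto intro: finite_subset[of _ "Pow B"])
    moreover have "Pow B = {R. R \<subseteq> B \<and> card R \<le> K} \<union> {R. R \<subseteq> B \<and> \<not> card R \<le> K}" by auto
    ultimately show ?thesis
      unfolding E_def full[symmetric] by (simp only:) (subst sum.union_disjoint, auto)
  qed
  have "exp (- real K / 2) \<le> exp (- 1)" using K(2) by simp
  also have "exp (- 1 :: real) \<le> 1 / 2"
    using exp_ge_add_one_self[of 1] by (simp add: exp_minus inverse_eq_divide divide_simps)
  finally have "exp (- 2 * exp (- real K / 2)) \<le> 1 - exp (- real K / 2)"
    by (intro one_minus_ge_exp) auto
  then have "E * exp (- 2 * exp (- real K / 2)) \<le> E * (1 - exp (- real K / 2))"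
    using E1 by (intro mult_left_mono) auto
  also have "\<dots> \<le> E - exp (- real K / 2)"
    using mult_right_mono[OF E1, of "exp (- real K / 2)"] by (simp add: right_diff_distrib)
  also have "\<dots> \<le> E - (\<Sum>R | R \<subseteq> B \<and> \<not> card R \<le> K. \<Prod>p\<in>R. \<nu> / real p)" using tail by simp
  also have "\<dots> = (\<Sum>R | R \<subseteq> B \<and> card R \<le> K. \<Prod>p\<in>R. \<nu> / real p)" using split by simp
  finally show ?thesis by (simp add: E_def)
qed

text \<open>The truncation constant is even so that the relative loss exp (- K/2) in a block is
  \<open>exp (- truncation K1 I i)\<close>, whose sum over blocks is at most 1. Of the exponent, - 2
  is this loss, - 2 nu comes from Mertens' lower bound, and - nu^2 from 1 + u >= exp (u -
  u^2).\<close>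

lemma admissible_sum_ge:
  assumes \<nu>: "\<nu> \<ge> 0" and K1: "K1 \<ge> 1" "real (2 * K1) \<ge> 12 * \<nu>"
  shows "exp (- 2 - 2 * \<nu> - \<nu>\<^sup>2) * (2 ^ I) powr \<nu>
    \<le> (\<Sum>R\<in>admissible_sets (truncation (2 * K1) I) I. \<nu> ^ card R / real (\<Prod>R))"
proof -
  let ?K = "truncation (2 * K1) I"
  have Kge: "2 * K1 \<le> ?K i" if "i < I" for i
  proof -
    have "2 * K1 * 1 \<le> 2 * K1 * (I - i)" using that by (intro mult_le_mono2) simp
    then show ?thesis by (simp add: truncation_def)
  qed
  have "exp (\<nu> * (real I * ln 2 - 2) - \<nu>\<^sup>2) \<le> exp (\<Sum>p\<in>odd_primes_below I. \<nu> / real p - (\<nu> / real p)\<^sup>2)"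
  proof -
    have "(\<Sum>p\<in>odd_primes_below I. 1 / (real p)\<^sup>2) \<le> (\<Sum>p | prime p \<and> p \<le> 2 ^ 2 ^ I. 1 / (real p)\<^sup>2)"
      by (intro sum_mono2) (auto simp: odd_primes_below_def)
    also have "\<dots> \<le> 1" by (rule sum_inverse_prime_squares_le)
    finally have "\<nu>\<^sup>2 * (\<Sum>p\<in>odd_primes_below I. 1 / (real p)\<^sup>2) \<le> \<nu>\<^sup>2 * 1" by (intro mult_left_mono) auto
    moreover have "\<nu> * (real I * ln 2 - 2) \<le> \<nu> * (\<Sum>p\<in>odd_primes_below I. 1 / real p)"
      using \<nu> sum_inverse_odd_primes_ge by (intro mult_left_mono) auto
    ultimately show ?thesis
      by (simp add: sum_subtractf sum_distrib_left power_divide)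
  qed
  also have "\<dots> = (\<Prod>i<I. \<Prod>p\<in>prime_block i. exp (\<nu> / real p - (\<nu> / real p)\<^sup>2))"
    by (simp add: sum_odd_primes_below exp_sum finite_prime_block)
  also have "\<dots> \<le> (\<Prod>i<I. \<Prod>p\<in>prime_block i. 1 + \<nu> / real p)"
  proof (intro prod_mono conjI)
    fix i p
    define u where "u = \<nu> / real p"
    have u: "u \<ge> 0" using \<nu> by (simp add: u_def)
    have "u - u\<^sup>2 \<le> u / (1 + u)"
    proof -
      have "(u - u\<^sup>2) * (1 + u) \<le> u" using u by (simp add: power2_eq_square algebra_simps)
      then show ?thesis using u by (simp add: le_divide_eq)
    qed
    moreover have "exp (u / (1 + u)) \<le> 1 + u"
    proof -
      have "1 / (1 + u) = 1 - u / (1 + u)" using u by (simp add: field_simps)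
      also have "\<dots> \<le> exp (- (u / (1 + u)))" using exp_ge_add_one_self[of "- (u / (1 + u))"] by simp
      finally show ?thesis using u by (simp add: exp_minus inverse_eq_divide divide_simps mult.commute)
    qed
    ultimately show "exp (\<nu> / real p - (\<nu> / real p)\<^sup>2) \<le> 1 + \<nu> / real p"
      unfolding u_def[symmetric] by (meson exp_le_cancel_iff order_trans)
  qed (auto intro!: prod_nonneg)
  finally have main: "exp (\<nu> * (real I * ln 2 - 2) - \<nu>\<^sup>2) \<le> (\<Prod>i<I. \<Prod>p\<in>prime_block i. 1 + \<nu> / real p)" .
  have "exp (- 2) * exp (\<nu> * (real I * ln 2 - 2) - \<nu>\<^sup>2)
     \<le> (\<Prod>i<I. exp (- 2 * exp (- real (?K i) / 2))) * (\<Prod>i<I. \<Prod>p\<in>prime_block i. 1 + \<nu> / real p)"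
  proof (intro mult_mono main)
    have "(\<Sum>i<I. exp (- real (?K i) / 2)) = (\<Sum>i<I. exp (- real (truncation K1 I i)))"
      by (simp add: truncation_def)
    also have "\<dots> \<le> 1" by (rule sum_truncated_exp_le[OF K1(1)])
    finally have "exp (- 2) \<le> exp (- 2 * (\<Sum>i<I. exp (- real (?K i) / 2)))" by simp
    then show "exp (- 2) \<le> (\<Prod>i<I. exp (- 2 * exp (- real (?K i) / 2)))"
      by (simp add: exp_sum[symmetric] sum_distrib_left)
  qed (auto intro!: prod_nonneg)
  also have "\<dots> = (\<Prod>i<I. (\<Prod>p\<in>prime_block i. 1 + \<nu> / real p) * exp (- 2 * exp (- real (?K i) / 2)))"
    by (simp add: prod.distrib mult.commute)
  also have "\<dots> \<le> (\<Prod>i<I. \<Sum>R | R \<subseteq> prime_block i \<and> card R \<le> ?K i. \<Prod>p\<in>R. \<nu> / real p)"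
  proof (intro prod_mono conjI)
    fix i assume "i \<in> {..<I}"
    then have "2 * K1 \<le> ?K i" using Kge by simp
    then have "real (2 * K1) \<le> real (?K i)" by (simp only: of_nat_le_iff)
    then have "real (?K i) \<ge> 12 * \<nu>" "?K i \<ge> 2" using K1 \<open>2 * K1 \<le> ?K i\<close> by linarith+
    then show "(\<Prod>p\<in>prime_block i. 1 + \<nu> / real p) * exp (- 2 * exp (- real (?K i) / 2))
         \<le> (\<Sum>R | R \<subseteq> prime_block i \<and> card R \<le> ?K i. \<Prod>p\<in>R. \<nu> / real p)"
      by (intro truncated_subset_sum_ge finite_prime_block sum_inverse_prime_block \<nu>)
  qed (use \<nu> in \<open>auto intro!: prod_nonneg mult_nonneg_nonneg\<close>)
  also have "\<dots> = (\<Sum>R\<in>admissible_sets ?K I. \<Prod>p\<in>R. \<nu> / real p)" by (rule admissible_sum_eq_prod[symmetric])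
  also have "\<dots> = (\<Sum>R\<in>admissible_sets ?K I. \<nu> ^ card R / real (\<Prod>R))"
    by (simp add: prod_dividef)
  also have "exp (- 2) * exp (\<nu> * (real I * ln 2 - 2) - \<nu>\<^sup>2) = exp (- 2 - 2 * \<nu> - \<nu>\<^sup>2) * (2 ^ I) powr \<nu>"
    by (simp add: powr_def ln_realpow exp_add[symmetric] algebra_simps)
  finally show ?thesis .
qed

text \<open>Bounds the second factor in Cauchy-Schwarz. All n up to Q have their primes below
  2^(2^I), so the sum is at most an Euler product with local factors 1 + kappa (1/p + 1/(p (p -
  1))). The constant 22 is 1/2 + 20 + 1, rounded up.\<close>

lemma sum_power_omega_le:
  assumes \<kappa>: "\<kappa> \<ge> 1" and Q: "Q \<le> 2 ^ 2 ^ I"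
  shows "(\<Sum>n=1..Q. \<kappa> ^ card (prime_factors n) / real n) \<le> exp (22 * \<kappa>) * (2 ^ I) powr \<kappa>"
proof -
  let ?N = "2 ^ 2 ^ I :: nat"
  let ?S = "{p. prime p \<and> p \<le> ?N}"
  define h where "h p e = (if e = 0 then 1 else \<kappa>) * (1 / real p) ^ e" for p e :: nat
  have h0: "h p e \<ge> 0" for p e using \<kappa> by (simp add: h_def)
  have fin: "finite ?S" by simp
  have eq: "\<kappa> ^ card (prime_factors n) / real n = (\<Prod>p\<in>?S. h p (multiplicity p n))" if n: "n \<in> {1..?N}" for n
  proof -
    have pf: "prime_factors n \<subseteq> ?S"
      using atLeastAtMost_subset_smooth_numbers[of ?N ?N] n by (auto simp: smooth_numbers_def subset_iff)
    have "(\<Prod>p\<in>?S. h p (multiplicity p n)) = (\<Prod>p\<in>?S. if multiplicity p n = 0 then 1 else \<kappa>) * (\<Prod>p\<in>?S. (1 / real p) ^ multiplicity p n)"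
      by (simp add: h_def prod.distrib)
    also have "(\<Prod>p\<in>?S. (1 / real p) ^ multiplicity p n) = 1 / real n"
      by (rule completely_multiplicative_prod[symmetric]) (use pf n in auto)
    also have "(\<Prod>p\<in>?S. if multiplicity p n = 0 then 1 else \<kappa>) = (\<Prod>p\<in>prime_factors n. \<kappa>)"
      by (rule prod.mono_neutral_cong_right[OF fin pf]) (auto simp: prime_factors_multiplicity)
    finally show ?thesis by simp
  qed
  have "(\<Sum>n=1..Q. \<kappa> ^ card (prime_factors n) / real n) \<le> (\<Sum>n=1..?N. \<kappa> ^ card (prime_factors n) / real n)"
    using Q \<kappa> by (intro sum_mono2) auto
  also have "\<dots> = (\<Sum>n=1..?N. \<Prod>p\<in>?S. h p (multiplicity p n))" by (intro sum.cong refl eq)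
  also have "\<dots> \<le> (\<Sum>n\<in>smooth_numbers ?S ?N. \<Prod>p\<in>?S. h p (multiplicity p n))"
    by (intro sum_mono2 finite_smooth_numbers fin atLeastAtMost_subset_smooth_numbers prod_nonneg h0) auto
  also have "\<dots> = (\<Prod>p\<in>?S. \<Sum>e\<le>?N. h p e)" by (rule finite_euler_product[OF fin, symmetric]) auto
  also have "\<dots> \<le> (\<Prod>p\<in>?S. exp (\<kappa> * (1 / real p + 1 / (real p * (real p - 1)))))"
  proof (intro prod_mono conjI)
    fix p assume "p \<in> ?S"
    then have p: "prime p" by simp
    show "0 \<le> (\<Sum>e\<le>?N. h p e)" by (intro sum_nonneg h0)
    have "(\<Sum>e\<le>?N. h p e) = (\<Sum>e\<le>?N. \<kappa> * (1 / real p) ^ e + (if e = 0 then 1 - \<kappa> else 0))"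
      by (intro sum.cong refl) (auto simp: h_def)
    also have "\<dots> = \<kappa> * (\<Sum>e\<le>?N. (1 / real p) ^ e) + (1 - \<kappa>)"
      by (simp only: sum.distrib sum_distrib_left) simp
    also have "\<dots> \<le> \<kappa> * (1 + (1 / real p + 1 / (real p * (real p - 1)))) + (1 - \<kappa>)"
      using \<kappa> sum_prime_powers_le[OF p, of ?N] by (intro add_right_mono mult_left_mono) auto
    also have "\<dots> = 1 + \<kappa> * (1 / real p + 1 / (real p * (real p - 1)))" by (simp add: distrib_left)
    also have "\<dots> \<le> exp (\<kappa> * (1 / real p + 1 / (real p * (real p - 1))))" by (rule exp_ge_add_one_self)
    finally show "(\<Sum>e\<le>?N. h p e) \<le> exp (\<kappa> * (1 / real p + 1 / (real p * (real p - 1))))" .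
  qed
  also have "\<dots> = exp (\<kappa> * ((\<Sum>p\<in>?S. 1 / real p) + (\<Sum>p\<in>?S. 1 / (real p * (real p - 1)))))"
    by (simp only: exp_sum[OF fin, symmetric] sum.distrib[symmetric] sum_distrib_left)
  also have "\<dots> \<le> exp (\<kappa> * ((1 / 2 + (real I * ln 2 + 20)) + 1))"
  proof -
    have "(\<Sum>p\<in>?S. 1 / real p) \<le> 1 / 2 + (real I * ln 2 + 20)"
      unfolding sum_primes_eq_sum_odd_primes_below using sum_inverse_odd_primes_le[of I] by simp
    then show ?thesis
      using \<kappa> sum_inverse_prime_times_pred_le[of ?N] unfolding exp_le_cancel_iff by (intro mult_left_mono add_mono) auto
  qed
  also have "\<dots> \<le> exp (22 * \<kappa> + \<kappa> * (real I * ln 2))"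
    using \<kappa> by (simp add: algebra_simps)
  also have "\<dots> = exp (22 * \<kappa>) * (2 ^ I) powr \<kappa>"
    by (simp add: powr_def ln_realpow exp_add)
  finally show ?thesis .
qed

section \<open>The second moment of the divisor sums\<close>

text \<open>The interval from y/2 to y holds at least y/(2d) - 1 multiples of \<open>d\<close>, and
  4d <= y lets half of the main term absorb the 1.\<close>

lemma card_multiples_ge:
  fixes y d :: nat
  assumes d: "d > 0" "4 * d \<le> y"
  shows "real y / (4 * real d) \<le> real (card {n. y \<le> 2 * n \<and> n \<le> y \<and> d dvd n})"
proof -
  have fin: "finite {n. y \<le> 2 * n \<and> n \<le> y \<and> d dvd n}" by (rule finite_subset[of _ "{..y}"]) auto
  have "(\<lambda>j. d * j) ` {y div (2 * d) <.. y div d} \<subseteq> {n. y \<le> 2 * n \<and> n \<le> y \<and> d dvd n}"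
  proof safe
    fix j assume j: "j \<in> {y div (2 * d) <.. y div d}"
    then have "y < j * (2 * d)" using d by (simp add: div_less_iff_less_mult)
    then show "y \<le> 2 * (d * j)" by (simp add: mult_ac)
    show "d * j \<le> y" using j d by (simp add: less_eq_div_iff_mult_less_eq mult.commute)
  qed auto
  then have "card ((\<lambda>j. d * j) ` {y div (2 * d) <.. y div d}) \<le> card {n. y \<le> 2 * n \<and> n \<le> y \<and> d dvd n}"
    by (rule card_mono[OF fin])
  moreover have "card ((\<lambda>j. d * j) ` {y div (2 * d) <.. y div d}) = y div d - y div (2 * d)"
    using d by (subst card_image) (auto simp: inj_on_def)
  moreover have "real y / real d - 1 \<le> real (y div d)"
  proof -
    have "y mod d < d" using d by simp
    then have "y \<le> d * (y div d) + d" by (metis add_left_mono less_imp_le mult_div_mod_eq)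
    then have "real y \<le> real (d * (y div d) + d)" by (simp only: of_nat_le_iff)
    then show ?thesis using d by (simp add: field_simps)
  qed
  moreover have "real (y div (2 * d)) \<le> real y / real (2 * d)" by (rule of_nat_div_le_of_nat)
  moreover have "real y / (4 * real d) \<ge> 1"
  proof -
    have "real (4 * d) \<le> real y" using d(2) by (simp only: of_nat_le_iff)
    then show ?thesis using d(1) by simp
  qed
  moreover have "real y / real d = 4 * (real y / (4 * real d))" "real y / real (2 * d) = 2 * (real y / (4 * real d))"
    using d by auto
  ultimately show ?thesis by linarith
qed

text \<open>(beta + 1)^omega(n) is the sum of beta^|D| over the sets D of primes dividing n. Keeping
  only the D of the form R - U, disjoint from \<open>U\<close>, gives the bound.\<close>

lemma power_omega_ge:
  fixes \<beta> :: real
  assumes U: "U \<in> admissible_sets K I" and n: "n > 0" and \<beta>: "\<beta> \<ge> 0"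
  shows "(\<Sum>R | R \<in> admissible_sets K I \<and> U \<subseteq> R \<and> \<Prod>(R - U) dvd n. (\<beta> + 1) ^ card U * \<beta> ^ card (R - U))
     \<le> (\<beta> + 1) ^ card (prime_factors (\<Prod>U * n)) "
proof -
  let ?A = "{R. R \<in> admissible_sets K I \<and> U \<subseteq> R \<and> \<Prod>(R - U) dvd n}"
  define T where "T = prime_factors n - U"
  have finT: "finite T" by (simp add: T_def)
  note PU = prod_set_of_primes[OF admissible_sets_finite_primes(1)[OF U] admissible_sets_finite_primes(2)[OF U]]
  have finU: "finite U" by (rule admissible_sets_finite_primes[OF U])
  have pf: "prime_factors (\<Prod>U * n) = U \<union> T"
    using PU(1,2) n by (auto simp: prime_factors_product T_def)
  have card: "card (prime_factors (\<Prod>U * n)) = card U + card T"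
    unfolding pf using finU finT by (intro card_Un_disjoint) (auto simp: T_def)
  have sub: "(\<lambda>R. R - U) ` ?A \<subseteq> Pow T"
  proof safe
    fix R p assume R: "R \<in> admissible_sets K I" "U \<subseteq> R" "\<Prod>(R - U) dvd n" and p: "p \<in> R" "p \<notin> U"
    have "finite R" "prime p" using admissible_sets_finite_primes[OF R(1)] p by auto
    then have "p dvd \<Prod>(R - U)" using p by (intro dvd_prodI) auto
    then have "p dvd n" using R(3) dvd_trans by blast
    then show "p \<in> T" using \<open>prime p\<close> p n by (auto simp: T_def in_prime_factors_iff)
  qed
  have inj: "inj_on (\<lambda>R. R - U) ?A" by (auto simp: inj_on_def)
  have "(\<Sum>R\<in>?A. \<beta> ^ card (R - U)) = (\<Sum>D\<in>(\<lambda>R. R - U) ` ?A. \<beta> ^ card D)"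
    by (simp add: sum.reindex[OF inj])
  also have "\<dots> \<le> (\<Sum>D\<in>Pow T. \<beta> ^ card D)"
    using sub finT \<beta> by (intro sum_mono2) auto
  also have "\<dots> = (\<beta> + 1) ^ card T"
    using prod_add[OF finT, of "\<lambda>_. \<beta>" "\<lambda>_. 1"] by simp
  finally have "(\<beta> + 1) ^ card U * (\<Sum>R\<in>?A. \<beta> ^ card (R - U)) \<le> (\<beta> + 1) ^ card U * (\<beta> + 1) ^ card T"
    using \<beta> by (intro mult_left_mono) auto
  then show ?thesis by (simp add: card power_add sum_distrib_left)
qed

text \<open>In Cauchy-Schwarz the test function should be proportional to b(N). The divisor sum of
  beta^omega(m) over squarefree m dividing N is (beta + 1)^omega(N), hence the choice k^omega(N)
  N^(-1/2). The cross term is reduced to squarefree m given by sets \<open>U\<close>, and k^omega(m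
  n) is expanded over admissible supersets \<open>R\<close> of \<open>U\<close>.\<close>

lemma divisor_second_moment_ge:
  fixes y Z Q :: nat
  defines "Y \<equiv> {n. y \<le> 2 * n \<and> n \<le> y}"
  assumes M: "finite M" "M \<subseteq> {m. 0 < m \<and> m \<le> Z}" and a: "\<And>m. m \<in> M \<Longrightarrow> a m \<ge> (0::real)"
    and adm: "\<And>R. R \<in> admissible_sets K I \<Longrightarrow> \<Prod>R \<in> M \<and> a (\<Prod>R) = \<beta> ^ card R"
    and \<beta>: "\<beta> \<ge> 0" and y: "y > 0" "4 * Z \<le> y" "Z * y \<le> Q"
  shows "real y / 16 * (\<Sum>R\<in>admissible_sets K I. (\<beta> * (\<beta> + 2)) ^ card R / real (\<Prod>R))\<^sup>2
     \<le> (\<Sum>N=1..Q. (\<Sum>m | m \<in> M \<and> m dvd N \<and> N div m \<in> Y. a m * real m powr (- 1 / 2))\<^sup>2)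
       * (\<Sum>N=1..Q. ((\<beta> + 1)\<^sup>2) ^ card (prime_factors N) / real N)"
proof -
  let ?A = "admissible_sets K I"
  define k where "k = \<beta> + 1"
  have k: "k \<ge> 1" using \<beta> by (simp add: k_def)
  define b where "b N = (\<Sum>m | m \<in> M \<and> m dvd N \<and> N div m \<in> Y. a m * real m powr (- 1 / 2))" for N
  define c where "c N = k ^ card (prime_factors N) * real N powr (- 1 / 2)" for N
  have finY: "finite Y" unfolding Y_def by (rule finite_subset[of _ "{..y}"]) auto
  have Ypos: "n > 0" if "n \<in> Y" for n using that y by (auto simp: Y_def)
  have Pos: "\<Prod>R > 0" if "R \<in> ?A" for R using adm[OF that] M by auto
  have "(\<Sum>N=1..Q. b N * c N) = (\<Sum>N=1..Q. \<Sum>m | m \<in> M \<and> m dvd N \<and> N div m \<in> Y. a m * real m powr (- 1 / 2) * c N)"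
    by (simp add: b_def sum_distrib_right)
  also have "\<dots> = (\<Sum>(N, m)\<in>(SIGMA N:{1..Q}. {m. m \<in> M \<and> m dvd N \<and> N div m \<in> Y}). a m * real m powr (- 1 / 2) * c N)"
    using M by (intro sum.Sigma) auto
  also have "\<dots> = (\<Sum>(m, n)\<in>M \<times> Y. a m * real m powr (- 1 / 2) * c (m * n))"
  proof (rule sum.reindex_bij_witness[where j = "\<lambda>(N, m). (m, N div m)" and i = "\<lambda>(m, n). (m * n, m)"])
    fix b assume "b \<in> M \<times> Y"
    then obtain m n where b: "b = (m, n)" "m \<in> M" "n \<in> Y" "0 < m" "m \<le> Z" using M by auto
    have "m * n \<le> Z * y" using b by (intro mult_mono) (auto simp: Y_def)
    then have "m * n \<le> Q" using y by linarith
    then show "(case b of (m, n) \<Rightarrow> (m * n, m)) \<in> (SIGMA N:{1..Q}. {m. m \<in> M \<and> m dvd N \<and> N div m \<in> Y})"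
      using b Ypos[OF b(3)] by (auto simp: Suc_le_eq)
  qed (use M in \<open>auto\<close>)
  also have "\<dots> = (\<Sum>m\<in>M. \<Sum>n\<in>Y. a m * real m powr (- 1 / 2) * c (m * n))"
    by (simp add: sum.cartesian_product)
  finally have eq1: "(\<Sum>N=1..Q. b N * c N) = (\<Sum>m\<in>M. \<Sum>n\<in>Y. a m * real m powr (- 1 / 2) * c (m * n))" .
  have 1: "(\<Sum>m\<in>M. \<Sum>n\<in>Y. real y powr (- 1 / 2) * (a m / real m * k ^ card (prime_factors (m * n)))) \<le> (\<Sum>N=1..Q. b N * c N)"
    unfolding eq1
  proof (intro sum_mono)
    fix m n assume mn: "m \<in> M" "n \<in> Y"
    have m: "m > 0" using mn M by auto
    have n: "n > 0" "n \<le> y" using mn Ypos by (auto simp: Y_def)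
    have "real m powr (- 1 / 2) * real (m * n) powr (- 1 / 2) = real m powr (- 1 / 2) * real m powr (- 1 / 2) * real n powr (- 1 / 2)"
      by (simp add: powr_mult)
    also have "real m powr (- 1 / 2) * real m powr (- 1 / 2) = 1 / real m"
      using powr_minus_half_sq[OF m] by (simp only: power2_eq_square)
    finally have e: "a m * real m powr (- 1 / 2) * c (m * n) = real n powr (- 1 / 2) * (a m / real m * k ^ card (prime_factors (m * n)))"
      by (simp add: c_def mult_ac)
    have "real y powr (- 1 / 2) \<le> real n powr (- 1 / 2)" using n by (intro powr_mono2') auto
    then show "real y powr (- 1 / 2) * (a m / real m * k ^ card (prime_factors (m * n))) \<le> a m * real m powr (- 1 / 2) * c (m * n)"
      unfolding e using a[OF mn(1)] k by (intro mult_right_mono) auto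
  qed
  have inj: "inj_on Prod ?A"
    using prod_set_of_primes(2) admissible_sets_finite_primes by (metis inj_onI)
  have 4: "(\<Sum>m\<in>Prod ` ?A. \<Sum>n\<in>Y. a m / real m * k ^ card (prime_factors (m * n)))
      \<le> (\<Sum>m\<in>M. \<Sum>n\<in>Y. a m / real m * k ^ card (prime_factors (m * n)))"
    using M adm a k by (intro sum_mono2 sum_nonneg mult_nonneg_nonneg divide_nonneg_nonneg) auto
  have 5: "(\<Sum>m\<in>Prod ` ?A. \<Sum>n\<in>Y. a m / real m * k ^ card (prime_factors (m * n)))
      = (\<Sum>U\<in>?A. \<beta> ^ card U / real (\<Prod>U) * (\<Sum>n\<in>Y. k ^ card (prime_factors (\<Prod>U * n))))"
    using adm by (simp add: sum.reindex[OF inj] sum_distrib_left)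
  have 6: "(\<Sum>U\<in>?A. \<beta> ^ card U / real (\<Prod>U) *
        (\<Sum>R | R \<in> ?A \<and> U \<subseteq> R. k ^ card U * \<beta> ^ card (R - U) * (real y / (4 * real (\<Prod>(R - U))))))
      \<le> (\<Sum>U\<in>?A. \<beta> ^ card U / real (\<Prod>U) * (\<Sum>n\<in>Y. k ^ card (prime_factors (\<Prod>U * n))))"
  proof (intro sum_mono mult_left_mono)
    fix U assume U: "U \<in> ?A"
    have "(\<Sum>R | R \<in> ?A \<and> U \<subseteq> R. k ^ card U * \<beta> ^ card (R - U) * (real y / (4 * real (\<Prod>(R - U)))))
       \<le> (\<Sum>R | R \<in> ?A \<and> U \<subseteq> R. k ^ card U * \<beta> ^ card (R - U) * real (card {n. y \<le> 2 * n \<and> n \<le> y \<and> \<Prod>(R - U) dvd n}))"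
    proof (intro sum_mono mult_left_mono card_multiples_ge)
      fix R assume "R \<in> {R. R \<in> ?A \<and> U \<subseteq> R}"
      then have D: "R - U \<in> ?A" using admissible_sets_subset by blast
      have "\<Prod>(R - U) \<le> Z" using adm[OF D] M by auto
      then show "4 * \<Prod>(R - U) \<le> y" using y by linarith
      show "\<Prod>(R - U) > 0" by (rule Pos[OF D])
    qed (use k \<beta> in auto)
    also have "\<dots> = (\<Sum>R | R \<in> ?A \<and> U \<subseteq> R. \<Sum>n\<in>Y. if \<Prod>(R - U) dvd n then k ^ card U * \<beta> ^ card (R - U) else 0)"
    proof (intro sum.cong refl)
      fix R
      have "{n. y \<le> 2 * n \<and> n \<le> y \<and> \<Prod>(R - U) dvd n} = {n\<in>Y. \<Prod>(R - U) dvd n}" by (auto simp: Y_def)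
      then show "k ^ card U * \<beta> ^ card (R - U) * real (card {n. y \<le> 2 * n \<and> n \<le> y \<and> \<Prod>(R - U) dvd n})
        = (\<Sum>n\<in>Y. if \<Prod>(R - U) dvd n then k ^ card U * \<beta> ^ card (R - U) else 0)"
        using finY by (simp add: sum.inter_filter[symmetric])
    qed
    also have "\<dots> = (\<Sum>n\<in>Y. \<Sum>R | R \<in> ?A \<and> U \<subseteq> R. if \<Prod>(R - U) dvd n then k ^ card U * \<beta> ^ card (R - U) else 0)"
      by (rule sum.swap)
    also have "\<dots> \<le> (\<Sum>n\<in>Y. k ^ card (prime_factors (\<Prod>U * n)))"
    proof (rule sum_mono)
      fix n assume "n \<in> Y"
      have "(\<Sum>R | R \<in> ?A \<and> U \<subseteq> R. if \<Prod>(R - U) dvd n then k ^ card U * \<beta> ^ card (R - U) else 0)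
         = (\<Sum>R | R \<in> ?A \<and> U \<subseteq> R \<and> \<Prod>(R - U) dvd n. k ^ card U * \<beta> ^ card (R - U))"
        using finite_admissible_sets[of K I] by (subst sum.inter_filter[symmetric]) (auto intro!: sum.cong)
      also have "\<dots> \<le> k ^ card (prime_factors (\<Prod>U * n))"
        unfolding k_def by (rule power_omega_ge[OF U Ypos[OF \<open>n \<in> Y\<close>] \<beta>])
      finally show "(\<Sum>R | R \<in> ?A \<and> U \<subseteq> R. if \<Prod>(R - U) dvd n then k ^ card U * \<beta> ^ card (R - U) else 0)
          \<le> k ^ card (prime_factors (\<Prod>U * n))" .
    qed
    finally show "(\<Sum>R | R \<in> ?A \<and> U \<subseteq> R. k ^ card U * \<beta> ^ card (R - U) * (real y / (4 * real (\<Prod>(R - U)))))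
       \<le> (\<Sum>n\<in>Y. k ^ card (prime_factors (\<Prod>U * n)))" .
  next
    fix U
    show "0 \<le> \<beta> ^ card U / real (\<Prod>U)" by (intro divide_nonneg_nonneg of_nat_0_le_iff zero_le_power \<beta>)
  qed
  define F where "F U R = real y / 4 * ((k * \<beta>) ^ card U * \<beta> ^ card (R - U) / real (\<Prod>R))" for U R :: "nat set"
  have F: "\<beta> ^ card U / real (\<Prod>U) * (k ^ card U * \<beta> ^ card (R - U) * (real y / (4 * real (\<Prod>(R - U))))) = F U R"
    if R: "R \<in> ?A" "U \<subseteq> R" for U R
  proof -
    have "\<Prod>R = \<Prod>(R - U) * \<Prod>U" using R admissible_sets_finite_primes(1)[OF R(1)] by (intro prod.subset_diff)
    then have "real (\<Prod>R) = real (\<Prod>(R - U)) * real (\<Prod>U)" by (simp only: of_nat_mult)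
    then show ?thesis unfolding F_def by (simp only:) (simp add: power_mult_distrib mult_ac del: of_nat_prod)
  qed
  have "(\<Sum>U\<in>?A. \<beta> ^ card U / real (\<Prod>U) *
        (\<Sum>R | R \<in> ?A \<and> U \<subseteq> R. k ^ card U * \<beta> ^ card (R - U) * (real y / (4 * real (\<Prod>(R - U))))))
     = (\<Sum>U\<in>?A. \<Sum>R | R \<in> ?A \<and> U \<subseteq> R. F U R)"
  proof (rule sum.cong[OF refl])
    fix U
    show "\<beta> ^ card U / real (\<Prod>U) * (\<Sum>R | R \<in> ?A \<and> U \<subseteq> R. k ^ card U * \<beta> ^ card (R - U) * (real y / (4 * real (\<Prod>(R - U)))))
      = (\<Sum>R | R \<in> ?A \<and> U \<subseteq> R. F U R)"
      unfolding sum_distrib_left by (rule sum.cong[OF refl], rule F) auto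
  qed
  \<comment> \<open>Summing over the subsets \<open>U\<close> of a fixed \<open>R\<close> first is a
    binomial expansion: it gives (k beta + beta)^|R|, and k beta + beta = k^2 - 1.\<close>
  also have "\<dots> = (\<Sum>R\<in>?A. \<Sum>U | U \<in> ?A \<and> U \<subseteq> R. F U R)"
    by (rule sum.swap_restrict[OF finite_admissible_sets finite_admissible_sets])
  also have "\<dots> = (\<Sum>R\<in>?A. real y / 4 * ((\<beta> * (\<beta> + 2)) ^ card R / real (\<Prod>R)))"
  proof (rule sum.cong[OF refl])
    fix R assume R: "R \<in> ?A"
    have "{U. U \<in> ?A \<and> U \<subseteq> R} = Pow R" using admissible_sets_subset[OF R] by auto
    then have "(\<Sum>U | U \<in> ?A \<and> U \<subseteq> R. F U R) = (\<Sum>U\<in>Pow R. F U R)" by simp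
    also have "\<dots> = real y / 4 * ((\<Sum>U\<in>Pow R. (k * \<beta>) ^ card U * \<beta> ^ card (R - U)) / real (\<Prod>R))"
      by (simp only: F_def sum_distrib_left sum_divide_distrib)
    also have "(\<Sum>U\<in>Pow R. (k * \<beta>) ^ card U * \<beta> ^ card (R - U)) = (k * \<beta> + \<beta>) ^ card R"
      using prod_add[OF admissible_sets_finite_primes(1)[OF R], of "\<lambda>_. k * \<beta>" "\<lambda>_. \<beta>"] by simp
    also have "k * \<beta> + \<beta> = \<beta> * (\<beta> + 2)" by (simp add: k_def algebra_simps)
    finally show "(\<Sum>U | U \<in> ?A \<and> U \<subseteq> R. F U R) = real y / 4 * ((\<beta> * (\<beta> + 2)) ^ card R / real (\<Prod>R))" .
  qed
  also have "\<dots> = real y / 4 * (\<Sum>R\<in>?A. (\<beta> * (\<beta> + 2)) ^ card R / real (\<Prod>R))" by (simp only: sum_distrib_left)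
  finally have 2: "real y / 4 * (\<Sum>R\<in>?A. (\<beta> * (\<beta> + 2)) ^ card R / real (\<Prod>R))
     \<le> (\<Sum>m\<in>M. \<Sum>n\<in>Y. a m / real m * k ^ card (prime_factors (m * n)))"
    using 4 5 6 by linarith
  define S where "S = (\<Sum>R\<in>?A. (\<beta> * (\<beta> + 2)) ^ card R / real (\<Prod>R))"
  have S0: "S \<ge> 0"
    unfolding S_def using \<beta> by (intro sum_nonneg divide_nonneg_nonneg of_nat_0_le_iff zero_le_power) auto
  have 3: "real y powr (- 1 / 2) * (real y / 4 * S) \<le> (\<Sum>N=1..Q. b N * c N)"
  proof -
    have "real y powr (- 1 / 2) * (real y / 4 * S)
        \<le> real y powr (- 1 / 2) * (\<Sum>m\<in>M. \<Sum>n\<in>Y. a m / real m * k ^ card (prime_factors (m * n)))"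
      unfolding S_def by (intro mult_left_mono 2) simp
    also have "\<dots> = (\<Sum>m\<in>M. \<Sum>n\<in>Y. real y powr (- 1 / 2) * (a m / real m * k ^ card (prime_factors (m * n))))"
      by (simp only: sum_distrib_left)
    also note 1
    finally show ?thesis .
  qed
  have "real y / 16 * S\<^sup>2 = (real y powr (- 1 / 2) * (real y / 4 * S))\<^sup>2"
    unfolding power_mult_distrib powr_minus_half_sq[OF y(1)] using y by (simp add: power2_eq_square)
  also have "\<dots> \<le> (\<Sum>N=1..Q. b N * c N)\<^sup>2"
    using 3 S0 by (intro power_mono) auto
  also have "\<dots> \<le> (\<Sum>N=1..Q. (b N)\<^sup>2) * (\<Sum>N=1..Q. (c N)\<^sup>2)" by (rule Cauchy_Schwarz_ineq_sum)
  also have "(\<Sum>N=1..Q. (c N)\<^sup>2) = (\<Sum>N=1..Q. ((\<beta> + 1)\<^sup>2) ^ card (prime_factors N) / real N)"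
  proof (rule sum.cong[OF refl])
    fix N assume N: "N \<in> {1..Q}"
    then have "(c N)\<^sup>2 = (k ^ card (prime_factors N))\<^sup>2 * (1 / real N)"
      unfolding c_def power_mult_distrib by (subst powr_minus_half_sq) auto
    then show "(c N)\<^sup>2 = ((\<beta> + 1)\<^sup>2) ^ card (prime_factors N) / real N"
      by (simp add: k_def power_mult[symmetric] mult.commute)
  qed
  finally show ?thesis unfolding S_def b_def .
qed

section \<open>Theta functions\<close>

definition theta_weight :: "nat \<Rightarrow> nat \<Rightarrow> nat \<Rightarrow> real" where
  "theta_weight \<kappa> q n = real n ^ \<kappa> * exp (- pi * (real n)\<^sup>2 / real q)"

text \<open>The exponent is constant on a parity class, so a natural number can replace the complex
  \<open>kappa chi\<close>, and complex powers become ordinary ones.\<close>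

definition parity_exponent :: "nat \<Rightarrow> (int \<Rightarrow> complex) set \<Rightarrow> nat \<Rightarrow> bool" where
  "parity_exponent q X \<kappa> \<longleftrightarrow> X = even_characters q \<and> \<kappa> = 0 \<or> X = odd_characters q \<and> \<kappa> = 1"

lemma norm_character_le_1:
  assumes "dirichlet_character q chi" "q > 0"
  shows "cmod (chi n) \<le> 1"
proof (cases "coprime n (int q)")
  case False
  then have "chi n = 0" using assms(1) unfolding dirichlet_character_def by blast
  then show ?thesis by simp
qed (use norm_dirichlet_character[OF assms(1) _ assms(2)] in simp)

text \<open>For n >= q^(2/3) the number u = n^2 / q satisfies u^2 >= n, so exp (-u) <= 6! / u^6 <=
  720 / n^3; the factor n^kappa costs at most one power of n.\<close>

lemma theta_weight_tail_le:
  assumes q: "q > 0" and \<kappa>: "\<kappa> \<le> 1" and n: "n > 0" "q\<^sup>2 \<le> n ^ 3"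
  shows "theta_weight \<kappa> q n \<le> 720 / (real n)\<^sup>2"
proof -
  define u where "u = (real n)\<^sup>2 / real q"
  have n1: "real n \<ge> 1" using n by simp
  have u0: "u > 0" using n q by (simp add: u_def)
  have "real (q\<^sup>2) \<le> real (n ^ 3)" using n(2) by (simp only: of_nat_le_iff)
  then have "real n * (real q)\<^sup>2 \<le> real n * real n ^ 3" by (intro mult_left_mono) auto
  then have u2: "real n \<le> u\<^sup>2"
    using q by (simp add: u_def power_divide pos_le_divide_eq power2_eq_square power3_eq_cube mult_ac)
  have "u ^ 6 / fact 6 \<le> exp u" using exp_series_le[of "{6}" u] u0 by simp
  then have e: "u ^ 6 \<le> 720 * exp u" by (simp add: fact_numeral)
  have "real n ^ 3 \<le> (u\<^sup>2) ^ 3" using u2 by (intro power_mono) auto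
  also have "\<dots> = u ^ 6" by (simp add: power_mult[symmetric])
  finally have n3: "real n ^ 3 \<le> 720 * exp u" using e by simp
  have "theta_weight \<kappa> q n \<le> real n ^ 1 * exp (- u)"
    unfolding theta_weight_def
  proof (intro mult_mono power_increasing)
    have "u \<le> pi * u" using u0 pi_gt3 by simp
    then show "exp (- pi * (real n)\<^sup>2 / real q) \<le> exp (- u)" by (simp add: u_def)
  qed (use n1 \<kappa> in auto)
  also have "\<dots> \<le> 720 / (real n)\<^sup>2"
    using n3 n1 by (simp add: exp_minus inverse_eq_divide divide_simps power2_eq_square power3_eq_cube mult_ac)
  finally show ?thesis .
qed

lemma theta_truncation:
  assumes q: "q > 0" and X: "parity_exponent q X \<kappa>" "chi \<in> X" and N0: "q\<^sup>2 \<le> N0 ^ 3"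
  shows "cmod (theta q 1 chi - (\<Sum>n=1..N0. of_real (theta_weight \<kappa> q n) * chi (int n))) \<le> 1440"
proof -
  have dc: "dirichlet_character q chi"
    using X by (auto simp: parity_exponent_def even_characters_def odd_characters_def)
  have \<kappa>: "\<kappa> \<le> 1" using X by (auto simp: parity_exponent_def)
  have kap: "kappa chi = of_nat \<kappa>"
    using X by (auto simp: parity_exponent_def even_characters_def odd_characters_def kappa_def)
  define f where "f n = of_real (theta_weight \<kappa> q n) * chi (int n)" for n :: nat
  have "theta q 1 chi = (\<Sum>\<^sub>\<infinity>n\<in>{1..}. f n)"
    unfolding theta_def
  proof (rule infsum_cong)
    fix n :: nat assume "n \<in> {1..}"
    then have "(of_nat n :: complex) powr kappa chi = of_nat n ^ \<kappa>" unfolding kap by simp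
    then show "chi (int n) * of_nat n powr kappa chi * of_real (exp (- pi * (real n)\<^sup>2 * 1 / real q)) = f n"
      by (simp add: f_def theta_weight_def)
  qed
  also have "{1..} = {1..N0} \<union> {Suc N0..}" by auto
  finally have th: "theta q 1 chi = infsum f ({1..N0} \<union> {Suc N0..})" .
  have split: "infsum f ({1..N0} \<union> {Suc N0..}) = infsum f {1..N0} + infsum f {Suc N0..}"
    and fin: "cmod (infsum f {Suc N0..}) \<le> 1440"
  proof -
    \<comment> \<open>One bound for finite partial sums gives both the estimate of the tail and
      summability; without the latter \<open>infsum\<close> would take the default value 0 and could
      not be split.\<close>
    have bound: "(\<Sum>n\<in>F. cmod (f n)) \<le> 1440" if F: "finite F" "F \<subseteq> {Suc N0..}" for F
    proof -
      have "(\<Sum>n\<in>F. cmod (f n)) \<le> (\<Sum>n\<in>F. 720 * (1 / (real n)\<^sup>2))"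
      proof (rule sum_mono)
        fix n assume "n \<in> F"
        then have n: "n > N0" using F by auto
        have "N0 ^ 3 \<le> n ^ 3" using n by (intro power_mono) auto
        then have "theta_weight \<kappa> q n \<le> 720 / (real n)\<^sup>2"
          using theta_weight_tail_le[OF q \<kappa>, of n] n N0 by linarith
        moreover have "theta_weight \<kappa> q n \<ge> 0" by (simp add: theta_weight_def)
        then have "cmod (f n) \<le> theta_weight \<kappa> q n * 1"
          unfolding f_def norm_mult using norm_character_le_1[OF dc q]
          by (intro mult_mono) auto
        ultimately show "cmod (f n) \<le> 720 * (1 / (real n)\<^sup>2)" by simp
      qed
      also have "\<dots> = 720 * (\<Sum>n\<in>F. 1 / (real n)\<^sup>2)" by (simp only: sum_distrib_left)
      also have "(\<Sum>n\<in>F. 1 / (real n)\<^sup>2) = (\<Sum>m\<in>(\<lambda>n. n - 1) ` F. 1 / (1 + real m)\<^sup>2)"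
      proof (subst sum.reindex)
        show "inj_on (\<lambda>n. n - 1) F"
        proof (rule inj_onI)
          fix x y assume "x \<in> F" "y \<in> F" and eq: "x - 1 = y - 1"
          then have "x \<ge> 1" "y \<ge> 1" using F by fastforce+
          then show "x = y" using eq by linarith
        qed
        show "(\<Sum>n\<in>F. 1 / (real n)\<^sup>2) = sum ((\<lambda>m. 1 / (1 + real m)\<^sup>2) \<circ> (\<lambda>n. n - 1)) F"
          using F by (intro sum.cong refl) (auto simp: of_nat_diff subset_iff)
      qed
      also have "\<dots> \<le> 2" using F by (intro sum_inverse_squares_le) auto
      finally show ?thesis by simp
    qed
    have abs: "(\<lambda>n. cmod (f n)) summable_on {Suc N0..}"
      by (rule nonneg_bdd_above_summable_on) (use bound in \<open>auto intro!: bdd_aboveI2\<close>)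
    then have "f summable_on {Suc N0..}" by (rule abs_summable_summable)
    then show "infsum f ({1..N0} \<union> {Suc N0..}) = infsum f {1..N0} + infsum f {Suc N0..}"
      by (intro infsum_Un_disjoint) auto
    have "cmod (infsum f {Suc N0..}) \<le> infsum (\<lambda>n. cmod (f n)) {Suc N0..}" by (rule norm_infsum_bound[OF abs])
    also have "\<dots> \<le> 1440" by (rule infsum_le_finite_sums[OF abs bound])
    finally show "cmod (infsum f {Suc N0..}) \<le> 1440" .
  qed
  show ?thesis using fin unfolding th split by (simp add: f_def[symmetric])
qed

lemma theta_weight_nonneg: "theta_weight \<kappa> q n \<ge> 0"
  by (simp add: theta_weight_def)

lemma theta_weight_ge:
  assumes "q > 0" "n\<^sup>2 \<le> q" "y \<le> 2 * n"
  shows "(real y / 2) ^ \<kappa> * exp (- pi) \<le> theta_weight \<kappa> q n"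
  unfolding theta_weight_def
proof (intro mult_mono power_mono)
  have "real (n\<^sup>2) \<le> real q" using assms(2) by (simp only: of_nat_le_iff)
  then have "(real n)\<^sup>2 / real q \<le> 1" using assms(1) by simp
  then have "pi * ((real n)\<^sup>2 / real q) \<le> pi * 1" by (intro mult_left_mono) auto
  then show "exp (- pi) \<le> exp (- pi * (real n)\<^sup>2 / real q)" by simp
qed (use assms in auto)

text \<open>Assembles the lower bound. Two limits for primes occur: \<open>I\<close> for the
  resonator, and a larger \<open>I'\<close> for the integers up to \<open>Z * N0\<close>, all of
  whose primes enter the Cauchy-Schwarz factor. When I' - I is bounded this costs only a
  constant.\<close>

lemma resonated_second_moment_ge:
  fixes K1 I I' N0 y q \<kappa> :: nat and \<beta> :: real
  defines "Z \<equiv> 2 ^ (8 * (2 * K1) * 2 ^ I)"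
  assumes X: "parity_class q X" and \<beta>: "\<beta> \<ge> 1" and K1: "K1 \<ge> 1" "real (2 * K1) \<ge> 12 * (\<beta> * (\<beta> + 2))"
    and L: "2 * (Z * N0) < q" and y: "4 * Z \<le> y" "0 < y" "y \<le> N0" "y\<^sup>2 \<le> q" and Q: "Z * N0 \<le> 2 ^ 2 ^ I'"
  shows "real (q - 1) / 2 * (2 ^ I / 4) * ((real y / 2) ^ \<kappa> * exp (- pi))\<^sup>2 * (real y / 16
        * (exp (- 2 - 2 * (\<beta> * (\<beta> + 2)) - (\<beta> * (\<beta> + 2))\<^sup>2) * (2 ^ I) powr (\<beta> * (\<beta> + 2)))\<^sup>2
        / (exp (22 * (\<beta> + 1)\<^sup>2) * (2 ^ I') powr (\<beta> + 1)\<^sup>2))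
    \<le> (\<Sum>chi\<in>X. (cmod (\<Sum>n=1..N0. of_real (theta_weight \<kappa> q n) * chi (int n)))\<^sup>2
             * resonator_energy \<beta> (2 * K1) I (\<lambda>n. chi (int n)))"
proof -
  let ?\<nu> = "\<beta> * (\<beta> + 2)" let ?K = "truncation (2 * K1) I"
  define w0 where "w0 = (real y / 2) ^ \<kappa> * exp (- pi)"
  have w0: "w0 \<ge> 0" by (simp add: w0_def)
  have q0: "q > 0" using X by (simp add: parity_class_def)
  define Y where "Y = {n. y \<le> 2 * n \<and> n \<le> y}"
  have \<nu>: "?\<nu> \<ge> 0" using \<beta> by simp
  have "\<beta> \<ge> 0" using \<beta> by simp
  from resonator_expansion[OF this, where I = I and K = ?K]
  obtain M a where *: "finite M \<and> M \<subseteq> {m. 0 < m \<and> m \<le> (\<Prod>i<I. (2 ^ 2 ^ Suc i) ^ ?K i) \<and> prime_factors m \<subseteq> odd_primes_below I}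
     \<and> (\<forall>m\<in>M. a m \<ge> 0)
     \<and> (\<forall>t f. completely_multiplicative f \<longrightarrow> resonator \<beta> ?K I t f = (\<Sum>m\<in>M. of_real (a m) * twist t m * f m))
     \<and> (\<forall>R\<in>admissible_sets ?K I. \<Prod>R \<in> M \<and> a (\<Prod>R) = \<beta> ^ card R)"
    by (elim exE) (rule that)
  note finM = *[THEN conjunct1] and Msub = *[THEN conjunct2, THEN conjunct1]
  note a = *[THEN conjunct2, THEN conjunct2, THEN conjunct1, rule_format]
  note exp = *[THEN conjunct2, THEN conjunct2, THEN conjunct2, THEN conjunct1, rule_format]
  note adm = *[THEN conjunct2, THEN conjunct2, THEN conjunct2, THEN conjunct2, rule_format]
  have "(\<Prod>i<I. (2 ^ 2 ^ Suc i) ^ ?K i) \<le> (\<Prod>i<I. ((2::nat) ^ 2 ^ Suc i) ^ (2 * ?K i))"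
    by (intro prod_mono conjI power_increasing) auto
  also have "\<dots> \<le> Z" unfolding Z_def by (rule prod_length_le)
  finally have M: "M \<subseteq> {m. 0 < m \<and> m \<le> Z}" using Msub by (auto dest: order_trans)
  define b where "b N = (\<Sum>m | m \<in> M \<and> m dvd N \<and> N div m \<in> Y. a m * real m powr (- 1 / 2))" for N
  have step1: "real (q - 1) / 2 * (2 ^ I / 4) *
      (\<Sum>N=1..Z * N0. (\<Sum>m | m \<in> M \<and> m dvd N \<and> N div m \<in> Y. theta_weight \<kappa> q (N div m) * a m * real m powr (- 1 / 2))\<^sup>2)
    \<le> (\<Sum>chi\<in>X. (cmod (\<Sum>n=1..N0. of_real (theta_weight \<kappa> q n) * chi (int n)))\<^sup>2 * resonator_energy \<beta> (2 * K1) I (\<lambda>n. chi (int n)))"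
    by (rule twisted_second_moment_ge[OF X finM M a exp theta_weight_nonneg L]) (use y in \<open>auto simp: Y_def\<close>)
  have step2: "w0\<^sup>2 * (\<Sum>N=1..Z * N0. (b N)\<^sup>2) \<le>
      (\<Sum>N=1..Z * N0. (\<Sum>m | m \<in> M \<and> m dvd N \<and> N div m \<in> Y. theta_weight \<kappa> q (N div m) * a m * real m powr (- 1 / 2))\<^sup>2)"
    unfolding sum_distrib_left
  proof (rule sum_mono)
    fix N
    have "w0 * b N \<le> (\<Sum>m | m \<in> M \<and> m dvd N \<and> N div m \<in> Y. theta_weight \<kappa> q (N div m) * a m * real m powr (- 1 / 2))"
      unfolding b_def sum_distrib_left mult.assoc[symmetric]
    proof (intro sum_mono mult_right_mono)
      fix m assume m: "m \<in> {m. m \<in> M \<and> m dvd N \<and> N div m \<in> Y}"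
      then have "(N div m)\<^sup>2 \<le> y\<^sup>2" by (intro power_mono) (auto simp: Y_def)
      then have "(N div m)\<^sup>2 \<le> q" using y(4) by (rule order_trans)
      then show "w0 \<le> theta_weight \<kappa> q (N div m)"
        unfolding w0_def using m q0 by (intro theta_weight_ge) (auto simp: Y_def)
      show "0 \<le> a m" using m a by auto
    qed auto
    moreover have "0 \<le> w0 * b N"
      unfolding b_def using w0 a by (intro mult_nonneg_nonneg sum_nonneg) auto
    ultimately show "w0\<^sup>2 * (b N)\<^sup>2 \<le> (\<Sum>m | m \<in> M \<and> m dvd N \<and> N div m \<in> Y. theta_weight \<kappa> q (N div m) * a m * real m powr (- 1 / 2))\<^sup>2"
      unfolding power_mult_distrib[symmetric] by (intro power_mono)
  qed
  define S where "S = (\<Sum>R\<in>admissible_sets ?K I. ?\<nu> ^ card R / real (\<Prod>R))"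
  define D where "D = (\<Sum>N=1..Z * N0. ((\<beta> + 1)\<^sup>2) ^ card (prime_factors N) / real N)"
  define S1 where "S1 = exp (- 2 - 2 * ?\<nu> - ?\<nu>\<^sup>2) * (2 ^ I) powr ?\<nu>"
  define D1 where "D1 = exp (22 * (\<beta> + 1)\<^sup>2) * (2 ^ I') powr (\<beta> + 1)\<^sup>2"
  have "S1 \<le> S" unfolding S1_def S_def by (rule admissible_sum_ge[OF \<nu> K1])
  moreover have "S1 \<ge> 0" by (simp add: S1_def)
  ultimately have S: "S1\<^sup>2 \<le> S\<^sup>2" by (intro power_mono)
  have D: "D \<le> D1" unfolding D_def D1_def
    using \<beta> by (intro sum_power_omega_le Q) (auto intro: one_le_power)
  have "D1 > 0" by (simp add: D1_def)
  have step3: "real y / 16 * S\<^sup>2 \<le> (\<Sum>N=1..Z * N0. (b N)\<^sup>2) * D"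
    unfolding b_def S_def D_def Y_def using \<beta> y
    by (intro divisor_second_moment_ge[OF finM M a adm]) auto
  have "real y / 16 * S1\<^sup>2 \<le> real y / 16 * S\<^sup>2" using S by (intro mult_left_mono) auto
  also note step3
  also have "(\<Sum>N=1..Z * N0. (b N)\<^sup>2) * D \<le> (\<Sum>N=1..Z * N0. (b N)\<^sup>2) * D1"
    using D by (intro mult_left_mono sum_nonneg) auto
  finally have "real y / 16 * S1\<^sup>2 / D1 \<le> (\<Sum>N=1..Z * N0. (b N)\<^sup>2)"
    using \<open>D1 > 0\<close> by (simp add: pos_divide_le_eq)
  then have "w0\<^sup>2 * (real y / 16 * S1\<^sup>2 / D1) \<le> w0\<^sup>2 * (\<Sum>N=1..Z * N0. (b N)\<^sup>2)"
    by (intro mult_left_mono) auto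
  from order_trans[OF this step2]
  have "real (q - 1) / 2 * (2 ^ I / 4) * (w0\<^sup>2 * (real y / 16 * S1\<^sup>2 / D1)) \<le> real (q - 1) / 2 * (2 ^ I / 4) *
      (\<Sum>N=1..Z * N0. (\<Sum>m | m \<in> M \<and> m dvd N \<and> N div m \<in> Y. theta_weight \<kappa> q (N div m) * a m * real m powr (- 1 / 2))\<^sup>2)"
    by (intro mult_left_mono) auto
  from order_trans[OF this step1] show ?thesis
    unfolding w0_def[symmetric] S1_def[symmetric] D1_def[symmetric] by (simp only: mult.assoc)
qed

section \<open>Hoelder's inequality and the passage from truncated sums to theta\<close>

text \<open>Normalize both sums to 1 and apply the weighted inequality of the means termwise. Raised
  to the k-th power, the inequality has the moment to be bounded as a factor.\<close>

lemma holder_sum: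
  fixes f g :: "'b \<Rightarrow> real"
  assumes T: "finite T" "\<And>x. x \<in> T \<Longrightarrow> f x \<ge> 0" "\<And>x. x \<in> T \<Longrightarrow> g x \<ge> 0" and k: "k > 1"
  shows "(\<Sum>x\<in>T. f x * g x) powr k \<le> (\<Sum>x\<in>T. f x powr k) * (\<Sum>x\<in>T. g x powr (k / (k - 1))) powr (k - 1)"
proof -
  define F where "F = (\<Sum>x\<in>T. f x powr k)"
  define G where "G = (\<Sum>x\<in>T. g x powr (k / (k - 1)))"
  have nn: "F \<ge> 0" "G \<ge> 0" by (auto simp: F_def G_def intro: sum_nonneg)
  show ?thesis
  proof (cases "F = 0 \<or> G = 0")
    case True
    then have "\<forall>x\<in>T. f x * g x = 0"
      using T by (auto simp: F_def G_def sum_nonneg_eq_0_iff)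
    then have "(\<Sum>x\<in>T. f x * g x) = 0" by (intro sum.neutral)
    then show ?thesis using nn by (simp add: F_def[symmetric] G_def[symmetric])
  next
    case False
    then have pos: "F > 0" "G > 0" using nn by auto
    have k0: "0 < 1 / k" "0 < 1 - 1 / k" using k by (auto simp: field_simps)
    have kk: "(k / (k - 1)) * (1 - 1 / k) = 1" using k by (simp add: field_simps)
    have young: "f x * g x \<le> F powr (1 / k) * G powr (1 - 1 / k) * (1 / k * (f x powr k / F) + (1 - 1 / k) * (g x powr (k / (k - 1)) / G))"
      if x: "x \<in> T" for x
    proof (cases "f x = 0 \<or> g x = 0")
      case True
      then show ?thesis using pos k0 k by (auto intro!: mult_nonneg_nonneg add_nonneg_nonneg)
    next
      case False
      then have fg: "f x > 0" "g x > 0" using T x by (auto simp: order_less_le)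
      have "(f x powr k / F) powr (1 / k) * (g x powr (k / (k - 1)) / G) powr (1 - 1 / k)
          \<le> 1 / k * (f x powr k / F) + (1 - 1 / k) * (g x powr (k / (k - 1)) / G)"
        using k0 fg pos by (intro Youngs_inequality_0) auto
      also have "(f x powr k / F) powr (1 / k) = f x / F powr (1 / k)"
        using fg pos k by (simp add: powr_divide powr_powr)
      also have "(g x powr (k / (k - 1)) / G) powr (1 - 1 / k) = g x / G powr (1 - 1 / k)"
        using fg pos by (simp only: powr_divide powr_powr kk) simp
      finally have "f x * g x / (F powr (1 / k) * G powr (1 - 1 / k)) \<le> 1 / k * (f x powr k / F) + (1 - 1 / k) * (g x powr (k / (k - 1)) / G)"
        by simp
      then show ?thesis using pos by (subst (asm) pos_divide_le_eq) (auto simp: mult.commute)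
    qed
    have "(\<Sum>x\<in>T. f x * g x) \<le> (\<Sum>x\<in>T. F powr (1 / k) * G powr (1 - 1 / k) * (1 / k * (f x powr k / F) + (1 - 1 / k) * (g x powr (k / (k - 1)) / G)))"
      by (intro sum_mono young)
    also have "\<dots> = F powr (1 / k) * G powr (1 - 1 / k) * (1 / k * (F / F) + (1 - 1 / k) * (G / G))"
      unfolding F_def G_def by (simp only: sum_distrib_left[symmetric] sum.distrib sum_divide_distrib)
    also have "\<dots> = F powr (1 / k) * G powr (1 - 1 / k)" using pos by simp
    finally have "(\<Sum>x\<in>T. f x * g x) powr k \<le> (F powr (1 / k) * G powr (1 - 1 / k)) powr k"
      using k T by (intro powr_mono2) (auto intro!: sum_nonneg)
    also have "\<dots> = F powr (1 / k * k) * G powr ((1 - 1 / k) * k)"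
      using pos by (simp add: powr_mult powr_powr)
    also have "1 / k * k = 1" using k by simp
    also have "(1 - 1 / k) * k = k - 1" using k by (simp add: field_simps)
    finally show ?thesis using pos by (simp add: F_def[symmetric] G_def[symmetric])
  qed
qed

lemma parity_exponent_imp_class:
  "parity_exponent q X \<kappa> \<Longrightarrow> prime q \<Longrightarrow> q > 2 \<Longrightarrow> parity_class q X"
  by (auto simp: parity_exponent_def parity_class_def)

text \<open>The mean square of the constant polynomial 1 counts the characters.\<close>

lemma card_parity_class_le:
  assumes "parity_class q X"
  shows "real (card X) \<le> real q"
  using mean_square_le[OF assms dirichlet_poly_one] assms by (simp add: parity_class_def)

text \<open>The tail of theta is removed by (a + b)^2 <= 2 a^2 + 2 b^2. The principal character is
  even, so its truncated sum has weights at most 1 and is at most \<open>N0\<close>. Both errors are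
  paid for by the pointwise bound \<open>Wm\<close>.\<close>

lemma resonated_theta_ge:
  assumes X: "parity_exponent q X \<kappa>" "parity_class q X" and N0: "q\<^sup>2 \<le> N0 ^ 3"
    and W: "\<And>chi. chi \<in> X \<Longrightarrow> 0 \<le> W chi \<and> W chi \<le> Wm"
  shows "(\<Sum>chi\<in>X. (cmod (\<Sum>n=1..N0. of_real (theta_weight \<kappa> q n) * chi (int n)))\<^sup>2 * W chi)
     \<le> 2 * (\<Sum>chi\<in>X - {principal_character q}. (cmod (theta q 1 chi))\<^sup>2 * W chi)
       + (2 * 1440\<^sup>2 * real q + (real N0)\<^sup>2) * Wm"
proof -
  let ?X' = "X - {principal_character q}"
  define S where "S chi = (\<Sum>n=1..N0. of_real (theta_weight \<kappa> q n) * chi (int n))" for chi :: "int \<Rightarrow> complex"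
  have q0: "q > 0" and q2: "q > 2" using X(2) by (auto simp: parity_class_def)
  have fin: "finite X" by (rule finite_parity_class[OF X(2)])
  have Wm: "Wm \<ge> 0"
  proof -
    have "X \<noteq> {}"
    proof
      assume "X = {}"
      then have "real (q - 1) / 2 * 1 = 0"
        using mean_square_dirichlet_poly[OF X(2), of "{1}" "\<lambda>_. 1"] q2 by simp
      then show False using q2 by simp
    qed
    then show ?thesis using W by (meson ex_in_conv order_trans)
  qed
  have comp: "(cmod (S chi))\<^sup>2 \<le> 2 * (cmod (theta q 1 chi))\<^sup>2 + 2 * 1440\<^sup>2" if "chi \<in> X" for chi
  proof -
    have "cmod (S chi) \<le> cmod (theta q 1 chi) + cmod (theta q 1 chi - S chi)"
      by (metis norm_minus_commute norm_triangle_sub)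
    then have "cmod (S chi) \<le> cmod (theta q 1 chi) + 1440"
      using theta_truncation[OF q0 X(1) that N0] unfolding S_def by linarith
    then have "(cmod (S chi))\<^sup>2 \<le> (cmod (theta q 1 chi) + 1440)\<^sup>2" by (intro power_mono) auto
    also have "\<dots> \<le> 2 * (cmod (theta q 1 chi))\<^sup>2 + 2 * 1440\<^sup>2"
      using sum_squares_bound[of "cmod (theta q 1 chi)" 1440] by (simp add: power2_sum)
    finally show ?thesis .
  qed
  have "(\<Sum>chi\<in>?X'. (cmod (S chi))\<^sup>2 * W chi)
     \<le> (\<Sum>chi\<in>?X'. 2 * ((cmod (theta q 1 chi))\<^sup>2 * W chi) + 2 * 1440\<^sup>2 * Wm)"
  proof (rule sum_mono)
    fix chi assume "chi \<in> ?X'"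
    then have chi: "chi \<in> X" by simp
    have "(cmod (S chi))\<^sup>2 * W chi \<le> (2 * (cmod (theta q 1 chi))\<^sup>2 + 2 * 1440\<^sup>2) * W chi"
      using comp[OF chi] W[OF chi] by (intro mult_right_mono) auto
    also have "\<dots> \<le> 2 * ((cmod (theta q 1 chi))\<^sup>2 * W chi) + 2 * 1440\<^sup>2 * Wm"
      using W[OF chi] by (simp add: distrib_right)
    finally show "(cmod (S chi))\<^sup>2 * W chi \<le> 2 * ((cmod (theta q 1 chi))\<^sup>2 * W chi) + 2 * 1440\<^sup>2 * Wm" .
  qed
  also have "\<dots> = 2 * (\<Sum>chi\<in>?X'. (cmod (theta q 1 chi))\<^sup>2 * W chi) + real (card ?X') * (2 * 1440\<^sup>2 * Wm)"
    by (simp add: sum.distrib sum_distrib_left)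
  also have "real (card ?X') * (2 * 1440\<^sup>2 * Wm) \<le> real q * (2 * 1440\<^sup>2 * Wm)"
  proof (rule mult_right_mono)
    have "card ?X' \<le> card X" using fin by (intro card_mono) auto
    then show "real (card ?X') \<le> real q" using card_parity_class_le[OF X(2)] by linarith
  qed (use Wm in simp)
  finally have main: "(\<Sum>chi\<in>?X'. (cmod (S chi))\<^sup>2 * W chi)
     \<le> 2 * (\<Sum>chi\<in>?X'. (cmod (theta q 1 chi))\<^sup>2 * W chi) + real q * (2 * 1440\<^sup>2 * Wm)" by simp
  have principal: "(\<Sum>chi\<in>X. (cmod (S chi))\<^sup>2 * W chi) \<le> (\<Sum>chi\<in>?X'. (cmod (S chi))\<^sup>2 * W chi) + (real N0)\<^sup>2 * Wm"
  proof (cases "principal_character q \<in> X")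
    case False
    then show ?thesis using Wm by simp
  next
    case True
    let ?p = "principal_character q"
    have "\<kappa> = 0"
      using X(1) True by (auto simp: parity_exponent_def odd_characters_def principal_character_def)
    have "cmod (S ?p) \<le> (\<Sum>n=1..N0. 1 * 1)"
      unfolding S_def
    proof (intro order_trans[OF norm_sum] sum_mono)
      fix n
      have "cmod (of_real (theta_weight \<kappa> q n)) \<le> 1"
        using \<open>\<kappa> = 0\<close> by (simp add: theta_weight_def)
      moreover have "cmod (?p (int n)) \<le> 1" by (simp add: principal_character_def)
      ultimately show "cmod (of_real (theta_weight \<kappa> q n) * ?p (int n)) \<le> 1 * 1"
        unfolding norm_mult by (intro mult_mono) auto
    qed
    then have "(cmod (S ?p))\<^sup>2 \<le> (real N0)\<^sup>2" by (intro power_mono) auto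
    then have "(cmod (S ?p))\<^sup>2 * W ?p \<le> (real N0)\<^sup>2 * Wm" using W[OF True] by (intro mult_mono) auto
    then show ?thesis using sum.remove[OF fin True, of "\<lambda>chi. (cmod (S chi))\<^sup>2 * W chi"] by simp
  qed
  show ?thesis using main principal unfolding S_def[symmetric] by (simp add: algebra_simps)
qed

section \<open>Choice of the parameters and the moment bound\<close>

text \<open>All sizes are powers of t = q^(1/48): resonator length Z <= t^3, truncation N0 of order
  t^32 = q^(2/3), and y of order t^24, the square root of q, where theta has its mass. Then 2 Z N0
  <= 4 t^35 < q, and the errors, of order t^67 J^nu, lose against a main term of order at least t^72
  J^nu.\<close>

lemma theta_moment_lower_bound:
  assumes k: "k \<ge> 2"
  shows "\<exists>c>0. \<exists>q1::nat. \<forall>q X \<kappa>. prime q \<longrightarrow> q \<ge> q1 \<longrightarrow> parity_exponent q X \<kappa> \<longrightarrow>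
     c * (real q powr ((1 / 2 + real \<kappa>) * k) * ln (real q) powr ((k - 1)\<^sup>2))
      \<le> 1 / real (totient q) * (\<Sum>chi\<in>X - {principal_character q}. cmod (theta q 1 chi) powr (2 * k))"
proof -
  define \<beta> where "\<beta> = k - 1"
  have \<beta>: "\<beta> \<ge> 1" and k\<beta>: "k = \<beta> + 1" using k by (auto simp: \<beta>_def)
  define \<nu> where "\<nu> = \<beta> * (\<beta> + 2)"
  obtain s :: nat where s: "max (4800 * \<beta>\<^sup>2) (12 * \<nu>) < 2 ^ s"
    using real_arch_pow[of 2 "max (4800 * \<beta>\<^sup>2) (12 * \<nu>)"] by auto
  define K1 :: nat where "K1 = 2 ^ s"
  \<comment> \<open>With K1 = 2^s the exponent of Z is 2^(s + 4 + I); the 8 adds four more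
    doublings, so that Z^16 is exactly 2^(2^M) for M = r + I.\<close>
  define r where "r = s + 8"
  define e1 where "e1 = exp (- 2 - 2 * \<nu> - \<nu>\<^sup>2)"
  define e2 where "e2 = exp (22 * (\<beta> + 1)\<^sup>2)"
  \<comment> \<open>8192 = 4 * 4 * 32 * 16: the losses are 4 in replacing (q - 1)/2 by q/4, 4 in the
    Fejer bound, 32 for the powers of y, and 16 in the divisor sums.\<close>
  define c2 where "c2 = exp (- pi) ^ 2 * e1\<^sup>2 / (8192 * e2 * (2 ^ Suc r) powr k\<^sup>2)"
  define C4 where "C4 = (2 * 1440\<^sup>2 + 4) * (2 * exp (20 * \<beta>\<^sup>2))"
  define C8 where "C8 = 8 * exp (20 * (\<beta> + 1)\<^sup>2 + 10)"
  \<comment> \<open>The margin t^5 between main term and error must absorb their constants; t >= H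
    guarantees this.\<close>
  define H where "H = max 2 (2 * C4 / c2)"
  define c where "c = (c2 / 4) powr k / C8 powr \<beta> / (2 ^ Suc r) powr \<beta>\<^sup>2"
  define q1 where "q1 = max (nat \<lceil>H ^ 48\<rceil>) (2 ^ 2 ^ r)"
  have pos: "c2 > 0" "C4 > 0" "C8 > 0" "e1 > 0" "e2 > 0"
    by (auto simp: c2_def C4_def C8_def e1_def e2_def intro!: divide_pos_pos mult_pos_pos add_pos_pos)
  have c: "c > 0" using pos by (simp add: c_def)
  have main: "c * (real q powr ((1 / 2 + real \<kappa>) * k) * ln (real q) powr ((k - 1)\<^sup>2))
      \<le> 1 / real (totient q) * (\<Sum>chi\<in>X - {principal_character q}. cmod (theta q 1 chi) powr (2 * k))"
    if q: "prime q" "q \<ge> q1" and X: "parity_exponent q X \<kappa>" for q X \<kappa>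
  proof -
    let ?X' = "X - {principal_character q}"
    have H2: "H \<ge> 2" and Hc: "H \<ge> 2 * C4 / c2" by (auto simp: H_def)
    define t where "t = real q powr (1 / 48)"
    have q0: "q > 0" using q(1) prime_gt_0_nat by blast
    have t48: "t ^ 48 = real q" using q0 by (simp add: t_def powr_power)
    have "H ^ 48 \<le> real q" using q(2) by (simp add: q1_def)
    then have tH: "t \<ge> H" using t48 power_mono_iff[of H t 48] H2 by (simp add: t_def)
    then have t2: "t \<ge> 2" using H2 by linarith
    have tpow: "t ^ m \<ge> 2 ^ m" for m using t2 by (intro power_mono) auto
    have tle: "t ^ m \<le> t ^ n" if "m \<le> n" for m n using that t2 by (intro power_increasing) auto
    define P where "P m \<longleftrightarrow> q < 2 ^ 2 ^ m" for m :: nat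
    have exP: "\<exists>m. P m"
    proof -
      have "q < 2 ^ q" by (rule less_exp)
      also have "\<dots> \<le> 2 ^ 2 ^ q" using less_exp[of q] by (intro power_increasing) auto
      finally show ?thesis unfolding P_def by blast
    qed
    \<comment> \<open>Chosen so that 2^(2^M) <= q < 2^(2^(M + 1)), which puts log q within a
      constant factor of 2^M. The least exponent exceeds \<open>r\<close>, so subtracting 1 is a
      true predecessor and M - r is not cut off.\<close>
    define M where "M = (LEAST m. P m) - 1"
    have notP: "\<not> P m" if "m \<le> r" for m
    proof -
      have "(2::nat) ^ 2 ^ m \<le> 2 ^ 2 ^ r" using that by (intro power_increasing) auto
      also have "2 ^ 2 ^ r \<le> q" using q(2) by (simp add: q1_def)
      finally show ?thesis unfolding P_def by (rule leD)
    qed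
    have L: "P (LEAST m. P m)" using exP by (rule LeastI_ex)
    then have gr: "(LEAST m. P m) > r" using notP by (meson not_le)
    have PM: "P (Suc M)" and nPM: "\<not> P M" and Mr: "r \<le> M"
      using L gr not_less_Least[of M P] by (auto simp: M_def)
    define I where "I = M - r"
    have MI: "M = r + I" using Mr by (simp add: I_def)
    define Z :: nat where "Z = 2 ^ (8 * (2 * K1) * 2 ^ I)"
    have "Z ^ 16 = 2 ^ 2 ^ M"
    proof -
      have "8 * (2 * K1) * 2 ^ I * 16 = 2 ^ M" by (simp add: K1_def MI r_def power_add)
      then show ?thesis by (simp only: Z_def power_mult[symmetric])
    qed
    then have "Z ^ 16 \<le> q" using nPM by (simp add: P_def)
    then have "real (Z ^ 16) \<le> (t ^ 3) ^ 16" using t48 by (simp add: power_mult[symmetric])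
    then have Zt: "real Z \<le> t ^ 3" using t2 power_mono_iff[of "real Z" "t ^ 3" 16] by simp
    define N0 where "N0 = nat \<lceil>t ^ 32\<rceil>"
    have N0: "t ^ 32 \<le> real N0" "real N0 \<le> 2 * t ^ 32"
    proof -
      have "t ^ 32 \<ge> 1" using tpow[of 32] by simp
      then show "t ^ 32 \<le> real N0" "real N0 \<le> 2 * t ^ 32" unfolding N0_def by linarith+
    qed
    define y where "y = nat \<lfloor>t ^ 24\<rfloor>"
    have y: "real y \<le> t ^ 24" "t ^ 24 - 1 \<le> real y"
    proof -
      have "t ^ 24 \<ge> 1" using tpow[of 24] by simp
      then show "real y \<le> t ^ 24" "t ^ 24 - 1 \<le> real y" unfolding y_def by linarith+
    qed
    have y2: "t ^ 24 / 2 \<le> real y" using y(2) tpow[of 24] by simp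
    have N0q: "q\<^sup>2 \<le> N0 ^ 3"
    proof -
      have "(real q)\<^sup>2 = (t ^ 32) ^ 3" unfolding t48[symmetric] by (simp add: power_mult[symmetric])
      also have "\<dots> \<le> real N0 ^ 3" using N0(1) t2 by (intro power_mono) auto
      finally have "real (q\<^sup>2) \<le> real (N0 ^ 3)" by simp
      then show ?thesis by (simp only: of_nat_le_iff)
    qed
    have ZN: "2 * (Z * N0) < q"
    proof -
      have "real (2 * (Z * N0)) = 2 * (real Z * real N0)" by simp
      also have "\<dots> \<le> 2 * (t ^ 3 * (2 * t ^ 32))"
        by (intro mult_left_mono mult_mono Zt N0(2)) (use t2 in auto)
      also have "\<dots> = 4 * t ^ 35" by (simp add: power_add[symmetric])
      also have "\<dots> < 2 ^ 13 * t ^ 35" using t2 by simp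
      also have "\<dots> \<le> t ^ 13 * t ^ 35" using tpow[of 13] t2 by (intro mult_right_mono) auto
      also have "\<dots> = real q" by (simp add: power_add[symmetric] t48)
      finally show ?thesis by (simp only: of_nat_less_iff)
    qed
    have Zy: "4 * Z \<le> y"
    proof -
      have "4 * real Z \<le> 4 * t ^ 3" using Zt by simp
      also have "\<dots> \<le> t ^ 24 - 1"
      proof -
        have "t ^ 24 = t ^ 21 * t ^ 3" by (simp add: power_add[symmetric])
        moreover have "2 ^ 21 * t ^ 3 \<le> t ^ 21 * t ^ 3" using tpow[of 21] t2 by (intro mult_right_mono) auto
        moreover have "t ^ 3 \<ge> 1" using tpow[of 3] by simp
        ultimately show ?thesis by simp
      qed
      also have "\<dots> \<le> real y" by (rule y(2))
      finally show ?thesis by simp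
    qed
    have y0: "0 < y" using y2 t2 by (metis less_le_trans half_gt_zero of_nat_0_less_iff zero_less_numeral zero_less_power)
    have yN: "y \<le> N0"
    proof -
      have "real y \<le> real N0" using y(1) tle[of 24 32] N0(1) by linarith
      then show ?thesis by simp
    qed
    have yq: "y\<^sup>2 \<le> q"
    proof -
      have "(real y)\<^sup>2 \<le> (t ^ 24)\<^sup>2" using y(1) by (intro power_mono) auto
      also have "\<dots> = real q" by (simp add: power_mult[symmetric] t48)
      finally have "real (y\<^sup>2) \<le> real q" by simp
      then show ?thesis by (simp only: of_nat_le_iff)
    qed
    have q3: "q > 2"
    proof -
      have "real q \<ge> 2 ^ 48" using tpow[of 48] t48 by simp
      then show ?thesis by simp
    qed
    have PC: "parity_class q X" by (rule parity_exponent_imp_class[OF X q(1) q3])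
    have K1: "K1 \<ge> 1" "real (2 * K1) \<ge> 12 * (\<beta> * (\<beta> + 2))" "real (2 * K1) \<ge> 4800 * \<beta>\<^sup>2"
    proof -
      have "4800 * \<beta>\<^sup>2 < 2 ^ s" "12 * (\<beta> * (\<beta> + 2)) < 2 ^ s" using s by (auto simp: \<nu>_def)
      moreover have "real (2 * K1) = 2 * 2 ^ s" "(2::real) ^ s > 0" by (simp_all add: K1_def)
      ultimately show "real (2 * K1) \<ge> 12 * (\<beta> * (\<beta> + 2))" "real (2 * K1) \<ge> 4800 * \<beta>\<^sup>2" by linarith+
    qed (simp add: K1_def)
    have QI: "Z * N0 \<le> 2 ^ 2 ^ Suc M" using ZN PM by (simp add: P_def)
    define J :: real where "J = 2 ^ I"
    have J1: "J \<ge> 1" by (simp add: J_def)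
    have J': "(2::real) ^ Suc M = 2 ^ Suc r * J" by (simp add: MI J_def power_add)
    define W where "W chi = resonator_energy \<beta> (2 * K1) I (\<lambda>n. chi (int n))" for chi :: "int \<Rightarrow> complex"
    define Wm where "Wm = 2 * 2 ^ I * (2 ^ (8 * (2 * K1) * 2 ^ I) * (exp (20 * \<beta>\<^sup>2) * (2 ^ I) powr \<beta>\<^sup>2))"
    have Wnn: "W chi \<ge> 0" for chi unfolding W_def resonator_energy_def by (intro sum_nonneg) auto
    have WWm: "W chi \<le> Wm" if "chi \<in> X" for chi
      unfolding W_def Wm_def
      using \<beta> norm_character_le_1[OF parity_class_character[OF PC that] q0]
        completely_multiplicative_character[OF parity_class_character[OF PC that]]
      by (intro resonator_energy_le) auto
    have kap: "\<kappa> \<le> 1" using X by (auto simp: parity_exponent_def)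
    define LB where "LB = real q * (t ^ 24) ^ (1 + 2 * \<kappa>) * J powr \<nu>"
    have LBpos: "LB > 0" using q0 t2 J1 by (simp add: LB_def)
    have B: "c2 * LB \<le> (\<Sum>chi\<in>X. (cmod (\<Sum>n=1..N0. of_real (theta_weight \<kappa> q n) * chi (int n)))\<^sup>2 * W chi)"
    proof -
      have "c2 * LB \<le> real (q - 1) / 2 * (2 ^ I / 4) * ((real y / 2) ^ \<kappa> * exp (- pi))\<^sup>2 * (real y / 16
        * (e1 * (2 ^ I) powr \<nu>)\<^sup>2 / (e2 * (2 ^ Suc M) powr (\<beta> + 1)\<^sup>2))"
      proof -
        \<comment> \<open>From k^2 = nu + 1: the squared sum over admissible sets gives J^(2 nu),
          the shifts give J, and the Cauchy-Schwarz factor J^(k^2) takes away nu + 1, leaving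
          J^nu.\<close>
        have J2: "(J powr \<nu>)\<^sup>2 * J = J powr \<nu> * J powr k\<^sup>2"
        proof -
          have "(J powr \<nu>)\<^sup>2 * J = J powr (\<nu> + \<nu> + 1)"
            unfolding powr_add power2_eq_square using J1 by simp
          also have "\<nu> + \<nu> + 1 = \<nu> + k\<^sup>2" by (simp add: \<nu>_def k\<beta> power2_eq_square algebra_simps)
          finally show ?thesis by (simp add: powr_add)
        qed
        have Jk: "J powr k\<^sup>2 > 0" using J1 by simp
        define R where "R = (2 ^ Suc r :: real) powr k\<^sup>2"
        have R: "R > 0" by (simp add: R_def)
        have "real q / 2 \<le> real (q - 1)" using q3 by (simp add: of_nat_diff)
        then have qq: "real q / 4 \<le> real (q - 1) / 2" by simp
        \<comment> \<open>The constant 32 is that of the odd case: y >= t^24 / 2 gives (1/4)^2 *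
          (1/2).\<close>
        have yy: "(t ^ 24) ^ (1 + 2 * \<kappa>) / 32 \<le> ((real y / 2) ^ \<kappa>)\<^sup>2 * real y"
        proof -
          have "(t ^ 24 / 4) ^ (2 * \<kappa>) * (t ^ 24 / 2) \<le> (real y / 2) ^ (2 * \<kappa>) * real y"
            using y2 t2 by (intro mult_mono power_mono) auto
          moreover have "(t ^ 24) ^ (1 + 2 * \<kappa>) / 32 \<le> (t ^ 24 / 4) ^ (2 * \<kappa>) * (t ^ 24 / 2)"
          proof (cases "\<kappa> = 0")
            case True
            then show ?thesis using t2 by simp
          next
            case False
            then have "\<kappa> = 1" using kap by simp
            then show ?thesis by (simp add: power2_eq_square power3_eq_cube)
          qed
          ultimately show ?thesis by (simp add: power_mult[symmetric] mult.commute)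
        qed
        have "c2 * LB = real q / 4 * (J / 4) * (exp (- pi) ^ 2 * ((t ^ 24) ^ (1 + 2 * \<kappa>) / 32)) * (1 / 16
            * (e1 * J powr \<nu>)\<^sup>2 / (e2 * (R * J powr k\<^sup>2)))"
        proof -
          have "real q / 4 * (J / 4) * (exp (- pi) ^ 2 * ((t ^ 24) ^ (1 + 2 * \<kappa>) / 32)) * (1 / 16
              * (e1 * J powr \<nu>)\<^sup>2 / (e2 * (R * J powr k\<^sup>2)))
            = real q * (exp (- pi) ^ 2 * (t ^ 24) ^ (1 + 2 * \<kappa>)) * e1\<^sup>2 * ((J powr \<nu>)\<^sup>2 * J) / (8192 * (e2 * (R * J powr k\<^sup>2)))"
            by (simp add: power_mult_distrib mult_ac)
          also have "\<dots> = real q * (exp (- pi) ^ 2 * (t ^ 24) ^ (1 + 2 * \<kappa>)) * e1\<^sup>2 * J powr \<nu> / (8192 * (e2 * R))"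
            unfolding J2 using Jk by simp
          also have "\<dots> = c2 * LB"
            by (simp add: c2_def LB_def R_def mult_ac)
          finally show ?thesis by simp
        qed
        also have "\<dots> \<le> real (q - 1) / 2 * (J / 4) * (exp (- pi) ^ 2 * (((real y / 2) ^ \<kappa>)\<^sup>2 * real y)) * (1 / 16
            * (e1 * J powr \<nu>)\<^sup>2 / (e2 * (R * J powr k\<^sup>2)))"
          using qq yy J1 pos R Jk t2 by (intro mult_mono mult_nonneg_nonneg divide_nonneg_nonneg) auto
        also have "\<dots> = real (q - 1) / 2 * (2 ^ I / 4) * ((real y / 2) ^ \<kappa> * exp (- pi))\<^sup>2 * (real y / 16
            * (e1 * (2 ^ I) powr \<nu>)\<^sup>2 / (e2 * (2 ^ Suc M) powr (\<beta> + 1)\<^sup>2))"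
          unfolding J' R_def J_def[symmetric] k\<beta>[symmetric] using J1
          by (simp add: power_mult_distrib powr_mult mult_ac)
        finally show ?thesis .
      qed
      also have "\<dots> \<le> (\<Sum>chi\<in>X. (cmod (\<Sum>n=1..N0. of_real (theta_weight \<kappa> q n) * chi (int n)))\<^sup>2 * W chi)"
        unfolding W_def e1_def e2_def \<nu>_def
        by (rule resonated_second_moment_ge[OF PC \<beta> K1(1,2) ZN[unfolded Z_def] Zy[unfolded Z_def] y0 yN yq QI[unfolded Z_def]])
      finally show ?thesis .
    qed
    \<comment> \<open>Both q and N0^2 are at most of order t^64, and Wm adds t^3 J^nu, because 1 +
      beta^2 <= nu for beta >= 1.\<close>
    have Err: "(2 * 1440\<^sup>2 * real q + (real N0)\<^sup>2) * Wm \<le> c2 * LB / 2"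
    proof -
      have "real q \<le> t ^ 64" using tle[of 48 64] t48 by simp
      moreover have "(real N0)\<^sup>2 \<le> (2 * t ^ 32)\<^sup>2" using N0(2) by (intro power_mono) auto
      moreover have "(2 * t ^ 32)\<^sup>2 = 4 * t ^ 64" by (simp add: power_mult_distrib power_mult[symmetric])
      ultimately have a: "2 * 1440\<^sup>2 * real q + (real N0)\<^sup>2 \<le> (2 * 1440\<^sup>2 + 4) * t ^ 64" by simp
      have "J * J powr \<beta>\<^sup>2 = J powr (1 + \<beta>\<^sup>2)" using J1 by (simp add: powr_add)
      also have "\<dots> \<le> J powr \<nu>" using J1 \<beta> by (intro powr_mono) (auto simp: \<nu>_def power2_eq_square algebra_simps)
      finally have Jle: "J * J powr \<beta>\<^sup>2 \<le> J powr \<nu>" .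
      have "Wm = (2 * exp (20 * \<beta>\<^sup>2)) * (real Z * (J * J powr \<beta>\<^sup>2))"
        by (simp add: Wm_def Z_def J_def)
      also have "\<dots> \<le> (2 * exp (20 * \<beta>\<^sup>2)) * (t ^ 3 * J powr \<nu>)"
        using Zt Jle t2 J1 by (intro mult_left_mono mult_mono) auto
      finally have b: "Wm \<le> (2 * exp (20 * \<beta>\<^sup>2)) * (t ^ 3 * J powr \<nu>)" .
      have Wm0: "Wm \<ge> 0" by (simp add: Wm_def)
      have "(2 * 1440\<^sup>2 * real q + (real N0)\<^sup>2) * Wm \<le> ((2 * 1440\<^sup>2 + 4) * t ^ 64) * ((2 * exp (20 * \<beta>\<^sup>2)) * (t ^ 3 * J powr \<nu>))"
        using a b Wm0 t2 by (intro mult_mono) auto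
      also have "\<dots> = C4 * (t ^ 67 * J powr \<nu>)"
        by (simp add: C4_def power_add[of t 64 3, simplified])
      also have "C4 \<le> c2 / 2 * t ^ 5"
      proof -
        have "2 * C4 / c2 \<le> t" using Hc tH by linarith
        also have "\<dots> \<le> t ^ 5" using tle[of 1 5] by simp
        finally show ?thesis using pos by (simp add: divide_le_eq mult.commute)
      qed
      then have "C4 * (t ^ 67 * J powr \<nu>) \<le> c2 / 2 * t ^ 5 * (t ^ 67 * J powr \<nu>)"
        using t2 by (intro mult_right_mono) auto
      also have "\<dots> = c2 / 2 * (t ^ 72 * J powr \<nu>)" by (simp add: power_add[of t 5 67, simplified])
      also have "\<dots> \<le> c2 / 2 * LB"
      proof (intro mult_left_mono)
        have "t ^ 72 = real q * t ^ 24" unfolding t48[symmetric] by (simp add: power_add[symmetric])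
        also have "\<dots> \<le> real q * (t ^ 24) ^ (1 + 2 * \<kappa>)"
        proof (intro mult_left_mono)
          have "(t ^ 24) ^ 1 \<le> (t ^ 24) ^ (1 + 2 * \<kappa>)" using tpow[of 24] by (intro power_increasing) auto
          then show "t ^ 24 \<le> (t ^ 24) ^ (1 + 2 * \<kappa>)" by simp
        qed simp
        finally show "t ^ 72 * J powr \<nu> \<le> LB" unfolding LB_def by (intro mult_right_mono) auto
      qed (use pos in simp)
      finally show ?thesis by simp
    qed
    define A where "A = (\<Sum>chi\<in>?X'. (cmod (theta q 1 chi))\<^sup>2 * W chi)"
    have "(\<Sum>chi\<in>X. (cmod (\<Sum>n=1..N0. of_real (theta_weight \<kappa> q n) * chi (int n)))\<^sup>2 * W chi)
        \<le> 2 * A + (2 * 1440\<^sup>2 * real q + (real N0)\<^sup>2) * Wm"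
      unfolding A_def by (rule resonated_theta_ge[OF X PC N0q]) (use Wnn WWm in auto)
    then have A: "c2 / 4 * LB \<le> A" using B Err by simp
    define F where "F = (\<Sum>chi\<in>?X'. cmod (theta q 1 chi) powr (2 * k))"
    have F0: "F \<ge> 0" unfolding F_def by (intro sum_nonneg) auto
    define G where "G = (\<Sum>chi\<in>?X'. W chi powr (k / (k - 1)))"
    have G0: "G \<ge> 0" unfolding G_def by (intro sum_nonneg) auto
    have fin: "finite X" by (rule finite_parity_class[OF PC])
    have G: "G \<le> C8 * (real q * J powr (k\<^sup>2 + 1))"
    proof -
      have "k / (k - 1) = 1 + 1 / \<beta>" using \<beta> by (simp add: k\<beta> field_simps)
      then have "G \<le> (\<Sum>chi\<in>X. W chi powr (1 + 1 / \<beta>))"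
        unfolding G_def using fin by (simp only:) (intro sum_mono2, auto)
      also have "\<dots> \<le> C8 * (real q * (2 ^ I) powr ((\<beta> + 1)\<^sup>2 + 1))"
        unfolding W_def C8_def
      proof (rule resonator_energy_moment_le[OF PC \<beta> K1(3)])
        have "N0 \<ge> 1" using yN y0 by linarith
        then have "2 * (Z * 1) \<le> 2 * (Z * N0)" by (intro mult_le_mono2)
        then have "2 * (Z * 1) < q" using ZN by (rule le_less_trans)
        then show "2 * 2 ^ (8 * (2 * K1) * 2 ^ I) < q" by (simp add: Z_def)
      qed
      finally show ?thesis by (simp add: J_def k\<beta>)
    qed
    have "(c2 / 4 * LB) powr k \<le> A powr k" using A pos LBpos k by (intro powr_mono2) auto
    also have "\<dots> \<le> (\<Sum>chi\<in>?X'. ((cmod (theta q 1 chi))\<^sup>2) powr k) * G powr (k - 1)"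
      unfolding A_def G_def by (rule holder_sum) (use fin Wnn k in auto)
    also have "(\<Sum>chi\<in>?X'. ((cmod (theta q 1 chi))\<^sup>2) powr k) = F"
      unfolding F_def
    proof (rule sum.cong[OF refl])
      fix chi
      have "(cmod (theta q 1 chi))\<^sup>2 = cmod (theta q 1 chi) powr 2"
        by (simp add: powr_numeral)
      then show "((cmod (theta q 1 chi))\<^sup>2) powr k = cmod (theta q 1 chi) powr (2 * k)" by (simp only: powr_powr)
    qed
    also have "F * G powr (k - 1) \<le> F * (C8 * (real q * J powr (k\<^sup>2 + 1))) powr (k - 1)"
      using G G0 F0 k by (intro mult_left_mono powr_mono2) auto
    finally have hol: "(c2 / 4 * LB) powr k \<le> F * (C8 * (real q * J powr (k\<^sup>2 + 1))) powr (k - 1)" .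
    have lhs: "(c2 / 4 * LB) powr k = (c2 / 4) powr k * (real q powr k * real q powr ((1 / 2 + real \<kappa>) * k) * J powr (\<nu> * k))"
    proof -
      have "(t ^ 24) ^ (1 + 2 * \<kappa>) = real q powr (1 / 2 + real \<kappa>)"
      proof -
        have "(t ^ 24) ^ (1 + 2 * \<kappa>) = t ^ (24 * (1 + 2 * \<kappa>))" by (simp only: power_mult)
        also have "\<dots> = t powr real (24 * (1 + 2 * \<kappa>))" using t2 by (intro powr_realpow[symmetric]) auto
        also have "\<dots> = real q powr (1 / 48 * real (24 * (1 + 2 * \<kappa>)))" by (simp only: t_def powr_powr)
        also have "1 / 48 * real (24 * (1 + 2 * \<kappa>)) = 1 / 2 + real \<kappa>" by simp
        finally show ?thesis .
      qed
      then have LB: "LB = real q * real q powr (1 / 2 + real \<kappa>) * J powr \<nu>" by (simp only: LB_def)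
      define d where "d = c2 / 4"
      have "d \<ge> 0" using pos by (simp add: d_def)
      then show ?thesis
        unfolding LB d_def[symmetric] using q0 J1 by (simp add: powr_mult powr_powr)
    qed
    have rhs: "(C8 * (real q * J powr (k\<^sup>2 + 1))) powr (k - 1) = C8 powr \<beta> * (real q powr \<beta> * J powr ((k\<^sup>2 + 1) * \<beta>))"
      unfolding \<beta>_def[symmetric] using pos q0 J1 by (simp add: powr_mult powr_powr)
    \<comment> \<open>Only this direction is needed, as log q enters the lower bound with a
      nonnegative exponent.\<close>
    have lnJ: "ln (real q) \<le> 2 ^ Suc r * J"
    proof -
      have "real q \<le> real (2 ^ 2 ^ Suc M)" using PM unfolding P_def by (simp only: of_nat_le_iff less_imp_le)
      then have "ln (real q) \<le> ln (2 ^ 2 ^ Suc M)" using q0 by simp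
      also have "\<dots> = 2 ^ Suc M * ln 2" by (simp add: ln_realpow)
      also have "\<dots> \<le> 2 ^ Suc M" using ln_2_less_1 by simp
      finally show ?thesis unfolding J' .
    qed
    have "c * (real q powr ((1 / 2 + real \<kappa>) * k) * ln (real q) powr ((k - 1)\<^sup>2)) * real q
        \<le> c * (real q powr ((1 / 2 + real \<kappa>) * k) * (2 ^ Suc r * J) powr \<beta>\<^sup>2) * real q"
      unfolding \<beta>_def[symmetric] using lnJ c q3
      by (intro mult_right_mono mult_left_mono powr_mono2) auto
    also have "\<dots> = (c2 / 4) powr k / C8 powr \<beta> * (real q powr ((1 / 2 + real \<kappa>) * k) * J powr \<beta>\<^sup>2) * real q"
    proof -
      have "(2 ^ Suc r * J) powr \<beta>\<^sup>2 = (2 ^ Suc r) powr \<beta>\<^sup>2 * J powr \<beta>\<^sup>2" by (rule powr_mult)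
      moreover have "((2::real) ^ Suc r) powr \<beta>\<^sup>2 > 0" by simp
      ultimately show ?thesis unfolding c_def by (simp del: power_Suc)
    qed
    also have "\<dots> = (c2 / 4 * LB) powr k / (C8 * (real q * J powr (k\<^sup>2 + 1))) powr (k - 1)"
    proof -
      have e: "real q powr k = real q powr \<beta> * real q" using q0 by (simp add: k\<beta> powr_add)
      \<comment> \<open>The exponent identity behind (k - 1)^2: dividing J^(nu k) by J^((k^2 + 1)
        beta) leaves J^(beta^2).\<close>
      have f: "J powr (\<nu> * k) = J powr ((k\<^sup>2 + 1) * \<beta>) * J powr \<beta>\<^sup>2"
      proof -
        have "\<nu> * k = (k\<^sup>2 + 1) * \<beta> + \<beta>\<^sup>2" by (simp add: \<nu>_def k\<beta> power2_eq_square algebra_simps)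
        then show ?thesis by (simp add: powr_add)
      qed
      have "real q powr \<beta> > 0" "J powr ((k\<^sup>2 + 1) * \<beta>) > 0" "C8 powr \<beta> > 0" using q0 J1 pos by auto
      then show ?thesis unfolding lhs rhs e f by (simp add: field_simps)
    qed
    also have "\<dots> \<le> F"
    proof -
      have "(C8 * (real q * J powr (k\<^sup>2 + 1))) powr (k - 1) > 0" using pos q0 J1 by simp
      then show ?thesis using hol by (simp add: pos_divide_le_eq)
    qed
    finally have "c * (real q powr ((1 / 2 + real \<kappa>) * k) * ln (real q) powr ((k - 1)\<^sup>2)) \<le> 1 / real q * F"
      using q0 by (simp add: pos_le_divide_eq)
    also have "\<dots> \<le> 1 / real (totient q) * F"
    proof (rule mult_right_mono[OF _ F0])
      have "0 < totient q" "totient q \<le> q" using q0 by (auto simp: totient_le)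
      then show "1 / real q \<le> 1 / real (totient q)" by (intro divide_left_mono) auto
    qed
    finally show ?thesis unfolding F_def .
  qed
  show ?thesis by (intro exI[of _ c] exI[of _ q1] conjI allI impI c main)
qed

theorem theorem1p2:
  shows "\<exists>q\<^sub>0::nat. \<forall>k::real. k \<ge> 2 \<longrightarrow> (\<exists>c::real. c > 0 \<and>
    (\<forall>q::nat. prime q \<and> q \<ge> q\<^sub>0 \<longrightarrow>
       1 / real (totient q) *
         (\<Sum>chi \<in> even_characters q - {principal_character q}. cmod (theta q 1 chi) powr (2 * k))
         \<ge> c * (real q powr (k / 2) * ln (real q) powr ((k - 1)\<^sup>2)) \<and>
       1 / real (totient q) *
         (\<Sum>chi \<in> odd_characters q. cmod (theta q 1 chi) powr (2 * k))
         \<ge> c * (real q powr (3 * k / 2) * ln (real q) powr ((k - 1)\<^sup>2))))"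
proof -
  define X :: "nat \<Rightarrow> nat \<Rightarrow> (int \<Rightarrow> complex) set"
    where "X q \<kappa> = (if \<kappa> = 0 then even_characters q else odd_characters q)" for q \<kappa>
  define lower where "lower k q \<kappa> = real q powr ((1 / 2 + real \<kappa>) * k) * ln (real q) powr ((k - 1)\<^sup>2)" for k q \<kappa>
  define moment where "moment k q \<kappa> = 1 / real (totient q) *
      (\<Sum>chi\<in>X q \<kappa> - {principal_character q}. cmod (theta q 1 chi) powr (2 * k))" for k q \<kappa>
  have large: "\<exists>c>0. \<exists>q1::nat. \<forall>q. prime q \<longrightarrow> q \<ge> q1 \<longrightarrow> (\<forall>\<kappa>\<in>{0, 1}. c * lower k q \<kappa> \<le> moment k q \<kappa>)"
    if k: "k \<ge> 2" for k
  proof -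
    from theta_moment_lower_bound[OF k] obtain c and q1 :: nat where "c > 0" and
      *: "\<And>q Y \<kappa>. prime q \<Longrightarrow> q \<ge> q1 \<Longrightarrow> parity_exponent q Y \<kappa> \<Longrightarrow>
       c * (real q powr ((1 / 2 + real \<kappa>) * k) * ln (real q) powr ((k - 1)\<^sup>2))
      \<le> 1 / real (totient q) * (\<Sum>chi\<in>Y - {principal_character q}. cmod (theta q 1 chi) powr (2 * k))"
      by metis
    have "parity_exponent q (X q \<kappa>) \<kappa>" if "\<kappa> \<in> {0, 1}" for q \<kappa>
      using that by (auto simp: parity_exponent_def X_def)
    then show ?thesis
      using * \<open>c > 0\<close> unfolding lower_def moment_def by metis
  qed
  obtain c2 q0 where c2: "c2 > (0::real)"
    and q0: "\<And>q \<kappa>. prime q \<Longrightarrow> q \<ge> (q0::nat) \<Longrightarrow> \<kappa> \<in> {0, 1} \<Longrightarrow> c2 * lower 2 q \<kappa> \<le> moment 2 q \<kappa>"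
    using large[of 2] by auto
  text \<open>The threshold for \<open>k = 2\<close> serves for all \<open>k\<close>: a positive fourth moment yields a nonvanishing value,
    which bounds the other moments below for the finitely many primes under the threshold for \<open>k\<close>.\<close>
  have positive: "moment k q \<kappa> > 0" if q: "prime q" "q \<ge> q0" and \<kappa>: "\<kappa> \<in> {0, 1}" for k q \<kappa>
  proof -
    have q1: "real q > 1" using prime_gt_1_nat[OF q(1)] by simp
    have fin: "finite (X q \<kappa>)"
      using finite_even_odd_characters[of q] prime_gt_0_nat[OF q(1)] by (simp add: X_def)
    have "lower 2 q \<kappa> > 0" using q1 by (simp add: lower_def)
    then have "0 < c2 * lower 2 q \<kappa>" using c2 by simp
    then have "moment 2 q \<kappa> > 0" using q0[OF q \<kappa>] by linarith
    then have "(\<Sum>chi\<in>X q \<kappa> - {principal_character q}. cmod (theta q 1 chi) powr (2 * 2)) \<noteq> 0"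
      unfolding moment_def by auto
    then obtain chi where chi: "chi \<in> X q \<kappa> - {principal_character q}" "cmod (theta q 1 chi) powr (2 * 2) \<noteq> 0"
      by (meson sum.not_neutral_contains_not_neutral)
    then have "0 < cmod (theta q 1 chi) powr (2 * k)" by simp
    then have "0 < (\<Sum>chi\<in>X q \<kappa> - {principal_character q}. cmod (theta q 1 chi) powr (2 * k))"
      using fin by (intro sum_pos2[OF _ chi(1)]) auto
    then show ?thesis using prime_gt_0_nat[OF q(1)] by (simp add: moment_def)
  qed
  have all: "\<exists>c>0. \<forall>q. prime q \<and> q \<ge> q0 \<longrightarrow> (\<forall>\<kappa>\<in>{0, 1}. c * lower k q \<kappa> \<le> moment k q \<kappa>)" if k: "k \<ge> 2" for k
  proof -
    obtain c q1 where c: "c > 0" and q1: "\<And>q \<kappa>. prime q \<Longrightarrow> q \<ge> (q1::nat) \<Longrightarrow> \<kappa> \<in> {0, 1} \<Longrightarrow> c * lower k q \<kappa> \<le> moment k q \<kappa>"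
      using large[OF k] by blast
    define B where "B = {q. prime q \<and> q \<ge> q0 \<and> q < q1} \<times> {0, 1::nat}"
    have finB: "finite B" unfolding B_def by (intro finite_cartesian_product) auto
    \<comment> \<open>The worst ratio among the finitely many primes below the threshold for
      \<open>k\<close>. Inserting \<open>c\<close> keeps the set nonempty and covers the larger
      primes.\<close>
    define c' where "c' = Min (insert c ((\<lambda>(q, \<kappa>). moment k q \<kappa> / lower k q \<kappa>) ` B))"
    have low: "lower k q \<kappa> > 0" if "prime q" for q \<kappa>
      using prime_gt_1_nat[OF that] by (simp add: lower_def)
    have "c' > 0"
      unfolding c'_def using finB c positive low by (auto simp: B_def intro!: divide_pos_pos)
    moreover have "c' * lower k q \<kappa> \<le> moment k q \<kappa>" if q: "prime q" "q \<ge> q0" and \<kappa>: "\<kappa> \<in> {0, 1}" for q \<kappa>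
    proof (cases "q \<ge> q1")
      case True
      have "c' \<le> c" unfolding c'_def using finB by (intro Min_le) auto
      then have "c' * lower k q \<kappa> \<le> c * lower k q \<kappa>" using low[OF q(1), of \<kappa>] by (intro mult_right_mono) auto
      then show ?thesis using q1[OF q(1) True \<kappa>] by linarith
    next
      case False
      then have "(q, \<kappa>) \<in> B" using q \<kappa> by (simp add: B_def)
      then have "c' \<le> moment k q \<kappa> / lower k q \<kappa>" unfolding c'_def using finB by (intro Min_le) force+
      then show ?thesis using low[OF q(1), of \<kappa>] by (simp add: pos_le_divide_eq)
    qed
    ultimately show ?thesis by blast
  qed
  \<comment> \<open>The principal character takes the value 1 at -1, so removing it from the odd
    class changes nothing and both parities fit one statement.\<close>
  have odd: "odd_characters q - {principal_character q} = odd_characters q" for q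
    by (auto simp: odd_characters_def principal_character_def)
  have half: "(1 / 2 + real 0) * k = k / 2" "(1 / 2 + real 1) * k = 3 * k / 2" for k :: real by auto
  show ?thesis
  proof (intro exI[of _ q0] allI impI)
    fix k :: real assume "k \<ge> 2"
    then obtain c where c: "c > 0" "\<And>q \<kappa>. prime q \<Longrightarrow> q \<ge> q0 \<Longrightarrow> \<kappa> \<in> {0, 1} \<Longrightarrow> c * lower k q \<kappa> \<le> moment k q \<kappa>"
      using all by blast
    have "c * lower k q 0 \<le> moment k q 0" "c * lower k q 1 \<le> moment k q 1" if "prime q" "q \<ge> q0" for q
      using c(2)[OF that] by auto
    then show "\<exists>c::real. c > 0 \<and>
    (\<forall>q::nat. prime q \<and> q \<ge> q0 \<longrightarrow>
       1 / real (totient q) *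
         (\<Sum>chi \<in> even_characters q - {principal_character q}. cmod (theta q 1 chi) powr (2 * k))
         \<ge> c * (real q powr (k / 2) * ln (real q) powr ((k - 1)\<^sup>2)) \<and>
       1 / real (totient q) *
         (\<Sum>chi \<in> odd_characters q. cmod (theta q 1 chi) powr (2 * k))
         \<ge> c * (real q powr (3 * k / 2) * ln (real q) powr ((k - 1)\<^sup>2)))"
      using c(1) unfolding lower_def moment_def half X_def by (auto simp: odd)
  qed
qed

end
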